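(* Let $X$ be an SCLCS and let $n\ge2$. Suppose that $a\in L^1_{loc}([0,\infty)^n)$, $f\in L^1_{loc}([0,\infty)^n:X)$ and $(\lambda_1,\dots,\lambda_n)\in\Omega_{abs}(a)\cap\Omega_{abs}(f)$. (i) If $X$ is a Fréchet space, then $a\ast_0f\in L^1_{loc}([0,+\infty)^n:X)$ and $$\bigl(\mathcal L(a\ast_0f)\bigr)(\lambda_1,\dots,\lambda_n)=(\mathcal La)(\lambda_1,\dots,\lambda_n)\cdot(\mathcal Lf)(\lambda_1,\dots,\lambda_n).\qquad(\ast)$$ (ii) If, in addition to the initial assumptions ($X$ a general SCLCS), $a\in C([0,\infty)^n)$ or $f\in C([0,\infty)^n:X)$, then $a\ast_0f\in L^1_{loc}([0,\infty)^n:X)$ and $(\ast)$ holds.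
   Context: An SCLCS is a Hausdorff sequentially complete locally convex space over $\mathbb C$; $\circledast$ denotes a fundamental system of seminorms defining the topology of $X$. Integration (with respect to Lebesgue measure): for a compact set $K$, a function $f:K\to X$ is integrable if there is a sequence $(f_k)$ of simple functions with $f_k(t)\to f(t)$ for a.e. $t\in K$ and such that for every $\epsilon>0$ and $p\in\circledast$ there is $k_0$ with $\int_K p(f_k-f_m)\le\epsilon$ for all $k,m\ge k_0$; then $\int_K f:=\lim_k\int_K f_k$. A function $f:[0,+\infty)^n\to X$ is locally integrable, written $f\in L^1_{loc}([0,\infty)^n:X)$, if its restriction to every compact subset is integrable; $L^1_{loc}([0,\infty)^n)$ is the scalar-valued case. (For Fréchet $X$ this agrees with Bochner integration.) For locally integrable $f$ and $\lambda=(\lambda_1,\dots,\lambda_n)\in\mathbb C^n$, the Laplace integral is the joint limit $$(\mathcal Lf)(\lambda):=\lim_{t_1\to+\infty;\dots;t_n\to+\infty}\int_0^{t_1}\!\!\cdots\int_0^{t_n}e^{-\lambda_1s_1-\dots-\lambda_ns_n}f(s_1,\dots,s_n)\,ds_1\cdots ds_n$$ in $X$, when it exists; an equality involving $(\mathcal Lf)(\lambda)$ includes the assertion that it exists. $\Omega_{abs}(f)$ is the set of all $\lambda$ with $\int_{[0,+\infty)^n}p(e^{-\lambda_1t_1-\dots-\lambda_nt_n}f(t_1,\dots,t_n))\,dt_1\cdots dt_n<+\infty$ for every $p\in\circledast$ (for scalar functions, $p=|\cdot|$); for such $\lambda$ the Laplace integral exists. The convolution is $$(a\ast_0f)(x):=\int_0^{x_1}\!\!\cdots\int_0^{x_n}a(x_1-s_1,\dots,x_n-s_n)f(s_1,\dots,s_n)\,ds_1\cdots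 ds_n,\quad x=(x_1,\dots,x_n)\in[0,\infty)^n$$ (in the Fréchet case it is defined for a.e. $x$). *)

theory Defs
  imports "HOL-Analysis.Analysis"
begin

section \<open>Sequentially complete locally convex spaces over the complex numbers\<close>

class scaleC = scaleR +
  fixes scaleC :: "complex \<Rightarrow> 'a \<Rightarrow> 'a" (infixr \<open>*\<^sub>C\<close> 75)
  assumes scaleR_scaleC: "scaleR r = scaleC (complex_of_real r)"

class complex_vector = scaleC + ab_group_add +
  assumes scaleC_add_right: "c *\<^sub>C (x + y) = c *\<^sub>C x + c *\<^sub>C y"
    and scaleC_add_left: "(c + d) *\<^sub>C x = c *\<^sub>C x + d *\<^sub>C x"
    and scaleC_scaleC: "c *\<^sub>C (d *\<^sub>C x) = (c * d) *\<^sub>C x"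
    and scaleC_one: "1 *\<^sub>C x = x"

subclass (in complex_vector) real_vector
  by standard
    (simp_all add: scaleR_scaleC scaleC_add_right scaleC_add_left scaleC_scaleC scaleC_one)

class complex_tvs = complex_vector + topological_ab_group_add +
  assumes tendsto_scaleC_Pair:
    "LIM z (nhds c \<times>\<^sub>F nhds x). fst z *\<^sub>C snd z :> nhds (c *\<^sub>C x)"

text \<open>The condition on \<open>V\<close> in \<open>locally_convex\<close> is \<open>convex V\<close>, written out because the
  constant \<open>convex\<close> is not available inside a class specification.
  The filter condition in \<open>seq_complete\<close> says that \<open>u\<close> is a Cauchy sequence for the
  uniformity of the topological group: every neighbourhood of 0 contains \<open>u m - u n\<close> for all
  sufficiently large \<open>m\<close> and \<open>n\<close>.\<close>

class sclcs = complex_tvs + t2_space +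
  assumes locally_convex:
    "open U \<Longrightarrow> 0 \<in> U \<Longrightarrow> \<exists>V. open V \<and> 0 \<in> V \<and> V \<subseteq> U \<and>
      (\<forall>x\<in>V. \<forall>y\<in>V. \<forall>r\<ge>0. \<forall>s\<ge>0. r + s = 1 \<longrightarrow> r *\<^sub>R x + s *\<^sub>R y \<in> V)"
    and seq_complete:
    "LIM (m, n) (sequentially \<times>\<^sub>F sequentially). u m - u n :> nhds 0 \<Longrightarrow>
      \<exists>l. filterlim u (nhds l) sequentially"

lemma locally_convex_convex:
  fixes U :: "'a::sclcs set"
  assumes "open U" "0 \<in> U"
  shows "\<exists>V. open V \<and> 0 \<in> V \<and> convex V \<and> V \<subseteq> U"
  using locally_convex[OF assms] unfolding convex_def by blast

text \<open>The scalar-valued case of all notions below is the case of the space \<open>complex\<close>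
  with the single seminorm \<open>norm\<close>.\<close>

instantiation complex :: complex_vector
begin

definition scaleC_complex :: "complex \<Rightarrow> complex \<Rightarrow> complex" where
  "scaleC_complex c z = c * z"

instance
  by standard (auto simp: scaleC_complex_def fun_eq_iff scaleR_conv_of_real algebra_simps)

end

instance complex :: complex_tvs
proof
  fix c x :: complex
  show "LIM z (nhds c \<times>\<^sub>F nhds x). fst z *\<^sub>C snd z :> nhds (c *\<^sub>C x)"
    unfolding scaleC_complex_def nhds_prod[symmetric]
    by (intro tendsto_mult tendsto_fst[where a = "(c, x)", simplified]
        tendsto_snd[where a = "(c, x)", simplified] filterlim_ident)
qed

instance complex :: sclcs
proof
  fix U :: "complex set"
  assume "open U" "0 \<in> U"
  then obtain e where "e > 0" "ball 0 e \<subseteq> U"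
    using open_contains_ball by blast
  moreover have "convex (ball (0::complex) e)" by simp
  ultimately show "\<exists>V. open V \<and> 0 \<in> V \<and> V \<subseteq> U \<and>
      (\<forall>x\<in>V. \<forall>y\<in>V. \<forall>r\<ge>0. \<forall>s\<ge>0. r + s = 1 \<longrightarrow> r *\<^sub>R x + s *\<^sub>R y \<in> V)"
    unfolding convex_def by (intro exI[of _ "ball 0 e"] conjI) auto
next
  fix u :: "nat \<Rightarrow> complex"
  assume *: "LIM (m, n) (sequentially \<times>\<^sub>F sequentially). u m - u n :> nhds 0"
  have "Cauchy u"
  proof (rule metric_CauchyI)
    fix e :: real
    assume "e > 0"
    with * have "\<forall>\<^sub>F z in sequentially \<times>\<^sub>F sequentially. dist (case z of (m, n) \<Rightarrow> u m - u n) 0 < e"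
      by (rule tendstoD)
    then obtain M where "\<forall>m\<ge>M. \<forall>n\<ge>M. dist (u m - u n) 0 < e"
      unfolding eventually_prod_sequentially by auto
    then show "\<exists>M. \<forall>m\<ge>M. \<forall>n\<ge>M. dist (u m) (u n) < e"
      by (auto simp: dist_norm)
  qed
  then show "\<exists>l. u \<longlonglongrightarrow> l"
    using Cauchy_convergent_iff convergent_def by blast
qed

definition seminorm :: "('a::complex_vector \<Rightarrow> real) \<Rightarrow> bool" where
  "seminorm p \<longleftrightarrow> (\<forall>x. 0 \<le> p x) \<and> (\<forall>x y. p (x + y) \<le> p x + p y) \<and>
    (\<forall>c x. p (c *\<^sub>C x) = cmod c * p x)"

text \<open>\<open>P\<close> is a family of seminorms that defines the topology; it is not required to be
  directed, hence the finite subfamilies.\<close>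

definition fundamental_seminorms :: "('a::complex_tvs \<Rightarrow> real) set \<Rightarrow> bool" where
  "fundamental_seminorms P \<longleftrightarrow>
    (\<forall>p\<in>P. seminorm p \<and> continuous_on UNIV p) \<and>
    (\<forall>U. open U \<and> 0 \<in> U \<longrightarrow>
      (\<exists>F e. finite F \<and> F \<subseteq> P \<and> e > 0 \<and> {x. \<forall>p\<in>F. p x < e} \<subseteq> U))"

lemma fundamental_seminorms_complex: "fundamental_seminorms {cmod}"
  unfolding fundamental_seminorms_def
proof (intro conjI allI impI)
  show "\<forall>p\<in>{cmod}. seminorm p \<and> continuous_on UNIV p"
    by (auto simp: seminorm_def scaleC_complex_def norm_mult norm_triangle_ineq
        intro!: continuous_intros)
next
  fix U :: "complex set"
  assume "open U \<and> 0 \<in> U"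
  then obtain e where "e > 0" "ball 0 e \<subseteq> U"
    using open_contains_ball by blast
  then show "\<exists>F e. finite F \<and> F \<subseteq> {cmod} \<and> e > 0 \<and> {x. \<forall>p\<in>F. p x < e} \<subseteq> U"
    by (intro exI[of _ "{cmod}"] exI[of _ e]) (auto simp: ball_def)
qed

text \<open>A Frechet space is a locally convex space whose topology is induced by a complete
  translation-invariant metric.\<close>

definition frechet_space :: "'a::sclcs itself \<Rightarrow> bool" where
  "frechet_space _ \<longleftrightarrow>
    (\<exists>d :: 'a \<Rightarrow> 'a \<Rightarrow> real. Metric_space UNIV d \<and> (\<forall>x y z. d (x + z) (y + z) = d x y) \<and>
      Metric_space.mtopology UNIV d = euclidean \<and> Metric_space.mcomplete UNIV d)"


section \<open>Integration\<close>

text \<open>In what follows \<open>P\<close> is a fundamental system of seminorms on the target space.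
  On \<open>real ^ 'n\<close> the order is componentwise: \<open>{0..}\<close> is the closed orthant,
  \<open>{0..t}\<close> is a box, and the filter \<open>at_top\<close> describes all coordinates tending jointly
  (and independently) to infinity.\<close>

definition approx_simple ::
  "('a::sclcs \<Rightarrow> real) set \<Rightarrow> (real ^ 'n) set \<Rightarrow> (real ^ 'n \<Rightarrow> 'a) \<Rightarrow> (nat \<Rightarrow> real ^ 'n \<Rightarrow> 'a) \<Rightarrow> bool"
where
  "approx_simple P K f s \<longleftrightarrow>
    (\<forall>k. simple_function (lebesgue_on K) (s k)) \<and>
    (AE t in lebesgue_on K. (\<lambda>k. s k t) \<longlonglongrightarrow> f t) \<and>
    (\<forall>p\<in>P. \<forall>e>0. \<exists>k0. \<forall>k\<ge>k0. \<forall>m\<ge>k0. (\<integral>t. p (s k t - s m t) \<partial>lebesgue_on K) \<le> e)"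

definition sc_integrable ::
  "('a::sclcs \<Rightarrow> real) set \<Rightarrow> (real ^ 'n) set \<Rightarrow> (real ^ 'n \<Rightarrow> 'a) \<Rightarrow> bool" where
  "sc_integrable P K f \<longleftrightarrow> (\<exists>s. approx_simple P K f s)"

text \<open>The limit of the integrals exists by sequential completeness and does not depend on
  the approximating sequence.\<close>

definition sc_integral ::
  "('a::sclcs \<Rightarrow> real) set \<Rightarrow> (real ^ 'n) set \<Rightarrow> (real ^ 'n \<Rightarrow> 'a) \<Rightarrow> 'a" where
  "sc_integral P K f =
    (THE I. \<exists>s. approx_simple P K f s \<and>
      (\<lambda>k. Bochner_Integration.simple_bochner_integral (lebesgue_on K) (s k)) \<longlonglongrightarrow> I)"

definition L1_loc :: "('a::sclcs \<Rightarrow> real) set \<Rightarrow> (real ^ 'n \<Rightarrow> 'a) set" where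
  "L1_loc P = {f. \<forall>K. compact K \<and> K \<subseteq> {0..} \<longrightarrow> sc_integrable P K f}"


section \<open>Laplace transform and convolution\<close>

definition laplace_kernel :: "complex ^ 'n \<Rightarrow> real ^ 'n \<Rightarrow> complex" where
  "laplace_kernel l t = exp (- (\<Sum>i\<in>UNIV. l $ i * complex_of_real (t $ i)))"

definition laplace_partial ::
  "('a::sclcs \<Rightarrow> real) set \<Rightarrow> (real ^ 'n \<Rightarrow> 'a) \<Rightarrow> complex ^ 'n \<Rightarrow> real ^ 'n \<Rightarrow> 'a" where
  "laplace_partial P f l t = sc_integral P {0..t} (\<lambda>s. laplace_kernel l s *\<^sub>C f s)"

definition laplace_exists ::
  "('a::sclcs \<Rightarrow> real) set \<Rightarrow> (real ^ 'n \<Rightarrow> 'a) \<Rightarrow> complex ^ 'n \<Rightarrow> bool" where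
  "laplace_exists P f l \<longleftrightarrow> (\<exists>L. (laplace_partial P f l \<longlongrightarrow> L) at_top)"

definition laplace ::
  "('a::sclcs \<Rightarrow> real) set \<Rightarrow> (real ^ 'n \<Rightarrow> 'a) \<Rightarrow> complex ^ 'n \<Rightarrow> 'a" where
  "laplace P f l = Lim at_top (laplace_partial P f l)"

definition Omega_abs ::
  "('a::sclcs \<Rightarrow> real) set \<Rightarrow> (real ^ 'n \<Rightarrow> 'a) \<Rightarrow> (complex ^ 'n) set" where
  "Omega_abs P f =
    {l. \<forall>p\<in>P. (\<integral>\<^sup>+t. ennreal (p (laplace_kernel l t *\<^sub>C f t)) \<partial>lebesgue_on {0..}) < \<infinity>}"

definition conv_defined_at ::
  "('a::sclcs \<Rightarrow> real) set \<Rightarrow> (real ^ 'n \<Rightarrow> complex) \<Rightarrow> (real ^ 'n \<Rightarrow> 'a) \<Rightarrow> real ^ 'n \<Rightarrow> bool" where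
  "conv_defined_at P a f x \<longleftrightarrow> sc_integrable P {0..x} (\<lambda>s. a (x - s) *\<^sub>C f s)"

definition conv0 ::
  "('a::sclcs \<Rightarrow> real) set \<Rightarrow> (real ^ 'n \<Rightarrow> complex) \<Rightarrow> (real ^ 'n \<Rightarrow> 'a) \<Rightarrow> real ^ 'n \<Rightarrow> 'a" where
  "conv0 P a f x = sc_integral P {0..x} (\<lambda>s. a (x - s) *\<^sub>C f s)"

end

theory Submission
  imports Defs
begin

text \<open>Absorbing the exponential weight into \<open>a\<close> and \<open>f\<close> (functions \<open>A\<close> and \<open>F\<close>) reduces everything
  to the case \<open>\<lambda> = 0\<close> with \<open>A\<close> and every \<open>p \<circ> F\<close> Lebesgue integrable over the orthant. By Tonelli,
  \<open>\<integral> p (A * F - A * G) \<le> \<parallel>A\<parallel>\<^sub>1 \<integral> p (F - G)\<close> for every seminorm \<open>p\<close>, and for a step function \<open>G\<close> the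
  convolution is a finite combination of scalar convolutions, for which the product formula is the
  classical Fubini argument. Since step functions are dense with respect to every single seminorm,
  the formula follows by density without vector-valued Fubini or duality.
  What remains is the integrability of the convolution. In a Frechet space countably many
  seminorms suffice, so a rapidly converging sequence of step functions converges almost everywhere
  as well. If one factor is continuous, then so is the convolution, and it is the pointwise limit of
  its values at the grid points below the argument.\<close>

text \<open>Integrability asks for one sequence of simple functions that converges almost everywhere
  and serves all seminorms at once, whereas density of step functions provides a separate sequence
  for each seminorm. This mismatch shapes the proof: a limit of integrals can be tested against one
  seminorm at a time, but the existence of the integrals needs a common sequence. The Laplace limit
  is a net over all boxes, while completeness and dominated convergence speak of sequences. The
  cubes with corner \<open>vec k\<close> mediate: the tail of an absolutely convergent integral
  outside such a cube controls all larger boxes. Only the compositions of a vector-valued function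
  with seminorms are treated as measurable functions; completeness of the measure supplies this from
  a.e. limits of simple functions. Since \<open>P\<close> need not be directed, the Frechet case
  passes to the finite sums of its members, which leaves integrability and integrals
  unchanged.\<close>

lemma scaleC_minus_one: "(-1) *\<^sub>C x = - (x::'a::complex_vector)"
  using scaleR_scaleC[where 'a='a, of "-1"] by (metis of_real_1 of_real_minus scaleR_minus1_left)

lemma scaleC_zero_left: "0 *\<^sub>C x = (0::'a::complex_vector)"
  using scaleR_scaleC[where 'a='a, of 0] by (metis of_real_0 scaleR_zero_left)

lemma scaleC_diff_right: "c *\<^sub>C (x - y) = c *\<^sub>C x - c *\<^sub>C (y::'a::complex_vector)"
  using scaleC_add_right[of c "x - y" y] by (simp add: algebra_simps)

lemma scaleC_zero_right: "c *\<^sub>C 0 = (0::'a::complex_vector)"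
  using scaleC_add_right[of c 0 "0::'a"] by simp

lemma scaleC_diff_left: "(c - d) *\<^sub>C x = c *\<^sub>C x - d *\<^sub>C (x::'a::complex_vector)"
  using scaleC_add_left[of "c - d" d x] by (simp add: algebra_simps)

lemma tendsto_scaleC:
  fixes c :: "'x \<Rightarrow> complex" and u :: "'x \<Rightarrow> 'a::complex_tvs"
  shows "(c \<longlongrightarrow> c0) F \<Longrightarrow> (u \<longlongrightarrow> u0) F \<Longrightarrow> ((\<lambda>x. c x *\<^sub>C u x) \<longlongrightarrow> c0 *\<^sub>C u0) F"
  using filterlim_compose[OF tendsto_scaleC_Pair, of "\<lambda>x. (c x, u x)" c0 u0 F]
  by (simp add: nhds_prod[symmetric] tendsto_Pair)

section \<open>Integration over complete finite measure spaces\<close>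

text \<open>The mean condition refers to the limit \<open>g\<close> instead of pairs of members of
  the sequence; \<open>approx_simple_iff\<close> shows that both forms agree. The nonnegative
  integral is meaningful before anything is known about integrability of
  \<open>p (g t - s k t)\<close>.\<close>

definition simple_approx ::
  "('a::sclcs \<Rightarrow> real) set \<Rightarrow> 'b measure \<Rightarrow> ('b \<Rightarrow> 'a) \<Rightarrow> (nat \<Rightarrow> 'b \<Rightarrow> 'a) \<Rightarrow> bool" where
  "simple_approx P M g s \<longleftrightarrow>
    (\<forall>k. simple_function M (s k)) \<and> (AE t in M. (\<lambda>k. s k t) \<longlonglongrightarrow> g t) \<and>
    (\<forall>p\<in>P. (\<lambda>k. \<integral>\<^sup>+t. ennreal (p (g t - s k t)) \<partial>M) \<longlonglongrightarrow> 0)"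

abbreviation simple_integral :: "'b measure \<Rightarrow> ('b \<Rightarrow> 'a::real_vector) \<Rightarrow> 'a" where
  "simple_integral \<equiv> Bochner_Integration.simple_bochner_integral"

definition has_sint ::
  "('a::sclcs \<Rightarrow> real) set \<Rightarrow> 'b measure \<Rightarrow> ('b \<Rightarrow> 'a) \<Rightarrow> 'a \<Rightarrow> bool" where
  "has_sint P M g I \<longleftrightarrow>
    (\<exists>s. simple_approx P M g s \<and> (\<lambda>k. simple_integral M (s k)) \<longlonglongrightarrow> I)"

text \<open>The two preimages of a Borel set differ by a subset of a null set, which is measurable
  by completeness.\<close>

lemma (in complete_measure) borel_measurable_cong_AE:
  fixes f g :: "'a \<Rightarrow> 'c::topological_space"
  assumes f: "f \<in> borel_measurable M" and ae: "AE x in M. f x = g x"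
  shows "g \<in> borel_measurable M"
proof (rule measurableI)
  fix A :: "'c set" assume A: "A \<in> sets borel"
  show "g -` A \<inter> space M \<in> sets M"
  proof (rule in_sets_AE)
    show "f -` A \<inter> space M \<in> sets M" using f A by (rule measurable_sets)
    show "AE x in M. (x \<in> f -` A \<inter> space M) \<longleftrightarrow> (x \<in> g -` A \<inter> space M)"
      using ae by eventually_elim auto
  qed auto
qed auto

lemma (in complete_measure) borel_measurable_AE_LIMSEQ:
  fixes f :: "nat \<Rightarrow> 'a \<Rightarrow> 'c::{banach, second_countable_topology}"
  assumes [measurable]: "\<And>k. f k \<in> borel_measurable M"
    and ae: "AE x in M. (\<lambda>k. f k x) \<longlonglongrightarrow> g x"
  shows "g \<in> borel_measurable M"
proof (rule borel_measurable_cong_AE)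
  show "(\<lambda>x. lim (\<lambda>k. f k x)) \<in> borel_measurable M" by measurable
  show "AE x in M. lim (\<lambda>k. f k x) = g x"
    using ae by eventually_elim (rule limI)
qed

lemma complete_measure_restrict_space:
  assumes "complete_measure M" "S \<in> sets M"
  shows "complete_measure (restrict_space M S)"
proof
  fix A B assume "B \<subseteq> A" "A \<in> null_sets (restrict_space M S)"
  then have A: "A \<subseteq> S" "A \<in> null_sets M" by (simp_all add: null_sets_restrict_space assms(2))
  then have "B \<in> sets M" using complete_measure.complete[OF assms(1)] \<open>B \<subseteq> A\<close> by blast
  with A \<open>B \<subseteq> A\<close> show "B \<in> sets (restrict_space M S)"
    unfolding sets_restrict_space by (auto intro!: image_eqI[of _ _ B])
qed

lemma tendsto_ennreal_0_iff:
  "(\<And>x. 0 \<le> f x) \<Longrightarrow> ((\<lambda>x. ennreal (f x)) \<longlongrightarrow> 0) F \<longleftrightarrow> (f \<longlongrightarrow> 0) F"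
  using tendsto_ennreal_iff[of f F 0] by simp

lemma tendsto_0_ennreal_sandwich:
  fixes f g :: "'b \<Rightarrow> ennreal"
  assumes "\<forall>\<^sub>F x in F. f x \<le> g x" "(g \<longlongrightarrow> 0) F"
  shows "(f \<longlongrightarrow> 0) F"
  by (rule tendsto_sandwich[OF _ assms(1) tendsto_const assms(2)]) simp

section \<open>Calculus with a fundamental system of seminorms\<close>

locale seminorm_system =
  fixes P :: "('a::sclcs \<Rightarrow> real) set"
  assumes fund: "fundamental_seminorms P"
begin

lemma seminormP: "p \<in> P \<Longrightarrow> seminorm p"
  and continuousP: "p \<in> P \<Longrightarrow> continuous_on UNIV p"
  using fund unfolding fundamental_seminorms_def by auto

lemma nonneg [simp]: "p \<in> P \<Longrightarrow> 0 \<le> p x"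
  and triangle: "p \<in> P \<Longrightarrow> p (x + y) \<le> p x + p y"
  and scale: "p \<in> P \<Longrightarrow> p (c *\<^sub>C x) = cmod c * p x"
  using seminormP[of p] unfolding seminorm_def by simp_all

lemma scaleR: "p \<in> P \<Longrightarrow> p (r *\<^sub>R x) = \<bar>r\<bar> * p x"
  using scale[of p "complex_of_real r" x] by (simp add: scaleR_scaleC)

lemma zero [simp]: "p \<in> P \<Longrightarrow> p 0 = 0"
  using scaleR[of p 0 0] by simp

lemma minus [simp]: "p \<in> P \<Longrightarrow> p (- x) = p x"
  using scaleR[of p "-1" x] by simp

lemma minus_commute: "p \<in> P \<Longrightarrow> p (x - y) = p (y - x)"
  using minus[of p "x - y"] by simp

lemma triangle_diff: "p \<in> P \<Longrightarrow> p (x - y) \<le> p x + p y"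
  using triangle[of p x "-y"] by simp

lemma triangle_via: "p \<in> P \<Longrightarrow> p (x - z) \<le> p (x - y) + p (y - z)"
  using triangle[of p "x - y" "y - z"] by simp

lemma triangle_split: "p \<in> P \<Longrightarrow> p x \<le> p y + p (x - y)"
  using triangle[of p y "x - y"] by simp

lemma sum_le: "p \<in> P \<Longrightarrow> p (sum f A) \<le> (\<Sum>x\<in>A. p (f x))"
  by (induction A rule: infinite_finite_induct) (auto intro: order_trans[OF triangle])

lemma tendsto_seminorm: "p \<in> P \<Longrightarrow> (u \<longlongrightarrow> l) F \<Longrightarrow> ((\<lambda>x. p (u x)) \<longlongrightarrow> p l) F"
  using continuousP by (rule continuous_on_tendsto_compose) auto

lemma nhds_0:
  assumes "open U" "0 \<in> U"
  obtains Q e where "finite Q" "Q \<subseteq> P" "e > 0" "\<And>x. (\<And>p. p \<in> Q \<Longrightarrow> p x < e) \<Longrightarrow> x \<in> U"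
proof -
  obtain Q e where "finite Q" "Q \<subseteq> P" "e > 0" "{x. \<forall>p\<in>Q. p x < e} \<subseteq> U"
    using fund assms unfolding fundamental_seminorms_def by blast
  then show thesis by (intro that[of Q e]) auto
qed

text \<open>\<open>P\<close> need not be directed: a neighbourhood of 0 is cut out by finitely many
  seminorms, and finitely many eventual conditions hold jointly.\<close>

lemma tendsto_0I:
  assumes "\<And>p. p \<in> P \<Longrightarrow> ((\<lambda>x. p (u x)) \<longlongrightarrow> 0) F"
  shows "(u \<longlongrightarrow> 0) F"
proof (rule topological_tendstoI)
  fix U :: "'a set" assume "open U" "0 \<in> U"
  then obtain Q e where Q: "finite Q" "Q \<subseteq> P" "e > 0"
    "\<And>x. (\<And>p. p \<in> Q \<Longrightarrow> p x < e) \<Longrightarrow> x \<in> U" using nhds_0 by metis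
  have "\<forall>\<^sub>F x in F. \<forall>p\<in>Q. p (u x) < e"
    using Q(1-3) by (intro eventually_ball_finite) (auto intro!: order_tendstoD(2)[OF assms])
  then show "\<forall>\<^sub>F x in F. u x \<in> U" by eventually_elim (simp add: Q(4))
qed

lemma tendstoI_seminorm:
  assumes "\<And>p. p \<in> P \<Longrightarrow> ((\<lambda>x. p (u x - l)) \<longlongrightarrow> 0) F"
  shows "(u \<longlongrightarrow> l) F"
proof -
  have "((\<lambda>x. u x - l) \<longlongrightarrow> 0) F" using assms by (rule tendsto_0I)
  from tendsto_add[OF this tendsto_const[of l]] show ?thesis by simp
qed

lemma tendstoD_seminorm:
  assumes "p \<in> P" "(u \<longlongrightarrow> l) F"
  shows "((\<lambda>x. p (u x - l)) \<longlongrightarrow> 0) F" "((\<lambda>x. p (l - u x)) \<longlongrightarrow> 0) F"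
proof -
  have "((\<lambda>x. u x + - l) \<longlongrightarrow> l + - l) F" using assms(2) by (intro tendsto_add tendsto_const)
  from tendsto_seminorm[OF assms(1) this] show "((\<lambda>x. p (u x - l)) \<longlongrightarrow> 0) F"
    using assms(1) by simp
  then show "((\<lambda>x. p (l - u x)) \<longlongrightarrow> 0) F" using minus_commute[OF assms(1)] by simp
qed

text \<open>This is the Hausdorff property: the constant sequence at \<open>x\<close> also converges
  to 0.\<close>

lemma eq_0I:
  assumes "\<And>p. p \<in> P \<Longrightarrow> p x = 0"
  shows "x = 0"
proof -
  have "(\<lambda>n::nat. x) \<longlonglongrightarrow> 0" by (rule tendsto_0I) (simp add: assms)
  then show ?thesis using LIMSEQ_unique[OF tendsto_const] by metis
qed

lemma seq_complete_seminorm: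
  assumes "\<And>p e. p \<in> P \<Longrightarrow> e > 0 \<Longrightarrow> \<exists>k0. \<forall>k\<ge>k0. \<forall>m\<ge>k0. p (u k - u m) \<le> e"
  shows "\<exists>l. u \<longlonglongrightarrow> l"
proof (rule seq_complete)
  show "LIM (m, n) (sequentially \<times>\<^sub>F sequentially). u m - u n :> nhds 0"
  proof (rule tendsto_0I)
    fix p assume p: "p \<in> P"
    show "((\<lambda>x. p (case x of (m, n) \<Rightarrow> u m - u n)) \<longlongrightarrow> 0) (sequentially \<times>\<^sub>F sequentially)"
    proof (rule tendstoI)
      fix e :: real assume "e > 0"
      then obtain k0 where "\<forall>k\<ge>k0. \<forall>m\<ge>k0. p (u k - u m) \<le> e / 2"
        using assms[OF p, of "e / 2"] by auto
      then have "\<forall>k\<ge>k0. \<forall>m\<ge>k0. p (u k - u m) < e" using \<open>e > 0\<close> by fastforce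
      then show "\<forall>\<^sub>F x in sequentially \<times>\<^sub>F sequentially. dist (p (case x of (m, n) \<Rightarrow> u m - u n)) 0 < e"
        unfolding eventually_prod_sequentially using p by (intro exI[of _ k0]) auto
    qed
  qed
qed

lemma borel_measurable_seminorm_simple:
  "simple_function M s \<Longrightarrow> (\<lambda>t. p (s t)) \<in> borel_measurable M"
  by (intro borel_measurable_simple_function simple_function_compose1[of M s p])

text \<open>Measurability is obtained for the real function \<open>p (g t)\<close>, an a.e. limit of
  simple functions on a complete measure, and not for \<open>g\<close> as a map into the vector
  space.\<close>

lemma borel_measurable_seminorm:
  assumes "complete_measure M" "\<And>k. simple_function M (s k)"
    and "AE t in M. (\<lambda>k. s k t) \<longlonglongrightarrow> g t" "p \<in> P"
  shows "(\<lambda>t. p (g t)) \<in> borel_measurable M"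
proof (rule complete_measure.borel_measurable_AE_LIMSEQ[OF assms(1)])
  show "(\<lambda>t. p (s k t)) \<in> borel_measurable M" for k
    using assms(2) by (rule borel_measurable_seminorm_simple)
  show "AE t in M. (\<lambda>k. p (s k t)) \<longlonglongrightarrow> p (g t)"
    using assms(3) by eventually_elim (rule tendsto_seminorm[OF assms(4)])
qed

end

section \<open>The integral: existence, uniqueness, estimates, linearity\<close>

locale seminorm_system_measure = seminorm_system P + complete_measure M + finite_measure M
  for P :: "('a::sclcs \<Rightarrow> real) set" and M :: "'b measure"
begin

lemma simple_approxD:
  assumes "simple_approx P M g s"
  shows "\<And>k. simple_function M (s k)" "AE t in M. (\<lambda>k. s k t) \<longlonglongrightarrow> g t"
    "\<And>p. p \<in> P \<Longrightarrow> (\<lambda>k. \<integral>\<^sup>+t. ennreal (p (g t - s k t)) \<partial>M) \<longlonglongrightarrow> 0"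
  using assms unfolding simple_approx_def by auto

lemma simple_approx_measurable:
  assumes "simple_approx P M g s" "p \<in> P"
  shows "(\<lambda>t. p (g t)) \<in> borel_measurable M"
  using simple_approxD(1,2)[OF assms(1)] assms(2)
  by (rule borel_measurable_seminorm[OF complete_measure_axioms])

lemma simple_approx_measurable_diff:
  assumes "simple_approx P M g s" "simple_approx P M g' s'" "p \<in> P"
  shows "(\<lambda>t. p (g t - g' t)) \<in> borel_measurable M"
proof (rule borel_measurable_seminorm[OF complete_measure_axioms _ _ assms(3)])
  show "simple_function M (\<lambda>t. s k t - s' k t)" for k
    using simple_approxD(1)[OF assms(1)] simple_approxD(1)[OF assms(2)]
    by (rule simple_function_compose2)
  show "AE t in M. (\<lambda>k. s k t - s' k t) \<longlonglongrightarrow> g t - g' t"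
    using simple_approxD(2)[OF assms(1)] simple_approxD(2)[OF assms(2)]
  proof eventually_elim
    case (elim t)
    show ?case using tendsto_add[OF elim(1) tendsto_minus[OF elim(2)]] by simp
  qed
qed

lemma simple_approx_simple: "simple_function M s \<Longrightarrow> simple_approx P M s (\<lambda>_. s)"
  unfolding simple_approx_def by simp

lemma simple_approx_measurable_diff_simple:
  assumes "simple_approx P M g s" "simple_function M s'" "p \<in> P"
  shows "(\<lambda>t. p (g t - s' t)) \<in> borel_measurable M"
  using simple_approx_measurable_diff[OF assms(1) simple_approx_simple[OF assms(2)] assms(3)] .

lemma simple_bochner_integrable:
  fixes s :: "'b \<Rightarrow> 'c::real_vector"
  shows "simple_function M s \<Longrightarrow> Bochner_Integration.simple_bochner_integrable M s"
  by (rule Bochner_Integration.simple_bochner_integrable.intros) auto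

lemma simple_integral_le:
  assumes s: "simple_function M s" and p: "p \<in> P"
  shows "ennreal (p (simple_integral M s)) \<le> (\<integral>\<^sup>+t. ennreal (p (s t)) \<partial>M)"
proof -
  have ps: "simple_function M (\<lambda>t. p (s t))" using s by (rule simple_function_compose1)
  have "p (simple_integral M s)
      \<le> (\<Sum>y\<in>s`space M. measure M {x\<in>space M. s x = y} *\<^sub>R p y)"
    unfolding simple_bochner_integral_def
    by (rule order_trans[OF sum_le[OF p]]) (simp add: scaleR[OF p])
  also have "\<dots> = simple_integral M (\<lambda>t. p (s t))"
    using s ps by (intro simple_bochner_integral_partition[symmetric] simple_bochner_integrable) auto
  finally have "ennreal (p (simple_integral M s))
      \<le> ennreal (simple_integral M (\<lambda>t. p (s t)))"
    by (rule ennreal_leI)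
  also have "\<dots> = (\<integral>\<^sup>+t. ennreal (p (s t)) \<partial>M)"
    using ps p by (intro simple_bochner_integral_eq_nn_integral simple_bochner_integrable) auto
  finally show ?thesis .
qed

lemma nn_integral_seminorm_via:
  assumes "p \<in> P" "(\<lambda>t. p (f t - g t)) \<in> borel_measurable M" "(\<lambda>t. p (g t - h t)) \<in> borel_measurable M"
  shows "(\<integral>\<^sup>+t. ennreal (p (f t - h t)) \<partial>M)
    \<le> (\<integral>\<^sup>+t. ennreal (p (f t - g t)) \<partial>M) + (\<integral>\<^sup>+t. ennreal (p (g t - h t)) \<partial>M)"
proof -
  have "(\<integral>\<^sup>+t. ennreal (p (f t - h t)) \<partial>M) \<le> (\<integral>\<^sup>+t. ennreal (p (f t - g t)) + ennreal (p (g t - h t)) \<partial>M)"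
    using triangle_via[OF assms(1)] assms(1) by (intro nn_integral_mono) (simp flip: ennreal_plus)
  also have "\<dots> = (\<integral>\<^sup>+t. ennreal (p (f t - g t)) \<partial>M) + (\<integral>\<^sup>+t. ennreal (p (g t - h t)) \<partial>M)"
    using assms(2,3) by (intro nn_integral_add) auto
  finally show ?thesis .
qed

lemma simple_integral_diff_le:
  assumes "simple_approx P M g s" "simple_approx P M g s'" "p \<in> P"
  shows "ennreal (p (simple_integral M (s k) - simple_integral M (s' m)))
    \<le> (\<integral>\<^sup>+t. ennreal (p (g t - s k t)) \<partial>M) + (\<integral>\<^sup>+t. ennreal (p (g t - s' m t)) \<partial>M)"
proof -
  note s = simple_approxD(1)[OF assms(1), of k] and s' = simple_approxD(1)[OF assms(2), of m]
  have ds: "simple_function M (\<lambda>t. s k t - s' m t)" using s s' by (rule simple_function_compose2)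
  have "ennreal (p (simple_integral M (s k) - simple_integral M (s' m)))
      = ennreal (p (simple_integral M (\<lambda>t. s k t - s' m t)))"
    using s s' by (simp add: simple_bochner_integral_diff simple_bochner_integrable)
  also have "\<dots> \<le> (\<integral>\<^sup>+t. ennreal (p (s k t - s' m t)) \<partial>M)"
    by (rule simple_integral_le[OF ds assms(3)])
  also have "\<dots> \<le> (\<integral>\<^sup>+t. ennreal (p (s k t - g t)) \<partial>M) + (\<integral>\<^sup>+t. ennreal (p (g t - s' m t)) \<partial>M)"
    using simple_approx_measurable_diff_simple[OF assms(1) s assms(3)]
      simple_approx_measurable_diff_simple[OF assms(1) s' assms(3)]
    by (intro nn_integral_seminorm_via[OF assms(3)]) (auto simp: minus_commute[OF assms(3), of "s k _"])
  finally show ?thesis by (simp add: minus_commute[OF assms(3), of "s k _"])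
qed

lemma simple_approx_has_sint:
  assumes s: "simple_approx P M g s"
  shows "\<exists>I. (\<lambda>k. simple_integral M (s k)) \<longlonglongrightarrow> I"
proof (rule seq_complete_seminorm)
  fix p :: "'a \<Rightarrow> real" and e :: real assume p: "p \<in> P" and e: "e > 0"
  have "\<forall>\<^sub>F k in sequentially. (\<integral>\<^sup>+t. ennreal (p (g t - s k t)) \<partial>M) < ennreal (e / 2)"
    using simple_approxD(3)[OF s p] by (rule order_tendstoD(2)) (use e in simp)
  then obtain k0 where k0: "\<And>k. k \<ge> k0 \<Longrightarrow> (\<integral>\<^sup>+t. ennreal (p (g t - s k t)) \<partial>M) < ennreal (e / 2)"
    unfolding eventually_sequentially by blast
  have "p (simple_integral M (s k) - simple_integral M (s m)) \<le> e"
    if "k \<ge> k0" "m \<ge> k0" for k m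
  proof -
    have "ennreal (p (simple_integral M (s k) - simple_integral M (s m)))
        \<le> ennreal (e / 2) + ennreal (e / 2)"
      using simple_integral_diff_le[OF s s p, of k m] k0[OF that(1)] k0[OF that(2)]
      by (meson add_mono less_imp_le order_trans)
    also have "\<dots> = ennreal e" using e by (simp flip: ennreal_plus)
    finally show ?thesis using e by simp
  qed
  then show "\<exists>k0. \<forall>k\<ge>k0. \<forall>m\<ge>k0.
      p (simple_integral M (s k) - simple_integral M (s m)) \<le> e" by blast
qed

lemma simple_approx_sint_unique:
  assumes s: "simple_approx P M g s" and s': "simple_approx P M g s'"
    and I: "(\<lambda>k. simple_integral M (s k)) \<longlonglongrightarrow> I"
    and J: "(\<lambda>k. simple_integral M (s' k)) \<longlonglongrightarrow> J"
  shows "I = J"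
proof -
  have "I - J = 0"
  proof (rule eq_0I)
    fix p assume p: "p \<in> P"
    have "(\<lambda>k. p (simple_integral M (s k) - simple_integral M (s' k))) \<longlonglongrightarrow> p (I - J)"
      using tendsto_add[OF I tendsto_minus[OF J]] by (intro tendsto_seminorm[OF p]) simp
    moreover have "(\<lambda>k. p (simple_integral M (s k) - simple_integral M (s' k))) \<longlonglongrightarrow> 0"
    proof (subst tendsto_ennreal_0_iff[symmetric])
      have "(\<lambda>k. (\<integral>\<^sup>+t. ennreal (p (g t - s k t)) \<partial>M) + (\<integral>\<^sup>+t. ennreal (p (g t - s' k t)) \<partial>M)) \<longlonglongrightarrow> 0"
        using tendsto_add[OF simple_approxD(3)[OF s p] simple_approxD(3)[OF s' p]] by simp
      then show "(\<lambda>k. ennreal (p (simple_integral M (s k) - simple_integral M (s' k)))) \<longlonglongrightarrow> 0"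
        by (rule tendsto_0_ennreal_sandwich[OF always_eventually[OF allI[OF simple_integral_diff_le[OF s s' p]]]])
    qed (use p in simp)
    ultimately show "p (I - J) = 0" by (rule LIMSEQ_unique)
  qed
  then show ?thesis by simp
qed

lemma has_sint_unique: "has_sint P M g I \<Longrightarrow> has_sint P M g J \<Longrightarrow> I = J"
  unfolding has_sint_def using simple_approx_sint_unique by blast

lemma has_sint_ex: "simple_approx P M g s \<Longrightarrow> \<exists>I. has_sint P M g I"
  unfolding has_sint_def using simple_approx_has_sint by blast

lemma has_sint_simple:
  "simple_function M s \<Longrightarrow> has_sint P M s (simple_integral M s)"
  unfolding has_sint_def by (intro exI[of _ "\<lambda>_. s"] conjI simple_approx_simple tendsto_const)

lemma has_sint_measurable: "has_sint P M g I \<Longrightarrow> p \<in> P \<Longrightarrow> (\<lambda>t. p (g t)) \<in> borel_measurable M"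
  unfolding has_sint_def using simple_approx_measurable by blast

text \<open>The finite-sum case \<open>simple_integral_le\<close> is passed to the limit. Applied to
  differences, this drives the later estimates of vector-valued integrals.\<close>

lemma has_sint_bound:
  assumes "has_sint P M g I" "p \<in> P"
  shows "ennreal (p I) \<le> (\<integral>\<^sup>+t. ennreal (p (g t)) \<partial>M)"
proof -
  obtain s where s: "simple_approx P M g s" and I: "(\<lambda>k. simple_integral M (s k)) \<longlonglongrightarrow> I"
    using assms(1) unfolding has_sint_def by blast
  have *: "ennreal (p (simple_integral M (s k)))
      \<le> (\<integral>\<^sup>+t. ennreal (p (g t)) \<partial>M) + (\<integral>\<^sup>+t. ennreal (p (g t - s k t)) \<partial>M)" for k
  proof -
    note sk = simple_approxD(1)[OF s, of k]
    have "ennreal (p (simple_integral M (s k))) \<le> (\<integral>\<^sup>+t. ennreal (p (s k t)) \<partial>M)"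
      by (rule simple_integral_le[OF sk assms(2)])
    also have "\<dots> \<le> (\<integral>\<^sup>+t. ennreal (p (g t)) + ennreal (p (g t - s k t)) \<partial>M)"
      using triangle_split[OF assms(2), of "s k _" "g _"] assms(2)
      by (intro nn_integral_mono) (simp add: minus_commute[OF assms(2), of "s k _"] flip: ennreal_plus)
    also have "\<dots> = (\<integral>\<^sup>+t. ennreal (p (g t)) \<partial>M) + (\<integral>\<^sup>+t. ennreal (p (g t - s k t)) \<partial>M)"
      using simple_approx_measurable_diff_simple[OF s sk assms(2)] simple_approx_measurable[OF s assms(2)]
      by (intro nn_integral_add) auto
    finally show ?thesis .
  qed
  show ?thesis
  proof (rule LIMSEQ_le)
    show "(\<lambda>k. ennreal (p (simple_integral M (s k)))) \<longlonglongrightarrow> ennreal (p I)"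
      using tendsto_seminorm[OF assms(2) I] assms(2) by (subst tendsto_ennreal_iff) auto
    show "(\<lambda>k. (\<integral>\<^sup>+t. ennreal (p (g t)) \<partial>M) + (\<integral>\<^sup>+t. ennreal (p (g t - s k t)) \<partial>M))
        \<longlonglongrightarrow> (\<integral>\<^sup>+t. ennreal (p (g t)) \<partial>M)"
      using tendsto_add[OF tendsto_const simple_approxD(3)[OF s assms(2)]] by simp
    show "\<exists>N. \<forall>n\<ge>N. ennreal (p (simple_integral M (s n)))
        \<le> (\<integral>\<^sup>+t. ennreal (p (g t)) \<partial>M) + (\<integral>\<^sup>+t. ennreal (p (g t - s n t)) \<partial>M)"
      using * by blast
  qed
qed

text \<open>One simple function at finite distance in mean suffices, and simple functions have
  finite integrals because the measure is finite.\<close>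

lemma has_sint_finite:
  assumes "has_sint P M g I" "p \<in> P"
  shows "(\<integral>\<^sup>+t. ennreal (p (g t)) \<partial>M) < \<infinity>"
proof -
  obtain s where s: "simple_approx P M g s"
    using assms(1) unfolding has_sint_def by blast
  have "\<forall>\<^sub>F k in sequentially. (\<integral>\<^sup>+t. ennreal (p (g t - s k t)) \<partial>M) < 1"
    using simple_approxD(3)[OF s assms(2)] by (rule order_tendstoD(2)) simp
  then obtain k where k: "(\<integral>\<^sup>+t. ennreal (p (g t - s k t)) \<partial>M) < 1"
    unfolding eventually_sequentially by blast
  note sk = simple_approxD(1)[OF s, of k]
  have "(\<integral>\<^sup>+t. ennreal (p (g t)) \<partial>M) \<le> (\<integral>\<^sup>+t. ennreal (p (s k t)) + ennreal (p (g t - s k t)) \<partial>M)"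
    using triangle_split[OF assms(2)] assms(2) by (intro nn_integral_mono) (simp flip: ennreal_plus)
  also have "\<dots> = (\<integral>\<^sup>+t. ennreal (p (s k t)) \<partial>M) + (\<integral>\<^sup>+t. ennreal (p (g t - s k t)) \<partial>M)"
    using simple_approx_measurable_diff_simple[OF s sk assms(2)] borel_measurable_seminorm_simple[OF sk]
    by (intro nn_integral_add) auto
  also have "\<dots> < \<infinity>"
  proof -
    have "Bochner_Integration.simple_bochner_integrable M (\<lambda>t. p (s k t))"
      using simple_function_compose1[OF sk] by (rule simple_bochner_integrable)
    then have "(\<integral>\<^sup>+t. ennreal (p (s k t)) \<partial>M) = ennreal (simple_integral M (\<lambda>t. p (s k t)))"
      using assms(2) by (intro simple_bochner_integral_eq_nn_integral[symmetric]) auto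
    then show ?thesis using k by (auto simp: less_top intro: less_trans)
  qed
  finally show ?thesis .
qed

lemma simple_approx_add:
  assumes s: "simple_approx P M g s" and s': "simple_approx P M g' s'"
  shows "simple_approx P M (\<lambda>t. g t + g' t) (\<lambda>k t. s k t + s' k t)"
  unfolding simple_approx_def
proof (intro conjI allI ballI)
  show "simple_function M (\<lambda>t. s k t + s' k t)" for k
    using simple_approxD(1)[OF s] simple_approxD(1)[OF s'] by (rule simple_function_compose2)
  show "AE t in M. (\<lambda>k. s k t + s' k t) \<longlonglongrightarrow> g t + g' t"
    using simple_approxD(2)[OF s] simple_approxD(2)[OF s'] by eventually_elim (rule tendsto_add)
  fix p assume p: "p \<in> P"
  have "(\<integral>\<^sup>+t. ennreal (p (g t + g' t - (s k t + s' k t))) \<partial>M)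
      \<le> (\<integral>\<^sup>+t. ennreal (p (g t - s k t)) \<partial>M) + (\<integral>\<^sup>+t. ennreal (p (g' t - s' k t)) \<partial>M)" for k
  proof -
    have "(\<integral>\<^sup>+t. ennreal (p (g t + g' t - (s k t + s' k t))) \<partial>M)
        \<le> (\<integral>\<^sup>+t. ennreal (p (g t - s k t)) + ennreal (p (g' t - s' k t)) \<partial>M)"
      using triangle[OF p, of "g _ - s k _" "g' _ - s' k _"] p
      by (intro nn_integral_mono) (simp add: algebra_simps flip: ennreal_plus)
    also have "\<dots> = (\<integral>\<^sup>+t. ennreal (p (g t - s k t)) \<partial>M) + (\<integral>\<^sup>+t. ennreal (p (g' t - s' k t)) \<partial>M)"
      using simple_approx_measurable_diff_simple[OF s simple_approxD(1)[OF s] p]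
        simple_approx_measurable_diff_simple[OF s' simple_approxD(1)[OF s'] p]
      by (intro nn_integral_add) auto
    finally show ?thesis .
  qed
  then show "(\<lambda>k. \<integral>\<^sup>+t. ennreal (p (g t + g' t - (s k t + s' k t))) \<partial>M) \<longlonglongrightarrow> 0"
  proof (rule tendsto_0_ennreal_sandwich[OF always_eventually[OF allI]])
    show "(\<lambda>k. (\<integral>\<^sup>+t. ennreal (p (g t - s k t)) \<partial>M) + (\<integral>\<^sup>+t. ennreal (p (g' t - s' k t)) \<partial>M)) \<longlonglongrightarrow> 0"
      using tendsto_add[OF simple_approxD(3)[OF s p] simple_approxD(3)[OF s' p]] by simp
  qed
qed

lemma simple_approx_scaleC:
  assumes s: "simple_approx P M g s"
  shows "simple_approx P M (\<lambda>t. c *\<^sub>C g t) (\<lambda>k t. c *\<^sub>C s k t)"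
  unfolding simple_approx_def
proof (intro conjI allI ballI)
  show "simple_function M (\<lambda>t. c *\<^sub>C s k t)" for k
    using simple_approxD(1)[OF s] by (rule simple_function_compose1)
  show "AE t in M. (\<lambda>k. c *\<^sub>C s k t) \<longlonglongrightarrow> c *\<^sub>C g t"
    using simple_approxD(2)[OF s] by eventually_elim (rule tendsto_scaleC[OF tendsto_const])
  fix p assume p: "p \<in> P"
  have "c *\<^sub>C x - c *\<^sub>C y = c *\<^sub>C (x - y)" for x y :: 'a
    using scaleC_add_right[of c "x - y" y] by (simp add: algebra_simps)
  then have "(\<integral>\<^sup>+t. ennreal (p (c *\<^sub>C g t - c *\<^sub>C s k t)) \<partial>M)
      = ennreal (cmod c) * (\<integral>\<^sup>+t. ennreal (p (g t - s k t)) \<partial>M)" for k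
    using simple_approx_measurable_diff_simple[OF s simple_approxD(1)[OF s] p] p
    by (simp add: scale ennreal_mult nn_integral_cmult)
  then show "(\<lambda>k. \<integral>\<^sup>+t. ennreal (p (c *\<^sub>C g t - c *\<^sub>C s k t)) \<partial>M) \<longlonglongrightarrow> 0"
    using ennreal_tendsto_cmult[OF _ simple_approxD(3)[OF s p], of "ennreal (cmod c)"] by simp
qed

lemma has_sint_add:
  assumes "has_sint P M g I" "has_sint P M g' J"
  shows "has_sint P M (\<lambda>t. g t + g' t) (I + J)"
proof -
  obtain s s' where s: "simple_approx P M g s" "(\<lambda>k. simple_integral M (s k)) \<longlonglongrightarrow> I"
    and s': "simple_approx P M g' s'" "(\<lambda>k. simple_integral M (s' k)) \<longlonglongrightarrow> J"
    using assms unfolding has_sint_def by blast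
  have "simple_integral M (\<lambda>t. s k t + s' k t)
      = simple_integral M (s k) + simple_integral M (s' k)" for k
    using simple_approxD(1)[OF s(1)] simple_approxD(1)[OF s'(1)]
    by (intro simple_bochner_integral_add simple_bochner_integrable)
  then show ?thesis
    unfolding has_sint_def using simple_approx_add[OF s(1) s'(1)] tendsto_add[OF s(2) s'(2)] by auto
qed

lemma has_sint_scaleC:
  assumes "has_sint P M g I"
  shows "has_sint P M (\<lambda>t. c *\<^sub>C g t) (c *\<^sub>C I)"
proof -
  obtain s where s: "simple_approx P M g s" "(\<lambda>k. simple_integral M (s k)) \<longlonglongrightarrow> I"
    using assms unfolding has_sint_def by blast
  have "linear (\<lambda>x::'a. c *\<^sub>C x)"
    by (rule linearI) (simp_all add: scaleC_add_right scaleR_scaleC scaleC_scaleC mult.commute)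
  then have "simple_integral M (\<lambda>t. c *\<^sub>C s k t) = c *\<^sub>C simple_integral M (s k)" for k
    using simple_approxD(1)[OF s(1)]
    by (intro simple_bochner_integral_linear simple_bochner_integrable)
  then show ?thesis
    unfolding has_sint_def using simple_approx_scaleC[OF s(1), of c] tendsto_scaleC[OF tendsto_const s(2), of c]
    by auto
qed

lemma has_sint_diff:
  assumes "has_sint P M g I" "has_sint P M g' J"
  shows "has_sint P M (\<lambda>t. g t - g' t) (I - J)"
  using has_sint_add[OF assms(1) has_sint_scaleC[OF assms(2), of "-1"]]
  by (simp add: scaleC_minus_one)

lemma has_sint_zero: "has_sint P M (\<lambda>_. 0) 0"
  using has_sint_scaleC[OF has_sint_simple[of "\<lambda>_. 0"], of 0]
  by (simp add: scaleC_zero_left)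

lemma has_sint_sum:
  "(\<And>i. i \<in> A \<Longrightarrow> has_sint P M (g i) (I i)) \<Longrightarrow>
    has_sint P M (\<lambda>t. \<Sum>i\<in>A. g i t) (\<Sum>i\<in>A. I i)"
  by (induction A rule: infinite_finite_induct) (auto intro: has_sint_zero has_sint_add)

text \<open>The majorant \<open>w p\<close> may change with the seminorm but not with
  \<open>k\<close>. Measurability of \<open>p (g t - s k t)\<close> comes from regarding
  \<open>g - s k\<close> as the limit of the simple functions \<open>s m - s k\<close> in
  \<open>m\<close>.\<close>

lemma simple_approx_dominated:
  assumes s: "\<And>k. simple_function M (s k)" and lim: "AE t in M. (\<lambda>k. s k t) \<longlonglongrightarrow> g t"
    and w: "\<And>p. p \<in> P \<Longrightarrow> w p \<in> borel_measurable M" "\<And>p. p \<in> P \<Longrightarrow> (\<integral>\<^sup>+t. w p t \<partial>M) < \<infinity>"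
    and bound: "\<And>p k. p \<in> P \<Longrightarrow> AE t in M. ennreal (p (g t - s k t)) \<le> w p t"
  shows "simple_approx P M g s"
  unfolding simple_approx_def
proof (intro conjI allI ballI s lim)
  fix p assume p: "p \<in> P"
  have "(\<lambda>k. \<integral>\<^sup>+t. ennreal (p (g t - s k t)) \<partial>M) \<longlonglongrightarrow> (\<integral>\<^sup>+t. 0 \<partial>M)"
  proof (rule nn_integral_dominated_convergence[OF _ _ w(1)[OF p] bound[OF p] w(2)[OF p]])
    show "(\<lambda>t. ennreal (p (g t - s k t))) \<in> borel_measurable M" for k
    proof -
      have "AE t in M. (\<lambda>m. s m t - s k t) \<longlonglongrightarrow> g t - s k t"
        using lim
      proof eventually_elim
        case (elim t)
        show ?case using tendsto_add[OF elim tendsto_const[of "- s k t"]] by simp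
      qed
      then have "(\<lambda>t. p (g t - s k t)) \<in> borel_measurable M"
        using simple_function_compose2[OF s s] p
        by (intro borel_measurable_seminorm[OF complete_measure_axioms]) auto
      then show ?thesis by measurable
    qed
    show "AE t in M. (\<lambda>k. ennreal (p (g t - s k t))) \<longlonglongrightarrow> 0"
      using lim by eventually_elim (use p tendstoD_seminorm(2) in \<open>simp add: tendsto_ennreal_0_iff\<close>)
  qed simp
  then show "(\<lambda>k. \<integral>\<^sup>+t. ennreal (p (g t - s k t)) \<partial>M) \<longlonglongrightarrow> 0" by simp
qed

end

section \<open>Products with scalar functions, change of variables, and the Cauchy condition\<close>

context seminorm_system
begin

text \<open>The scalar error \<open>c - d\<close> is paired with \<open>x\<close>, which is the
  limit function in the application, so that a fixed integrable majorant is available.\<close>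

lemma seminorm_scaleC_diff_le:
  assumes "p \<in> P"
  shows "p (c *\<^sub>C x - d *\<^sub>C y) \<le> cmod d * p (x - y) + cmod (c - d) * p x"
proof -
  have "c *\<^sub>C x - d *\<^sub>C y = d *\<^sub>C (x - y) + (c - d) *\<^sub>C x"
    by (simp add: scaleC_diff_right scaleC_diff_left)
  then show ?thesis
    using triangle[OF assms, of "d *\<^sub>C (x - y)" "(c - d) *\<^sub>C x"] by (simp add: scale[OF assms])
qed

end

context seminorm_system_measure
begin

lemma complex_simple_approx:
  fixes \<alpha> :: "'b \<Rightarrow> complex"
  assumes "\<alpha> \<in> borel_measurable M"
  shows "\<exists>s. (\<forall>k. simple_function M (s k)) \<and> (\<forall>t\<in>space M. (\<lambda>k. s k t) \<longlonglongrightarrow> \<alpha> t) \<and>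
    (\<forall>k. \<forall>t\<in>space M. cmod (s k t) \<le> 2 * cmod (\<alpha> t))"
  using borel_measurable_implies_sequence_metric[OF assms, of 0] by simp

text \<open>Links the vector-valued integral to the Bochner integral of the coefficient; integrals
  of step functions and of their convolutions are computed through it.\<close>

lemma has_sint_scalar:
  fixes \<alpha> :: "'b \<Rightarrow> complex"
  assumes \<alpha>: "integrable M \<alpha>"
  shows "has_sint P M (\<lambda>t. \<alpha> t *\<^sub>C c) ((\<integral>t. \<alpha> t \<partial>M) *\<^sub>C c)"
proof -
  have \<alpha>m: "\<alpha> \<in> borel_measurable M" using \<alpha> by simp
  obtain s where "(\<forall>k. simple_function M (s k)) \<and> (\<forall>t\<in>space M. (\<lambda>k. s k t) \<longlonglongrightarrow> \<alpha> t) \<and>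
    (\<forall>k. \<forall>t\<in>space M. cmod (s k t) \<le> 2 * cmod (\<alpha> t))"
    using complex_simple_approx[OF \<alpha>m] ..
  then have s: "\<And>k. simple_function M (s k)" "\<And>t. t \<in> space M \<Longrightarrow> (\<lambda>k. s k t) \<longlonglongrightarrow> \<alpha> t"
    "\<And>k t. t \<in> space M \<Longrightarrow> cmod (s k t) \<le> 2 * cmod (\<alpha> t)"
    by simp_all
  have "simple_approx P M (\<lambda>t. \<alpha> t *\<^sub>C c) (\<lambda>k t. s k t *\<^sub>C c)"
  \<comment> \<open>The factor 3 is 1 for \<open>\<alpha>\<close> plus 2 for the simple functions,
    whose modulus is at most twice that of \<open>\<alpha>\<close>.\<close>
  proof (rule simple_approx_dominated[where w = "\<lambda>p t. ennreal (3 * cmod (\<alpha> t) * p c)"])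
    show "simple_function M (\<lambda>t. s k t *\<^sub>C c)" for k
      using s(1) by (rule simple_function_compose1)
    show "AE t in M. (\<lambda>k. s k t *\<^sub>C c) \<longlonglongrightarrow> \<alpha> t *\<^sub>C c"
      using s(2) by (intro AE_I2 tendsto_scaleC tendsto_const)
    fix p assume p: "p \<in> P"
    show "(\<lambda>t. ennreal (3 * cmod (\<alpha> t) * p c)) \<in> borel_measurable M"
      using \<alpha>m by measurable
    have "integrable M (\<lambda>t. 3 * cmod (\<alpha> t) * p c)" using \<alpha> by simp
    then show "(\<integral>\<^sup>+t. ennreal (3 * cmod (\<alpha> t) * p c) \<partial>M) < \<infinity>"
      using p by (subst nn_integral_eq_integral) auto
    have "p (\<alpha> t *\<^sub>C c - s k t *\<^sub>C c) \<le> 3 * cmod (\<alpha> t) * p c" if "t \<in> space M" for k t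
    proof -
      have "cmod (\<alpha> t - s k t) \<le> 3 * cmod (\<alpha> t)"
        using norm_triangle_ineq4[of "\<alpha> t" "s k t"] s(3)[OF that, of k] by simp
      then have "cmod (\<alpha> t - s k t) * p c \<le> 3 * cmod (\<alpha> t) * p c"
        using p by (intro mult_right_mono) auto
      then show ?thesis using scale[OF p, of "\<alpha> t - s k t" c] by (simp add: scaleC_diff_left)
    qed
    then show "AE t in M. ennreal (p (\<alpha> t *\<^sub>C c - s k t *\<^sub>C c)) \<le> ennreal (3 * cmod (\<alpha> t) * p c)" for k
      by (intro AE_I2 ennreal_leI)
  qed
  moreover have "(\<lambda>k. simple_integral M (\<lambda>t. s k t *\<^sub>C c)) \<longlonglongrightarrow> (\<integral>t. \<alpha> t \<partial>M) *\<^sub>C c"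
  proof -
    have lin: "linear (\<lambda>z. z *\<^sub>C c)"
      by (rule linearI) (simp_all add: scaleC_add_left scaleR_scaleC scaleC_scaleC scaleC_complex_def scaleR_conv_of_real)
    have "simple_integral M (\<lambda>t. s k t *\<^sub>C c) = (\<integral>t. s k t \<partial>M) *\<^sub>C c" for k
      using simple_bochner_integral_linear[OF lin simple_bochner_integrable[OF s(1)], of k]
        simple_bochner_integrable_eq_integral[OF simple_bochner_integrable[OF s(1)], of k]
      by simp
    moreover have "(\<lambda>k. \<integral>t. s k t \<partial>M) \<longlonglongrightarrow> (\<integral>t. \<alpha> t \<partial>M)"
      using s \<alpha> by (intro integral_dominated_convergence[where w = "\<lambda>t. 2 * cmod (\<alpha> t)"])
        (auto intro: borel_measurable_simple_function)
    ultimately show ?thesis by (simp add: tendsto_scaleC[OF _ tendsto_const])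
  qed
  ultimately show ?thesis unfolding has_sint_def by blast
qed

text \<open>In the error of the product approximation, the part with \<open>g t - s k t\<close> is
  small in mean because the coefficients stay bounded, and the part with
  \<open>\<alpha> t - a k t\<close> tends to 0 by dominated convergence with a multiple of
  \<open>p (g t)\<close> as majorant.\<close>

lemma has_sint_bounded_mult:
  fixes \<alpha> :: "'b \<Rightarrow> complex"
  assumes g: "has_sint P M g I" and \<alpha>: "\<alpha> \<in> borel_measurable M"
    and B: "\<And>t. t \<in> space M \<Longrightarrow> cmod (\<alpha> t) \<le> B"
  shows "\<exists>J. has_sint P M (\<lambda>t. \<alpha> t *\<^sub>C g t) J"
proof -
  obtain s where s: "simple_approx P M g s" using g unfolding has_sint_def by blast
  obtain a where "(\<forall>k. simple_function M (a k)) \<and> (\<forall>t\<in>space M. (\<lambda>k. a k t) \<longlonglongrightarrow> \<alpha> t) \<and>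
    (\<forall>k. \<forall>t\<in>space M. cmod (a k t) \<le> 2 * cmod (\<alpha> t))"
    using complex_simple_approx[OF \<alpha>] ..
  then have a: "\<And>k. simple_function M (a k)" "\<And>t. t \<in> space M \<Longrightarrow> (\<lambda>k. a k t) \<longlonglongrightarrow> \<alpha> t"
    "\<And>k t. t \<in> space M \<Longrightarrow> cmod (a k t) \<le> 2 * cmod (\<alpha> t)"
    by simp_all
  have aB: "cmod (a k t) \<le> 2 * B" if "t \<in> space M" for k t
    using a(3)[OF that, of k] B[OF that] by simp
  have dB: "cmod (\<alpha> t - a k t) \<le> 3 * B" if "t \<in> space M" for k t
    using norm_triangle_ineq4[of "\<alpha> t" "a k t"] aB[OF that, of k] B[OF that] by simp
  have "simple_approx P M (\<lambda>t. \<alpha> t *\<^sub>C g t) (\<lambda>k t. a k t *\<^sub>C s k t)"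
    unfolding simple_approx_def
  proof (intro conjI allI ballI)
    show "simple_function M (\<lambda>t. a k t *\<^sub>C s k t)" for k
      using a(1) simple_approxD(1)[OF s] by (rule simple_function_compose2)
    show "AE t in M. (\<lambda>k. a k t *\<^sub>C s k t) \<longlonglongrightarrow> \<alpha> t *\<^sub>C g t"
      using simple_approxD(2)[OF s] AE_space
      by eventually_elim (intro tendsto_scaleC a(2))
    fix p assume p: "p \<in> P"
    note pg[measurable] = simple_approx_measurable[OF s p]
    have pgs[measurable]: "(\<lambda>t. p (g t - s k t)) \<in> borel_measurable M" for k
      using simple_approx_measurable_diff_simple[OF s simple_approxD(1)[OF s] p] .
    note am[measurable] = borel_measurable_simple_function[OF a(1)] and \<alpha>[measurable]
    have 1: "(\<integral>\<^sup>+t. ennreal (p (\<alpha> t *\<^sub>C g t - a k t *\<^sub>C s k t)) \<partial>M)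
        \<le> ennreal (2 * \<bar>B\<bar>) * (\<integral>\<^sup>+t. ennreal (p (g t - s k t)) \<partial>M) + (\<integral>\<^sup>+t. ennreal (cmod (\<alpha> t - a k t) * p (g t)) \<partial>M)" for k
    proof -
      have "(\<integral>\<^sup>+t. ennreal (p (\<alpha> t *\<^sub>C g t - a k t *\<^sub>C s k t)) \<partial>M)
        \<le> (\<integral>\<^sup>+t. ennreal (2 * \<bar>B\<bar> * p (g t - s k t)) + ennreal (cmod (\<alpha> t - a k t) * p (g t)) \<partial>M)"
      proof (rule nn_integral_mono)
        fix t assume t: "t \<in> space M"
        have "p (\<alpha> t *\<^sub>C g t - a k t *\<^sub>C s k t) \<le> cmod (a k t) * p (g t - s k t) + cmod (\<alpha> t - a k t) * p (g t)"
          by (rule seminorm_scaleC_diff_le[OF p])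
        also have "\<dots> \<le> 2 * \<bar>B\<bar> * p (g t - s k t) + cmod (\<alpha> t - a k t) * p (g t)"
          using aB[OF t, of k] p by (intro add_right_mono mult_right_mono) auto
        finally show "ennreal (p (\<alpha> t *\<^sub>C g t - a k t *\<^sub>C s k t))
          \<le> ennreal (2 * \<bar>B\<bar> * p (g t - s k t)) + ennreal (cmod (\<alpha> t - a k t) * p (g t))"
          using p by (simp flip: ennreal_plus)
      qed
      also have "\<dots> = (\<integral>\<^sup>+t. ennreal (2 * \<bar>B\<bar> * p (g t - s k t)) \<partial>M) + (\<integral>\<^sup>+t. ennreal (cmod (\<alpha> t - a k t) * p (g t)) \<partial>M)"
        by (intro nn_integral_add) measurable
      also have "(\<integral>\<^sup>+t. ennreal (2 * \<bar>B\<bar> * p (g t - s k t)) \<partial>M) = ennreal (2 * \<bar>B\<bar>) * (\<integral>\<^sup>+t. ennreal (p (g t - s k t)) \<partial>M)"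
        using p by (simp add: ennreal_mult nn_integral_cmult)
      finally show ?thesis .
    qed
    have 2: "(\<lambda>k. \<integral>\<^sup>+t. ennreal (cmod (\<alpha> t - a k t) * p (g t)) \<partial>M) \<longlonglongrightarrow> (\<integral>\<^sup>+t. 0 \<partial>M)"
    proof (rule nn_integral_dominated_convergence[where w = "\<lambda>t. ennreal (3 * \<bar>B\<bar>) * ennreal (p (g t))"])
      show "AE t in M. ennreal (cmod (\<alpha> t - a k t) * p (g t)) \<le> ennreal (3 * \<bar>B\<bar>) * ennreal (p (g t))" for k
      proof (rule AE_I2)
        fix t assume t: "t \<in> space M"
        have "cmod (\<alpha> t - a k t) * p (g t) \<le> 3 * \<bar>B\<bar> * p (g t)"
          using dB[OF t, of k] p by (intro mult_right_mono) auto
        then show "ennreal (cmod (\<alpha> t - a k t) * p (g t)) \<le> ennreal (3 * \<bar>B\<bar>) * ennreal (p (g t))"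
          using p by (simp flip: ennreal_mult)
      qed
      show "(\<integral>\<^sup>+t. ennreal (3 * \<bar>B\<bar>) * ennreal (p (g t)) \<partial>M) < \<infinity>"
        using has_sint_finite[OF g p] by (simp add: nn_integral_cmult ennreal_mult_less_top)
      show "AE t in M. (\<lambda>k. ennreal (cmod (\<alpha> t - a k t) * p (g t))) \<longlonglongrightarrow> 0"
      proof (rule AE_I2)
        fix t assume t: "t \<in> space M"
        have "(\<lambda>k. cmod (\<alpha> t - a k t) * p (g t)) \<longlonglongrightarrow> 0"
          using tendsto_mult_right[OF tendsto_norm[OF tendsto_diff[OF tendsto_const a(2)[OF t]]], of "\<alpha> t" "p (g t)"]
          by (simp add: mult.commute)
        then show "(\<lambda>k. ennreal (cmod (\<alpha> t - a k t) * p (g t))) \<longlonglongrightarrow> 0"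
          using p by (subst tendsto_ennreal_0_iff) auto
      qed
    qed measurable
    show "(\<lambda>k. \<integral>\<^sup>+t. ennreal (p (\<alpha> t *\<^sub>C g t - a k t *\<^sub>C s k t)) \<partial>M) \<longlonglongrightarrow> 0"
    proof (rule tendsto_0_ennreal_sandwich[OF always_eventually[OF allI[OF 1]]])
      have "(\<lambda>k. ennreal (2 * \<bar>B\<bar>) * (\<integral>\<^sup>+t. ennreal (p (g t - s k t)) \<partial>M)) \<longlonglongrightarrow> 0"
        using ennreal_tendsto_cmult[OF _ simple_approxD(3)[OF s p], of "ennreal (2 * \<bar>B\<bar>)"] by simp
      from tendsto_add[OF this 2]
      show "(\<lambda>k. ennreal (2 * \<bar>B\<bar>) * (\<integral>\<^sup>+t. ennreal (p (g t - s k t)) \<partial>M)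
          + (\<integral>\<^sup>+t. ennreal (cmod (\<alpha> t - a k t) * p (g t)) \<partial>M)) \<longlonglongrightarrow> 0" by simp
    qed
  qed
  then show ?thesis by (rule has_sint_ex)
qed

text \<open>Complement of \<open>has_sint_bounded_mult\<close>: the scalar factor is merely
  integrable, while the vector factor is a pointwise limit of simple functions that stay bounded in
  every seminorm. It serves the case of continuous \<open>F\<close>, with \<open>F\<close> sampled
  on a grid.\<close>

lemma has_sint_integrable_mult:
  fixes \<alpha> :: "'b \<Rightarrow> complex"
  assumes \<alpha>: "integrable M \<alpha>" and s: "\<And>k. simple_function M (s k)"
    and lim: "\<And>t. t \<in> space M \<Longrightarrow> (\<lambda>k. s k t) \<longlonglongrightarrow> g t"
    and B: "\<And>p t. p \<in> P \<Longrightarrow> t \<in> space M \<Longrightarrow> p (g t) \<le> B p"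
      "\<And>p t k. p \<in> P \<Longrightarrow> t \<in> space M \<Longrightarrow> p (s k t) \<le> B p"
  shows "\<exists>J. has_sint P M (\<lambda>t. \<alpha> t *\<^sub>C g t) J"
proof -
  have \<alpha>m[measurable]: "\<alpha> \<in> borel_measurable M" using \<alpha> by simp
  obtain a where "(\<forall>k. simple_function M (a k)) \<and> (\<forall>t\<in>space M. (\<lambda>k. a k t) \<longlonglongrightarrow> \<alpha> t) \<and>
    (\<forall>k. \<forall>t\<in>space M. cmod (a k t) \<le> 2 * cmod (\<alpha> t))"
    using complex_simple_approx[OF \<alpha>m] ..
  then have a: "\<And>k. simple_function M (a k)" "\<And>t. t \<in> space M \<Longrightarrow> (\<lambda>k. a k t) \<longlonglongrightarrow> \<alpha> t"
    "\<And>k t. t \<in> space M \<Longrightarrow> cmod (a k t) \<le> 2 * cmod (\<alpha> t)"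
    by simp_all
  have "simple_approx P M (\<lambda>t. \<alpha> t *\<^sub>C g t) (\<lambda>k t. a k t *\<^sub>C s k t)"
  proof (rule simple_approx_dominated[where w = "\<lambda>p t. ennreal (3 * \<bar>B p\<bar> * cmod (\<alpha> t))"])
    show "simple_function M (\<lambda>t. a k t *\<^sub>C s k t)" for k
      using a(1) s by (rule simple_function_compose2)
    show "AE t in M. (\<lambda>k. a k t *\<^sub>C s k t) \<longlonglongrightarrow> \<alpha> t *\<^sub>C g t"
      by (intro AE_I2 tendsto_scaleC a(2) lim)
    fix p assume p: "p \<in> P"
    show "(\<lambda>t. ennreal (3 * \<bar>B p\<bar> * cmod (\<alpha> t))) \<in> borel_measurable M" by measurable
    have "integrable M (\<lambda>t. 3 * \<bar>B p\<bar> * cmod (\<alpha> t))" using \<alpha> by simp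
    then show "(\<integral>\<^sup>+t. ennreal (3 * \<bar>B p\<bar> * cmod (\<alpha> t)) \<partial>M) < \<infinity>"
      by (subst nn_integral_eq_integral) auto
    have "p (\<alpha> t *\<^sub>C g t - a k t *\<^sub>C s k t) \<le> 3 * \<bar>B p\<bar> * cmod (\<alpha> t)" if t: "t \<in> space M" for k t
    proof -
      have "p (\<alpha> t *\<^sub>C g t - a k t *\<^sub>C s k t) \<le> cmod (\<alpha> t) * p (g t) + cmod (a k t) * p (s k t)"
        using triangle_diff[OF p] by (simp flip: scale[OF p])
      also have "\<dots> \<le> cmod (\<alpha> t) * \<bar>B p\<bar> + 2 * cmod (\<alpha> t) * \<bar>B p\<bar>"
        using B(1)[OF p t] B(2)[OF p t, of k] a(3)[OF t, of k] p
        by (intro add_mono mult_mono) auto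
      finally show ?thesis by (simp add: algebra_simps)
    qed
    then show "AE t in M. ennreal (p (\<alpha> t *\<^sub>C g t - a k t *\<^sub>C s k t)) \<le> ennreal (3 * \<bar>B p\<bar> * cmod (\<alpha> t))" for k
      by (intro AE_I2 ennreal_leI)
  qed
  then show ?thesis by (rule has_sint_ex)
qed

text \<open>The approximating sequence is composed with \<open>T\<close>. The map to be substituted
  later is the reflection of the box \<open>{0..x}\<close> that sends \<open>u\<close> to
  \<open>x - u\<close>.\<close>

lemma has_sint_measure_preserving:
  assumes g: "has_sint P M g I" and T: "T \<in> M \<rightarrow>\<^sub>M M" and distr: "distr M M T = M"
  shows "has_sint P M (\<lambda>t. g (T t)) I"
proof -
  obtain s where s: "simple_approx P M g s" "(\<lambda>k. simple_integral M (s k)) \<longlonglongrightarrow> I"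
    using g unfolding has_sint_def by blast
  note sk = simple_approxD(1)[OF s(1)]
  have TM: "T ` space M \<subseteq> space M" using measurable_space[OF T] by blast
  have sT: "simple_function M (\<lambda>t. s k (T t))" for k
    unfolding simple_function_def
  proof (intro conjI ballI)
    show "finite ((\<lambda>t. s k (T t)) ` space M)"
      using TM simple_functionD(1)[OF sk[of k]]
      by (rule_tac finite_subset[of _ "s k ` space M"]) auto
    fix x assume "x \<in> (\<lambda>t. s k (T t)) ` space M"
    have "(\<lambda>t. s k (T t)) -` {x} \<inter> space M = T -` (s k -` {x} \<inter> space M) \<inter> space M"
      using TM by auto
    then show "(\<lambda>t. s k (T t)) -` {x} \<inter> space M \<in> sets M"
      using measurable_sets[OF T simple_functionD(2)[OF sk]] by simp
  qed
  have "simple_approx P M (\<lambda>t. g (T t)) (\<lambda>k t. s k (T t))"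
    unfolding simple_approx_def
  proof (intro conjI allI ballI sT)
    show "AE t in M. (\<lambda>k. s k (T t)) \<longlonglongrightarrow> g (T t)"
      using simple_approxD(2)[OF s(1)]
      by (intro AE_distrD[OF T, of "\<lambda>t. (\<lambda>k. s k t) \<longlonglongrightarrow> g t"]) (simp only: distr)
    fix p assume p: "p \<in> P"
    have "(\<integral>\<^sup>+t. ennreal (p (g (T t) - s k (T t))) \<partial>M) = (\<integral>\<^sup>+t. ennreal (p (g t - s k t)) \<partial>M)" for k
      using simple_approx_measurable_diff_simple[OF s(1) sk p]
      by (subst (2) distr[symmetric]) (intro nn_integral_distr[symmetric] T; simp add: distr)
    then show "(\<lambda>k. \<integral>\<^sup>+t. ennreal (p (g (T t) - s k (T t))) \<partial>M) \<longlonglongrightarrow> 0"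
      using simple_approxD(3)[OF s(1) p] by simp
  qed
  moreover have "simple_integral M (\<lambda>t. s k (T t))
      = simple_integral M (s k)" for k
  proof -
    have eq: "measure M {t \<in> space M. s k (T t) = y} = measure M {t \<in> space M. s k t = y}" for y
    proof -
      have *: "{t \<in> space M. s k t = y} \<in> sets M"
        using simple_functionD(2)[OF sk, of k "{y}"] by (simp add: vimage_def Int_def conj_commute)
      have "measure M {t \<in> space M. s k t = y} = measure (distr M M T) {t \<in> space M. s k t = y}"
        by (simp add: distr)
      also have "\<dots> = measure M (T -` {t \<in> space M. s k t = y} \<inter> space M)"
        by (rule measure_distr[OF T *])
      also have "T -` {t \<in> space M. s k t = y} \<inter> space M = {t \<in> space M. s k (T t) = y}"
        using TM by auto
      finally show ?thesis by simp
    qed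
    have sub: "(\<lambda>t. s k (T t)) ` space M \<subseteq> s k ` space M" using TM by auto
    show ?thesis
      unfolding simple_bochner_integral_def eq[symmetric]
    \<comment> \<open>Composition with \<open>T\<close> can lose values; a lost value has an empty
      level set and contributes nothing.\<close>
    proof (rule sum.mono_neutral_left[OF simple_functionD(1)[OF sk] sub], intro ballI)
      fix y assume "y \<in> s k ` space M - (\<lambda>t. s k (T t)) ` space M"
      then have "{t \<in> space M. s k (T t) = y} = {}" by blast
      then show "measure M {t \<in> space M. s k (T t) = y} *\<^sub>R y = 0"
        by (simp only: measure_empty scaleR_zero_left)
    qed
  qed
  ultimately show ?thesis unfolding has_sint_def using s(2) by auto
qed

text \<open>Allows integrals over nested boxes to be subtracted on a single measure space, where
  \<open>has_sint_diff\<close> applies.\<close>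

lemma has_sint_extend:
  assumes g: "has_sint P (restrict_space M S) g I" and S: "S \<in> sets M"
  shows "has_sint P M (\<lambda>t. if t \<in> S then g t else 0) I"
proof -
  interpret R: seminorm_system_measure P "restrict_space M S"
    by (intro seminorm_system_measure.intro seminorm_system_axioms
        complete_measure_restrict_space[OF complete_measure_axioms S]
        finite_measure_restrict_space[OF finite_measure_axioms] S)
  have SM: "S \<inter> space M \<in> sets M" using S by auto
  have SS: "S \<subseteq> space M" using S by (rule sets.sets_into_space)
  have sp: "space (restrict_space M S) = S" using SS by (auto simp: space_restrict_space)
  obtain s where s: "simple_approx P (restrict_space M S) g s"
      "(\<lambda>k. simple_integral (restrict_space M S) (s k)) \<longlonglongrightarrow> I"
    using g unfolding has_sint_def by blast
  note sk = R.simple_approxD(1)[OF s(1)]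
  define s' where "s' k t = (if t \<in> S then s k t else 0)" for k t
  have s': "simple_function M (s' k)" for k
    unfolding simple_function_def
  proof (intro conjI ballI)
    have "finite (s k ` S)" using simple_functionD(1)[OF sk, of k] by (simp add: sp)
    then show "finite (s' k ` space M)"
      by (rule_tac finite_subset[of _ "insert 0 (s k ` S)"]) (auto simp: s'_def)
    fix x
    have *: "s k -` {x} \<inter> S \<in> sets M"
      using simple_functionD(2)[OF sk, of k "{x}"] S by (simp add: sp sets_restrict_space_iff[OF SM])
    have "s' k -` {x} \<inter> space M = (s k -` {x} \<inter> S) \<union> (if x = 0 then space M - S else {})"
      using SS by (auto simp: s'_def split: if_splits)
    then show "s' k -` {x} \<inter> space M \<in> sets M" using * S by auto
  qed
  have "simple_approx P M (\<lambda>t. if t \<in> S then g t else 0) s'"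
    unfolding simple_approx_def
  proof (intro conjI allI ballI s')
    show "AE t in M. (\<lambda>k. s' k t) \<longlonglongrightarrow> (if t \<in> S then g t else 0)"
      using R.simple_approxD(2)[OF s(1)] unfolding AE_restrict_space_iff[OF SM] s'_def
      by eventually_elim simp
    fix p assume p: "p \<in> P"
    have "(\<integral>\<^sup>+t. ennreal (p ((if t \<in> S then g t else 0) - s' k t)) \<partial>M)
        = (\<integral>\<^sup>+t. ennreal (p (g t - s k t)) \<partial>restrict_space M S)" for k
      unfolding nn_integral_restrict_space[OF SM] s'_def using p
      by (intro nn_integral_cong) (auto simp: indicator_def)
    then show "(\<lambda>k. \<integral>\<^sup>+t. ennreal (p ((if t \<in> S then g t else 0) - s' k t)) \<partial>M) \<longlonglongrightarrow> 0"
      using R.simple_approxD(3)[OF s(1) p] by simp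
  qed
  moreover have "simple_integral M (s' k)
      = simple_integral (restrict_space M S) (s k)" for k
  proof -
    have "simple_integral (restrict_space M S) (s k)
        = (\<Sum>y\<in>s k ` S. measure M {t \<in> space M. s' k t = y} *\<^sub>R y)"
      unfolding simple_bochner_integral_def sp
    proof (intro sum.cong refl)
      fix y
      show "measure (restrict_space M S) {x \<in> S. s k x = y} *\<^sub>R y = measure M {t \<in> space M. s' k t = y} *\<^sub>R y"
      proof (cases "y = 0")
        case False
        have "measure (restrict_space M S) {x \<in> S. s k x = y} = measure M {x \<in> S. s k x = y}"
          by (rule measure_restrict_space[OF SM]) auto
        moreover have "{x \<in> S. s k x = y} = {t \<in> space M. s' k t = y}"
          using SS False by (auto simp: s'_def split: if_splits)
        ultimately show ?thesis by simp
      qed simp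
    qed
    \<comment> \<open>The extension and \<open>s k\<close> may differ in whether they take the value
      0. It contributes nothing to either sum and is inserted to compare the two ranges.\<close>
    also have "\<dots> = (\<Sum>y\<in>insert 0 (s k ` S). measure M {t \<in> space M. s' k t = y} *\<^sub>R y)"
      using simple_functionD(1)[OF sk, of k] by (intro sum.mono_neutral_left) (auto simp: sp)
    also have "\<dots> = (\<Sum>y\<in>s' k ` space M. measure M {t \<in> space M. s' k t = y} *\<^sub>R y)"
    proof (rule sum.mono_neutral_right)
      show "finite (insert 0 (s k ` S))" using simple_functionD(1)[OF sk, of k] by (simp add: sp)
      show "s' k ` space M \<subseteq> insert 0 (s k ` S)" by (auto simp: s'_def)
      show "\<forall>y\<in>insert 0 (s k ` S) - s' k ` space M. measure M {t \<in> space M. s' k t = y} *\<^sub>R y = 0"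
      proof
        fix y assume "y \<in> insert 0 (s k ` S) - s' k ` space M"
        then have "{t \<in> space M. s' k t = y} = {}" by blast
        then show "measure M {t \<in> space M. s' k t = y} *\<^sub>R y = 0"
          by (simp only: measure_empty scaleR_zero_left)
      qed
    qed
    finally show ?thesis unfolding simple_bochner_integral_def by simp
  qed
  ultimately show ?thesis unfolding has_sint_def using s(2) by auto
qed

text \<open>Fatou's lemma in \<open>m\<close>: since \<open>s m\<close> converges a.e. to
  \<open>g\<close>, the integral of \<open>p (g t - s k t)\<close> is at most the lower limit of
  those of \<open>p (s m t - s k t)\<close>, which the Cauchy condition bounds.\<close>

lemma approx_simple_cauchy_imp:
  assumes s: "\<And>k. simple_function M (s k)" and lim: "AE t in M. (\<lambda>k. s k t) \<longlonglongrightarrow> g t"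
    and cau: "\<And>e. e > 0 \<Longrightarrow> \<exists>k0. \<forall>k\<ge>k0. \<forall>m\<ge>k0. (\<integral>t. p (s k t - s m t) \<partial>M) \<le> e"
    and p: "p \<in> P"
  shows "(\<lambda>k. \<integral>\<^sup>+t. ennreal (p (g t - s k t)) \<partial>M) \<longlonglongrightarrow> 0"
proof (rule order_tendstoI)
  fix y :: ennreal assume "0 < y"
  have "\<exists>e>0. ennreal e < y"
  proof (cases y)
    case (real r)
    with \<open>0 < y\<close> show ?thesis by (intro exI[of _ "r / 2"]) (auto simp: ennreal_less_iff)
  next
    case top
    then show ?thesis by (intro exI[of _ 1]) simp
  qed
  then obtain e where e: "e > 0" "ennreal e < y" by blast
  have sm: "simple_function M (\<lambda>t. s m t - s k t)" for k m
    using s s by (rule simple_function_compose2)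
  have nn: "(\<integral>\<^sup>+t. ennreal (p (s m t - s k t)) \<partial>M) = ennreal (\<integral>t. p (s m t - s k t) \<partial>M)" for k m
  proof (rule nn_integral_eq_integral)
    show "integrable M (\<lambda>t. p (s m t - s k t))"
      by (rule integrable_simple_function[OF simple_function_compose1[OF sm]]) auto
  qed (use p in simp)
  obtain k0 where "\<forall>k\<ge>k0. \<forall>m\<ge>k0. (\<integral>t. p (s k t - s m t) \<partial>M) \<le> e"
    using cau[OF e(1)] ..
  then have k0: "(\<integral>t. p (s k t - s m t) \<partial>M) \<le> e" if "k \<ge> k0" "m \<ge> k0" for k m
    using that by blast
  have "(\<integral>\<^sup>+t. ennreal (p (g t - s k t)) \<partial>M) < y" if k: "k \<ge> k0" for k
  proof -
    have "(\<integral>\<^sup>+t. ennreal (p (g t - s k t)) \<partial>M) = (\<integral>\<^sup>+t. liminf (\<lambda>m. ennreal (p (s m t - s k t))) \<partial>M)"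
    proof (rule nn_integral_cong_AE)
      show "AE t in M. ennreal (p (g t - s k t)) = liminf (\<lambda>m. ennreal (p (s m t - s k t)))"
        using lim
      proof eventually_elim
        case (elim t)
        have "(\<lambda>m. s m t - s k t) \<longlonglongrightarrow> g t - s k t"
          using tendsto_add[OF elim tendsto_const[of "- s k t"]] by simp
        from tendsto_seminorm[OF p this]
        have "(\<lambda>m. ennreal (p (s m t - s k t))) \<longlonglongrightarrow> ennreal (p (g t - s k t))"
          using p by (subst tendsto_ennreal_iff) auto
        then show ?case by (simp add: lim_imp_Liminf)
      qed
    qed
    also have "\<dots> \<le> liminf (\<lambda>m. \<integral>\<^sup>+t. ennreal (p (s m t - s k t)) \<partial>M)"
      using borel_measurable_seminorm_simple[OF sm] by (intro nn_integral_liminf) measurable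
    also have "\<dots> \<le> ennreal e"
    proof (rule Liminf_le)
      show "\<forall>\<^sub>F m in sequentially. (\<integral>\<^sup>+t. ennreal (p (s m t - s k t)) \<partial>M) \<le> ennreal e"
        using k0[OF _ k] unfolding nn eventually_sequentially by (intro exI[of _ k0]) (auto intro: ennreal_leI)
    qed simp
    finally show ?thesis using e(2) by simp
  qed
  then show "\<forall>\<^sub>F k in sequentially. (\<integral>\<^sup>+t. ennreal (p (g t - s k t)) \<partial>M) < y"
    unfolding eventually_sequentially by blast
qed simp

lemma simple_approx_imp_cauchy:
  assumes s: "simple_approx P M g s" and p: "p \<in> P" and e: "e > 0"
  shows "\<exists>k0. \<forall>k\<ge>k0. \<forall>m\<ge>k0. (\<integral>t. p (s k t - s m t) \<partial>M) \<le> e"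
proof -
  note sk = simple_approxD(1)[OF s]
  have "\<forall>\<^sub>F k in sequentially. (\<integral>\<^sup>+t. ennreal (p (g t - s k t)) \<partial>M) < ennreal (e / 2)"
    using simple_approxD(3)[OF s p] by (rule order_tendstoD(2)) (use e in simp)
  then obtain k0 where k0: "\<And>k. k \<ge> k0 \<Longrightarrow> (\<integral>\<^sup>+t. ennreal (p (g t - s k t)) \<partial>M) < ennreal (e / 2)"
    unfolding eventually_sequentially by blast
  have "(\<integral>t. p (s k t - s m t) \<partial>M) \<le> e" if "k \<ge> k0" "m \<ge> k0" for k m
  proof -
    have "simple_function M (\<lambda>t. s k t - s m t)" using sk sk by (rule simple_function_compose2)
    then have "integrable M (\<lambda>t. p (s k t - s m t))"
      by (intro integrable_simple_function[OF simple_function_compose1]) auto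
    then have "ennreal (\<integral>t. p (s k t - s m t) \<partial>M) = (\<integral>\<^sup>+t. ennreal (p (s k t - s m t)) \<partial>M)"
      using p by (intro nn_integral_eq_integral[symmetric]) auto
    also have "\<dots> \<le> (\<integral>\<^sup>+t. ennreal (p (s k t - g t)) \<partial>M) + (\<integral>\<^sup>+t. ennreal (p (g t - s m t)) \<partial>M)"
      using simple_approx_measurable_diff_simple[OF s sk p]
      by (intro nn_integral_seminorm_via[OF p]) (auto simp: minus_commute[OF p, of "s k _"])
    also have "\<dots> \<le> ennreal (e / 2) + ennreal (e / 2)"
      using k0[OF that(1)] k0[OF that(2)] by (intro add_mono) (auto simp: minus_commute[OF p, of "s k _"])
    also have "\<dots> = ennreal e" using e by (simp flip: ennreal_plus)
    finally show ?thesis using e by simp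
  qed
  then show ?thesis by blast
qed

end

section \<open>Agreement with the integral over sets of finite Lebesgue measure\<close>

lemma complete_measure_lebesgue_on: "K \<in> sets lebesgue \<Longrightarrow> complete_measure (lebesgue_on K)"
  by (rule complete_measure_restrict_space) unfold_locales

context seminorm_system
begin

lemma seminorm_system_lebesgue_on:
  assumes "K \<in> lmeasurable"
  shows "seminorm_system_measure P (lebesgue_on K)"
  using assms
  by (intro seminorm_system_measure.intro seminorm_system_axioms complete_measure_lebesgue_on
      finite_measureI) (auto simp: fmeasurable_def emeasure_restrict_space space_restrict_space less_top)

text \<open>On a set of finite measure the seminorm of a difference of simple functions is
  integrable, so the Bochner integral in the Cauchy condition never falls back on its default value
  0.\<close>

lemma approx_simple_iff:
  fixes K :: "(real ^ 'n) set"
  assumes "K \<in> lmeasurable"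
  shows "approx_simple P K g s \<longleftrightarrow> simple_approx P (lebesgue_on K) g s"
proof -
  interpret seminorm_system_measure P "lebesgue_on K"
    by (rule seminorm_system_lebesgue_on[OF assms])
  show ?thesis
  proof
    assume "approx_simple P K g s"
    then show "simple_approx P (lebesgue_on K) g s"
      unfolding approx_simple_def simple_approx_def by (simp add: approx_simple_cauchy_imp)
  next
    assume "simple_approx P (lebesgue_on K) g s"
    from simple_approx_imp_cauchy[OF this] simple_approxD(1,2)[OF this]
    show "approx_simple P K g s" unfolding approx_simple_def by simp
  qed
qed

lemma sc_integrable_iff:
  assumes "K \<in> lmeasurable"
  shows "sc_integrable P K g \<longleftrightarrow> (\<exists>I. has_sint P (lebesgue_on K) g I)"
proof -
  interpret seminorm_system_measure P "lebesgue_on K"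
    by (rule seminorm_system_lebesgue_on[OF assms])
  show ?thesis
    unfolding sc_integrable_def approx_simple_iff[OF assms]
    using has_sint_ex by (auto simp: has_sint_def)
qed

lemma sc_integral_eqI:
  assumes "K \<in> lmeasurable" "has_sint P (lebesgue_on K) g I"
  shows "sc_integral P K g = I"
proof -
  interpret seminorm_system_measure P "lebesgue_on K"
    by (rule seminorm_system_lebesgue_on[OF assms(1)])
  have "sc_integral P K g = (THE I. has_sint P (lebesgue_on K) g I)"
    unfolding sc_integral_def approx_simple_iff[OF assms(1)] has_sint_def ..
  then show ?thesis using assms(2) has_sint_unique by (auto intro: the_equality)
qed

lemma has_sint_sc_integral:
  "K \<in> lmeasurable \<Longrightarrow> sc_integrable P K g \<Longrightarrow> has_sint P (lebesgue_on K) g (sc_integral P K g)"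
  using sc_integrable_iff sc_integral_eqI by metis

end

lemma seminorm_system_complex: "seminorm_system {cmod}"
  by unfold_locales (rule fundamental_seminorms_complex)

text \<open>Gives access to Fubini's theorem and dominated convergence for the scalar factor, whose
  hypotheses are phrased with the vector-valued integral.\<close>

lemma has_sint_complex_iff:
  assumes "complete_measure M" "finite_measure M"
  shows "has_sint {cmod} M \<alpha> I \<longleftrightarrow> has_bochner_integral M \<alpha> I"
proof -
  interpret seminorm_system_measure "{cmod}" M
    by (intro seminorm_system_measure.intro seminorm_system_complex assms)
  show ?thesis
  proof
    assume "has_sint {cmod} M \<alpha> I"
    then obtain s where s: "simple_approx {cmod} M \<alpha> s"
        "(\<lambda>k. simple_integral M (s k)) \<longlonglongrightarrow> I"
      unfolding has_sint_def by blast
    show "has_bochner_integral M \<alpha> I"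
    proof (rule has_bochner_integral.intros[OF _ _ _ s(2)])
      show "\<alpha> \<in> borel_measurable M"
        by (rule borel_measurable_AE_LIMSEQ[OF _ simple_approxD(2)[OF s(1)]])
          (rule borel_measurable_simple_function[OF simple_approxD(1)[OF s(1)]])
      show "Bochner_Integration.simple_bochner_integrable M (s k)" for k
        using simple_approxD(1)[OF s(1)] by (rule simple_bochner_integrable)
      show "(\<lambda>k. \<integral>\<^sup>+x. ennreal (cmod (\<alpha> x - s k x)) \<partial>M) \<longlonglongrightarrow> 0"
        using simple_approxD(3)[OF s(1)] by simp
    qed
  next
    assume "has_bochner_integral M \<alpha> I"
    then show "has_sint {cmod} M \<alpha> I"
      using has_sint_scalar[of \<alpha> 1] by (simp add: has_bochner_integral_iff scaleC_complex_def)
  qed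
qed

section \<open>Convolution of scalar functions on Euclidean space\<close>

lemma lborel_distr_reflect: "distr lborel borel ((-) x) = (lborel :: 'a::euclidean_space measure)"
proof -
  have "(\<lambda>y. x + (-1) *\<^sub>R y) = (-) x" by (simp add: fun_eq_iff)
  then show ?thesis using lborel_affine[of "-1" x] by (simp add: density_1)
qed

lemma lborel_distr_minus: "distr lborel borel (\<lambda>y. y - x) = (lborel :: 'a::euclidean_space measure)"
proof -
  have "(+) (- x) = (\<lambda>y. y - x)" by (simp add: fun_eq_iff)
  then show ?thesis using lborel_distr_plus[of "- x"] by simp
qed

text \<open>An affine map with all scaling factors equal to -1, hence with determinant of modulus
  1.\<close>

lemma lebesgue_reflect:
  fixes x :: "'a::euclidean_space"
  shows "distr lebesgue lebesgue ((-) x) = lebesgue" "(-) x \<in> lebesgue \<rightarrow>\<^sub>M lebesgue"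
proof -
  have T: "x + (\<Sum>j\<in>Basis. ((-1) * (y \<bullet> j)) *\<^sub>R j) = x - y" for y :: 'a
    by (simp add: sum_negf euclidean_representation)
  show "(-) x \<in> lebesgue \<rightarrow>\<^sub>M lebesgue"
    using lebesgue_affine_measurable[of "\<lambda>_. -1" x] unfolding T by simp
  show "distr lebesgue lebesgue ((-) x) = lebesgue"
    using lebesgue_affine_euclidean[of "\<lambda>_. -1" x] unfolding T by (simp add: density_1)
qed

lemma AE_lborel_reflect:
  fixes x :: "'a::euclidean_space"
  assumes "AE y in lborel. Q y"
  shows "AE y in lborel. Q (x - y)"
proof -
  have "AE y in distr lborel borel ((-) x). Q y" unfolding lborel_distr_reflect by (rule assms)
  then show ?thesis by (rule AE_distrD[rotated]) simp
qed

lemma nn_integral_lborel_minus: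
  fixes x :: "'a::euclidean_space"
  assumes "f \<in> borel_measurable borel"
  shows "(\<integral>\<^sup>+y. f (y - x) \<partial>lborel) = (\<integral>\<^sup>+y. f y \<partial>lborel)"
  using assms by (subst (2) lborel_distr_minus[of x, symmetric]) (simp add: nn_integral_distr)

lemma integral_lborel_minus:
  fixes x :: "'a::euclidean_space" and f :: "'a \<Rightarrow> complex"
  assumes "f \<in> borel_measurable borel"
  shows "(\<integral>y. f (y - x) \<partial>lborel) = (\<integral>y. f y \<partial>lborel)"
  using assms by (subst (2) lborel_distr_minus[of x, symmetric]) (simp add: integral_distr)

lemma nn_convolution_borel:
  fixes \<alpha> h :: "'a::euclidean_space \<Rightarrow> ennreal"
  assumes [measurable]: "\<alpha> \<in> borel_measurable borel" "h \<in> borel_measurable borel"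
  shows "(\<integral>\<^sup>+x. (\<integral>\<^sup>+s. \<alpha> (x - s) * h s \<partial>lborel) \<partial>lborel) = (\<integral>\<^sup>+x. \<alpha> x \<partial>lborel) * (\<integral>\<^sup>+x. h x \<partial>lborel)"
proof -
  have "(\<integral>\<^sup>+x. (\<integral>\<^sup>+s. \<alpha> (x - s) * h s \<partial>lborel) \<partial>lborel)
      = (\<integral>\<^sup>+s. (\<integral>\<^sup>+x. \<alpha> (x - s) * h s \<partial>lborel) \<partial>lborel)"
    by (rule lborel_pair.Fubini'[symmetric]) measurable
  also have "\<dots> = (\<integral>\<^sup>+s. (\<integral>\<^sup>+x. \<alpha> x \<partial>lborel) * h s \<partial>lborel)"
    by (simp add: nn_integral_multc nn_integral_lborel_minus)
  finally show ?thesis by (simp add: nn_integral_cmult)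
qed

text \<open>Product measurability of \<open>\<alpha> (x - s)\<close> is immediate for Borel
  functions, so Borel versions are substituted. For each \<open>x\<close> the exceptional null set
  of \<open>\<alpha>\<close> is reflected to a null set; hence the inner integrals agree at every
  \<open>x\<close>, not just almost everywhere.\<close>

lemma nn_convolution_lebesgue:
  fixes \<alpha> h :: "'a::euclidean_space \<Rightarrow> ennreal"
  assumes "\<alpha> \<in> borel_measurable lebesgue" "h \<in> borel_measurable lebesgue"
  shows "(\<lambda>x. \<integral>\<^sup>+s. \<alpha> (x - s) * h s \<partial>lebesgue) \<in> borel_measurable lebesgue"
    and "(\<integral>\<^sup>+x. (\<integral>\<^sup>+s. \<alpha> (x - s) * h s \<partial>lebesgue) \<partial>lebesgue)
      = (\<integral>\<^sup>+x. \<alpha> x \<partial>lebesgue) * (\<integral>\<^sup>+x. h x \<partial>lebesgue)"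
proof -
  obtain \<alpha>' h' where b[measurable]: "\<alpha>' \<in> borel_measurable lborel" "h' \<in> borel_measurable lborel"
    and ae: "AE x in lborel. \<alpha> x = \<alpha>' x" "AE x in lborel. h x = h' x"
    using completion_ex_borel_measurable[OF assms(1)] completion_ex_borel_measurable[OF assms(2)] by blast
  have eq: "(\<integral>\<^sup>+s. \<alpha> (x - s) * h s \<partial>lebesgue) = (\<integral>\<^sup>+s. \<alpha>' (x - s) * h' s \<partial>lborel)" for x
    unfolding nn_integral_completion
    using AE_lborel_reflect[OF ae(1), of x] ae(2) by (intro nn_integral_cong_AE) auto
  have m: "(\<lambda>x. \<integral>\<^sup>+s. \<alpha>' (x - s) * h' s \<partial>lborel) \<in> borel_measurable lborel"
    by (intro lborel.borel_measurable_nn_integral) measurable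
  then show "(\<lambda>x. \<integral>\<^sup>+s. \<alpha> (x - s) * h s \<partial>lebesgue) \<in> borel_measurable lebesgue"
    unfolding eq by (rule measurable_completion)
  have "(\<integral>\<^sup>+x. \<alpha> x \<partial>lborel) = (\<integral>\<^sup>+x. \<alpha>' x \<partial>lborel)" "(\<integral>\<^sup>+x. h x \<partial>lborel) = (\<integral>\<^sup>+x. h' x \<partial>lborel)"
    using ae by (auto intro: nn_integral_cong_AE)
  then show "(\<integral>\<^sup>+x. (\<integral>\<^sup>+s. \<alpha> (x - s) * h s \<partial>lebesgue) \<partial>lebesgue)
      = (\<integral>\<^sup>+x. \<alpha> x \<partial>lebesgue) * (\<integral>\<^sup>+x. h x \<partial>lebesgue)"
    unfolding eq unfolding nn_integral_completion using b by (simp add: nn_convolution_borel)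
qed

lemma completion_ex_borel_measurable_complex:
  fixes g :: "'a \<Rightarrow> complex"
  assumes "g \<in> borel_measurable (completion M)"
  shows "\<exists>g'\<in>borel_measurable M. AE x in M. g x = g' x"
proof -
  have "(\<lambda>x. Re (g x)) \<in> borel_measurable (completion M)" "(\<lambda>x. Im (g x)) \<in> borel_measurable (completion M)"
    using assms by (auto intro: borel_measurable_Re borel_measurable_Im)
  then obtain u v where uv: "u \<in> borel_measurable M" "v \<in> borel_measurable M"
    "AE x in M. Re (g x) = u x" "AE x in M. Im (g x) = v x"
    using completion_ex_borel_measurable_real[of "\<lambda>x. Re (g x)" M]
      completion_ex_borel_measurable_real[of "\<lambda>x. Im (g x)" M] by blast
  have "(\<lambda>x. Complex (u x) (v x)) \<in> borel_measurable M"
    using uv(1,2) by (subst borel_measurable_complex_iff) simp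
  moreover have "AE x in M. g x = Complex (u x) (v x)"
    using uv(3,4) by eventually_elim (simp add: complex_eq_iff)
  ultimately show ?thesis by (intro bexI[of _ "\<lambda>x. Complex (u x) (v x)"])
qed

text \<open>Fubini for Borel versions of both factors; as in the nonnegative case, the inner
  integral is unchanged at every \<open>x\<close>.\<close>

lemma convolution_lebesgue:
  fixes \<alpha> \<beta> :: "'a::euclidean_space \<Rightarrow> complex"
  assumes \<alpha>: "integrable lebesgue \<alpha>" and \<beta>: "integrable lebesgue \<beta>"
  shows "integrable lebesgue (\<lambda>x. \<integral>s. \<alpha> (x - s) * \<beta> s \<partial>lebesgue)"
    and "(\<integral>x. (\<integral>s. \<alpha> (x - s) * \<beta> s \<partial>lebesgue) \<partial>lebesgue) = (\<integral>x. \<alpha> x \<partial>lebesgue) * (\<integral>x. \<beta> x \<partial>lebesgue)"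
proof -
  obtain \<alpha>' where [measurable]: "\<alpha>' \<in> borel_measurable lborel" and ae1: "AE x in lborel. \<alpha> x = \<alpha>' x"
    using completion_ex_borel_measurable_complex[OF borel_measurable_integrable[OF \<alpha>]] by blast
  obtain \<beta>' where [measurable]: "\<beta>' \<in> borel_measurable lborel" and ae2: "AE x in lborel. \<beta> x = \<beta>' x"
    using completion_ex_borel_measurable_complex[OF borel_measurable_integrable[OF \<beta>]] by blast
  have to_lborel: "integrable lborel f'" "(\<integral>x. f x \<partial>lebesgue) = (\<integral>x. f' x \<partial>lborel)"
    if "integrable lebesgue f" "f' \<in> borel_measurable lborel" "AE x in lborel. f x = f' x"
    for f f' :: "'a \<Rightarrow> complex"
  proof -
    have ae: "AE x in lebesgue. f x = f' x" using that(3) by (rule AE_completion)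
    have m: "f' \<in> borel_measurable lebesgue" using that(2) by (rule measurable_completion)
    have "integrable lebesgue f'"
      using that(1) integrable_cong_AE[OF borel_measurable_integrable[OF that(1)] m ae] by simp
    then show "integrable lborel f'" by (simp add: integrable_completion[OF that(2)])
    have "(\<integral>x. f x \<partial>lebesgue) = (\<integral>x. f' x \<partial>lebesgue)"
      by (rule integral_cong_AE[OF borel_measurable_integrable[OF that(1)] m ae])
    then show "(\<integral>x. f x \<partial>lebesgue) = (\<integral>x. f' x \<partial>lborel)" by (simp add: integral_completion[OF that(2)])
  qed
  have \<alpha>': "integrable lborel \<alpha>'" and I\<alpha>: "(\<integral>x. \<alpha> x \<partial>lebesgue) = (\<integral>x. \<alpha>' x \<partial>lborel)"
    by (rule to_lborel[OF \<alpha> _ ae1]; measurable)+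
  have \<beta>': "integrable lborel \<beta>'" and I\<beta>: "(\<integral>x. \<beta> x \<partial>lebesgue) = (\<integral>x. \<beta>' x \<partial>lborel)"
    by (rule to_lborel[OF \<beta> _ ae2]; measurable)+
  have eq: "(\<integral>s. \<alpha> (x - s) * \<beta> s \<partial>lebesgue) = (\<integral>s. \<alpha>' (x - s) * \<beta>' s \<partial>lborel)" for x
  proof -
    have "(\<integral>s. \<alpha> (x - s) * \<beta> s \<partial>lebesgue) = (\<integral>s. \<alpha>' (x - s) * \<beta>' s \<partial>lebesgue)"
    proof (rule integral_cong_AE)
      have "(\<lambda>s. \<alpha> (x - s)) \<in> borel_measurable lebesgue"
        by (rule measurable_compose[OF lebesgue_reflect(2) borel_measurable_integrable[OF \<alpha>]])
      then show "(\<lambda>s. \<alpha> (x - s) * \<beta> s) \<in> borel_measurable lebesgue"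
        using borel_measurable_integrable[OF \<beta>] by measurable
      have "(\<lambda>s. \<alpha>' (x - s) * \<beta>' s) \<in> borel_measurable lborel" by measurable
      then show "(\<lambda>s. \<alpha>' (x - s) * \<beta>' s) \<in> borel_measurable lebesgue"
        by (rule measurable_completion)
      show "AE s in lebesgue. \<alpha> (x - s) * \<beta> s = \<alpha>' (x - s) * \<beta>' s"
        using AE_lborel_reflect[OF ae1, of x] ae2 by (intro AE_completion) auto
    qed
    then show ?thesis by (subst (asm) (2) integral_completion) (simp_all, measurable)
  qed
  \<comment> \<open>Absolute integrability on the product is Tonelli: the double integral of the
    modulus is the product of the two \<open>L^1\<close> norms.\<close>
  have prod: "integrable (lborel \<Otimes>\<^sub>M lborel) (\<lambda>(x, s). \<alpha>' (x - s) * \<beta>' s)"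
  proof (rule integrableI_bounded)
    show "(\<lambda>(x, s). \<alpha>' (x - s) * \<beta>' s) \<in> borel_measurable (lborel \<Otimes>\<^sub>M lborel)" by measurable
    have "(\<integral>\<^sup>+z. ennreal (norm (case z of (x, s) \<Rightarrow> \<alpha>' (x - s) * \<beta>' s)) \<partial>(lborel \<Otimes>\<^sub>M lborel))
        = (\<integral>\<^sup>+x. (\<integral>\<^sup>+s. ennreal (norm (\<alpha>' (x - s))) * ennreal (norm (\<beta>' s)) \<partial>lborel) \<partial>lborel)"
      by (subst lborel.nn_integral_fst[symmetric]) (auto simp: norm_mult ennreal_mult)
    also have "\<dots> = (\<integral>\<^sup>+x. ennreal (norm (\<alpha>' x)) \<partial>lborel) * (\<integral>\<^sup>+x. ennreal (norm (\<beta>' x)) \<partial>lborel)"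
      by (rule nn_convolution_borel) measurable
    also have "\<dots> < \<infinity>"
      using \<alpha>' \<beta>' unfolding integrable_iff_bounded by (simp add: ennreal_mult_less_top)
    finally show "(\<integral>\<^sup>+z. ennreal (norm (case z of (x, s) \<Rightarrow> \<alpha>' (x - s) * \<beta>' s)) \<partial>(lborel \<Otimes>\<^sub>M lborel)) < \<infinity>" .
  qed
  have int: "integrable lborel (\<lambda>x. \<integral>s. \<alpha>' (x - s) * \<beta>' s \<partial>lborel)"
    by (rule lborel_pair.integrable_fst[OF prod])
  then show "integrable lebesgue (\<lambda>x. \<integral>s. \<alpha> (x - s) * \<beta> s \<partial>lebesgue)"
    unfolding eq by (simp add: integrable_completion[OF borel_measurable_integrable])
  have "(\<integral>x. (\<integral>s. \<alpha>' (x - s) * \<beta>' s \<partial>lborel) \<partial>lborel) = (\<integral>s. (\<integral>x. \<alpha>' (x - s) * \<beta>' s \<partial>lborel) \<partial>lborel)"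
    by (rule lborel_pair.Fubini_integral[symmetric, OF prod])
  also have "\<dots> = (\<integral>x. \<alpha>' x \<partial>lborel) * (\<integral>s. \<beta>' s \<partial>lborel)"
    by (simp add: integral_lborel_minus)
  finally show "(\<integral>x. (\<integral>s. \<alpha> (x - s) * \<beta> s \<partial>lebesgue) \<partial>lebesgue) = (\<integral>x. \<alpha> x \<partial>lebesgue) * (\<integral>x. \<beta> x \<partial>lebesgue)"
    unfolding eq I\<alpha> I\<beta> by (simp add: integral_completion[OF borel_measurable_integrable[OF int]])
qed

section \<open>Boxes exhausting the orthant\<close>

lemma box_lmeasurable [simp]: "{a..b::real^'n} \<in> lmeasurable"
  by (simp add: interval_cbox_cart)

lemma box_sets [simp]: "{a..b::real^'n} \<in> sets lebesgue"
  using box_lmeasurable fmeasurableD by blast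

lemma orthant_sets [simp]: "{0..} \<in> sets (lebesgue :: (real^'n) measure)"
  by (intro sets_completionI_sets) (simp add: borel_closed)

lemma box_compact [simp]: "compact {a..b::real^'n}"
  by (simp add: interval_cbox_cart)

text \<open>The componentwise order is only partial; binary suprema make the principal up-sets a
  filter base.\<close>

lemma eventually_at_top_vec:
  "eventually Q (at_top :: (real^'n) filter) \<longleftrightarrow> (\<exists>N. \<forall>t\<ge>N. Q t)"
  unfolding at_top_def
proof (subst eventually_INF_base)
  fix a b :: "real^'n"
  show "\<exists>x\<in>UNIV. principal {x..} \<le> inf (principal {a..}) (principal {b..})"
    by (intro bexI[of _ "sup a b"]) auto
qed (auto simp: eventually_principal)

lemma at_top_vec_neq_bot: "(at_top :: (real^'n) filter) \<noteq> bot"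
  unfolding trivial_limit_def eventually_at_top_vec by auto

lemma vec_mono: "x \<le> y \<Longrightarrow> vec x \<le> (vec y :: real^'n)"
  by (simp add: less_eq_vec_def)

lemma orthant_exhaustion:
  fixes t :: "real^'n"
  shows "\<exists>k. t \<le> vec (real k)"
proof -
  obtain k :: nat where k: "norm t \<le> real k" using real_arch_simple by blast
  have "t $ i \<le> real k" for i
    using component_le_norm_cart[of t i] k by linarith
  then show ?thesis by (auto simp: less_eq_vec_def)
qed

text \<open>Every point lies below some \<open>vec k\<close>, so the integrand is eventually 0
  pointwise, and it is dominated by \<open>h\<close>.\<close>

lemma orthant_tail_tendsto_0:
  fixes h :: "real^'n \<Rightarrow> ennreal"
  assumes [measurable]: "h \<in> borel_measurable lebesgue" and fin: "(\<integral>\<^sup>+t. h t \<partial>lebesgue) < \<infinity>"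
  shows "(\<lambda>k. \<integral>\<^sup>+t. h t * indicator ({0..} - {0..vec (real k)}) t \<partial>lebesgue) \<longlonglongrightarrow> 0"
proof -
  have "(\<lambda>k. \<integral>\<^sup>+t. h t * indicator ({0..} - {0..vec (real k)}) t \<partial>lebesgue) \<longlonglongrightarrow> (\<integral>\<^sup>+t. 0 \<partial>(lebesgue :: (real^'n) measure))"
  proof (rule nn_integral_dominated_convergence[OF _ _ assms(1) _ fin])
    show "(\<lambda>t. h t * indicator ({0..} - {0..vec (real k)}) t) \<in> borel_measurable lebesgue" for k
      by (intro borel_measurable_times_ennreal assms(1) borel_measurable_indicator sets.Diff) auto
    show "AE t in lebesgue. (\<lambda>k. h t * indicator ({0..} - {0..vec (real k)}) t) \<longlonglongrightarrow> 0"
    proof (rule AE_I2)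
      fix t :: "real^'n"
      obtain k where k: "t \<le> vec (real k)" using orthant_exhaustion by blast
      show "(\<lambda>k. h t * indicator ({0..} - {0..vec (real k)}) t) \<longlonglongrightarrow> 0"
      proof (rule tendsto_eventually, unfold eventually_sequentially, intro exI allI impI)
        fix m assume "k \<le> m"
        then have "t \<le> vec (real m)" using k vec_mono[of "real k" "real m"] by (meson of_nat_mono order_trans)
        then show "h t * indicator ({0..} - {0..vec (real m)}) t = 0" by (auto simp: indicator_def)
      qed
    qed
  qed (auto simp: indicator_def intro!: AE_I2)
  then show ?thesis by simp
qed

text \<open>Local integrability speaks about compact sets only. The cubes exhaust the orthant, and
  the truncations of \<open>h\<close> to them are eventually constant at each point.\<close>

lemma borel_measurable_orthantI:
  fixes h :: "real^'n \<Rightarrow> 'b::euclidean_space"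
  assumes "\<And>k::nat. h \<in> borel_measurable (lebesgue_on {0..vec (real k)})"
  shows "(\<lambda>t. if t \<in> {0..} then h t else 0) \<in> borel_measurable lebesgue"
proof (rule borel_measurable_LIMSEQ_metric)
  show "(\<lambda>t. if t \<in> {0..vec (real k)} then h t else 0) \<in> borel_measurable lebesgue" for k
    using assms[of k] borel_measurable_if[OF box_sets] by blast
  fix t :: "real^'n"
  obtain k where k: "t \<le> vec (real k)" using orthant_exhaustion by blast
  have "(if t \<in> {0..vec (real m)} then h t else 0) = (if t \<in> {0..} then h t else 0)" if "k \<le> m" for m
    using k vec_mono[of "real k" "real m"] that by (auto intro: order_trans)
  then show "(\<lambda>m. if t \<in> {0..vec (real m)} then h t else 0) \<longlonglongrightarrow> (if t \<in> {0..} then h t else 0)"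
    by (intro tendsto_eventually) (unfold eventually_sequentially, blast)
qed

lemma nn_integral_lebesgue_on:
  "S \<in> sets lebesgue \<Longrightarrow> (\<integral>\<^sup>+t. f t \<partial>lebesgue_on S) = (\<integral>\<^sup>+t. f t * indicator S t \<partial>lebesgue)"
  by (rule nn_integral_restrict_space) simp

text \<open>Dominated convergence concerns sequences, while this limit runs over a net of boxes. A
  single cube outside of which \<open>\<phi>\<close> has mass below \<open>e\<close> settles all
  larger boxes at once.\<close>

lemma integral_orthant_tendsto:
  fixes \<phi> :: "real^'n \<Rightarrow> complex"
  assumes \<phi>: "integrable lebesgue \<phi>" and zero: "\<And>t. t \<notin> {0..} \<Longrightarrow> \<phi> t = 0"
  shows "((\<lambda>t. \<integral>s. \<phi> s \<partial>lebesgue_on {0..t}) \<longlongrightarrow> (\<integral>s. \<phi> s \<partial>lebesgue)) at_top"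
proof (rule tendstoI)
  fix e :: real assume e: "e > 0"
  let ?R = "\<lambda>k. \<integral>\<^sup>+s. ennreal (cmod (\<phi> s)) * indicator ({0..} - {0..vec (real k)}) s \<partial>lebesgue"
  have "(\<lambda>k. ?R k) \<longlonglongrightarrow> 0"
    using \<phi> unfolding integrable_iff_bounded by (intro orthant_tail_tendsto_0) auto
  then have "\<forall>\<^sub>F k in sequentially. ?R k < ennreal e"
    by (rule order_tendstoD(2)) (use e in simp)
  then obtain k where k: "?R k < ennreal e" unfolding eventually_sequentially by blast
  have "dist (\<integral>s. \<phi> s \<partial>lebesgue_on {0..t}) (\<integral>s. \<phi> s \<partial>lebesgue) < e" if t: "vec (real k) \<le> t" for t
  proof -
    have int: "integrable lebesgue (\<lambda>s. indicator {0..t} s *\<^sub>R \<phi> s)"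
      using integrable_mult_indicator[OF box_sets \<phi>] .
    have eq: "(\<integral>s. \<phi> s \<partial>lebesgue) - (\<integral>s. \<phi> s \<partial>lebesgue_on {0..t}) = (\<integral>s. \<phi> s - indicator {0..t} s *\<^sub>R \<phi> s \<partial>lebesgue)"
      using \<phi> int by (simp add: integral_restrict_space)
    have "ennreal (cmod ((\<integral>s. \<phi> s \<partial>lebesgue) - (\<integral>s. \<phi> s \<partial>lebesgue_on {0..t})))
        \<le> (\<integral>\<^sup>+s. ennreal (cmod (\<phi> s - indicator {0..t} s *\<^sub>R \<phi> s)) \<partial>lebesgue)"
      unfolding eq using \<phi> int by (intro integral_norm_bound_ennreal) simp
    also have "\<dots> \<le> ?R k"
      using zero t by (intro nn_integral_mono) (auto simp: indicator_def intro: order_trans)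
    also note k
    finally show ?thesis using e by (simp add: dist_norm norm_minus_commute ennreal_less_iff)
  qed
  then show "\<forall>\<^sub>F t in at_top. dist (\<integral>s. \<phi> s \<partial>lebesgue_on {0..t}) (\<integral>s. \<phi> s \<partial>lebesgue) < e"
    unfolding eventually_at_top_vec by blast
qed

section \<open>Integrals over growing boxes\<close>

context seminorm_system
begin

lemma L1_loc_has_sint:
  assumes "f \<in> L1_loc P" "compact K" "K \<subseteq> {0..}"
  shows "has_sint P (lebesgue_on K) f (sc_integral P K f)"
  using assms by (intro has_sint_sc_integral lmeasurable_compact) (auto simp: L1_loc_def)

lemma L1_loc_box:
  fixes f :: "real^'n \<Rightarrow> 'a"
  shows "f \<in> L1_loc P \<Longrightarrow> has_sint P (lebesgue_on {0..t}) f (sc_integral P {0..t} f)"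
  by (rule L1_loc_has_sint) auto

lemma L1_locI:
  fixes f :: "real^'n \<Rightarrow> 'a"
  assumes "\<And>K. compact K \<Longrightarrow> K \<subseteq> {0..} \<Longrightarrow> \<exists>I. has_sint P (lebesgue_on K) f I"
  shows "f \<in> L1_loc P"
  using assms unfolding L1_loc_def by (auto simp: sc_integrable_iff[OF lmeasurable_compact])

lemma L1_loc_seminorm_measurable:
  fixes f :: "real^'n \<Rightarrow> 'a"
  assumes f: "f \<in> L1_loc P" and p: "p \<in> P"
  shows "(\<lambda>t. ennreal (p (f t)) * indicator {0..} t) \<in> borel_measurable lebesgue"
proof -
  have "(\<lambda>t. p (f t)) \<in> borel_measurable (lebesgue_on {0..vec (real k)})" for k
  proof -
    interpret seminorm_system_measure P "lebesgue_on {0..vec (real k) :: real^'n}"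
      by (rule seminorm_system_lebesgue_on) simp
    show ?thesis using has_sint_measurable[OF L1_loc_box[OF f] p] .
  qed
  then have m: "(\<lambda>t. if t \<in> {0..} then p (f t) else 0) \<in> borel_measurable lebesgue"
    by (rule borel_measurable_orthantI)
  have "(\<lambda>t. ennreal (p (f t)) * indicator {0..} t) = (\<lambda>t. ennreal (if t \<in> {0..} then p (f t) else 0))"
    by (auto simp: fun_eq_iff)
  then show ?thesis using m by simp
qed

text \<open>The restriction of \<open>f\<close> to the cube is extended by zero to
  \<open>{0..t}\<close>, so the difference of the integrals is the integral of a function that
  vanishes on the cube.\<close>

lemma sint_tail_le:
  fixes f :: "real^'n \<Rightarrow> 'a"
  assumes f: "f \<in> L1_loc P" and p: "p \<in> P" and t: "vec (real k) \<le> t"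
  shows "ennreal (p (sc_integral P {0..t} f - sc_integral P {0..vec (real k)} f))
    \<le> (\<integral>\<^sup>+s. ennreal (p (f s)) * indicator {0..} s * indicator ({0..} - {0..vec (real k)}) s \<partial>lebesgue)"
proof -
  interpret seminorm_system_measure P "lebesgue_on {0..t}"
    by (rule seminorm_system_lebesgue_on) simp
  let ?B = "{0..vec (real k)} :: (real^'n) set"
  have sub: "?B \<subseteq> {0..t}" using t by auto
  have "restrict_space (lebesgue_on {0..t}) ?B = lebesgue_on ?B"
    using sub by (subst restrict_restrict_space) (auto simp: Int_absorb1)
  then have "has_sint P (restrict_space (lebesgue_on {0..t}) ?B) f (sc_integral P ?B f)"
    using L1_loc_box[OF f, of "vec (real k)"] by simp
  moreover have "?B \<in> sets (lebesgue_on {0..t})"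
    using sub by (auto simp: sets_restrict_space_iff)
  ultimately have "has_sint P (lebesgue_on {0..t}) (\<lambda>s. if s \<in> ?B then f s else 0) (sc_integral P ?B f)"
    by (rule has_sint_extend)
  from has_sint_bound[OF has_sint_diff[OF L1_loc_box[OF f] this] p]
  have "ennreal (p (sc_integral P {0..t} f - sc_integral P ?B f))
    \<le> (\<integral>\<^sup>+s. ennreal (p (f s - (if s \<in> ?B then f s else 0))) \<partial>lebesgue_on {0..t})" .
  also have "\<dots> = (\<integral>\<^sup>+s. ennreal (p (f s - (if s \<in> ?B then f s else 0))) * indicator {0..t} s \<partial>lebesgue)"
    by (simp add: nn_integral_lebesgue_on)
  also have "\<dots> \<le> (\<integral>\<^sup>+s. ennreal (p (f s)) * indicator {0..} s * indicator ({0..} - ?B) s \<partial>lebesgue)"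
    using p by (intro nn_integral_mono) (auto simp: indicator_def)
  finally show ?thesis .
qed

text \<open>Completeness is available for sequences only. The integrals over cubes form a Cauchy
  sequence, and the tail bound carries its limit over to arbitrary boxes.\<close>

lemma L1_loc_limit_exists:
  fixes f :: "real^'n \<Rightarrow> 'a"
  assumes f: "f \<in> L1_loc P"
    and fin: "\<And>p. p \<in> P \<Longrightarrow> (\<integral>\<^sup>+t. ennreal (p (f t)) \<partial>lebesgue_on {0..}) < \<infinity>"
  shows "\<exists>L. ((\<lambda>t. sc_integral P {0..t} f) \<longlongrightarrow> L) at_top"
proof -
  define R where "R p k = (\<integral>\<^sup>+s. ennreal (p (f s)) * indicator {0..} s * indicator ({0..} - {0..vec (real k)}) s \<partial>lebesgue)"
    for p :: "'a \<Rightarrow> real" and k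
  have R0: "R p \<longlonglongrightarrow> 0" if "p \<in> P" for p
    unfolding R_def using fin[OF that]
    by (intro orthant_tail_tendsto_0 L1_loc_seminorm_measurable[OF f that]) (simp add: nn_integral_lebesgue_on)
  have Re: "\<exists>k. R p k < ennreal e" if "p \<in> P" "e > 0" for p e
    using order_tendstoD(2)[OF R0[OF that(1)], of "ennreal e"] that(2) by (auto simp: eventually_sequentially)
  let ?u = "\<lambda>k::nat. sc_integral P {0..vec (real k)} f"
  have "\<exists>L. ?u \<longlonglongrightarrow> L"
  proof (rule seq_complete_seminorm)
    fix p :: "'a \<Rightarrow> real" and e :: real assume p: "p \<in> P" and e: "e > 0"
    obtain k0 where k0: "R p k0 < ennreal (e / 2)" using Re[OF p, of "e / 2"] e by auto
    have *: "p (?u k - ?u k0) \<le> e / 2" if "k \<ge> k0" for k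
    proof -
      have "ennreal (p (?u k - ?u k0)) \<le> ennreal (e / 2)"
        using sint_tail_le[OF f p, of k0 "vec (real k)"] vec_mono[of "real k0" "real k"] that k0
        unfolding R_def by (meson less_imp_le of_nat_mono order_trans)
      then show ?thesis using e by simp
    qed
    have "p (?u k - ?u m) \<le> e" if "k \<ge> k0" "m \<ge> k0" for k m
      using triangle_via[OF p, of "?u k" "?u m" "?u k0"] *[OF that(1)] *[OF that(2)]
      by (simp add: minus_commute[OF p, of "?u k0"])
    then show "\<exists>k0. \<forall>k\<ge>k0. \<forall>m\<ge>k0. p (?u k - ?u m) \<le> e" by blast
  qed
  then obtain L where L: "?u \<longlonglongrightarrow> L" ..
  have "((\<lambda>t. sc_integral P {0..t} f) \<longlongrightarrow> L) at_top"
  proof (rule tendstoI_seminorm)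
    fix p assume p: "p \<in> P"
    show "((\<lambda>t. p (sc_integral P {0..t} f - L)) \<longlongrightarrow> 0) at_top"
    proof (rule tendstoI)
      fix e :: real assume e: "e > 0"
      obtain k1 where k1: "R p k1 < ennreal (e / 4)" using Re[OF p, of "e / 4"] e by auto
      have *: "p (sc_integral P {0..t} f - ?u k1) \<le> e / 4" if "vec (real k1) \<le> t" for t
      proof -
        have "ennreal (p (sc_integral P {0..t} f - ?u k1)) \<le> ennreal (e / 4)"
          using sint_tail_le[OF f p that] k1 unfolding R_def by (meson less_imp_le order_trans)
        then show ?thesis using e by simp
      qed
      have "\<forall>\<^sub>F k in sequentially. p (?u k - L) < e / 4"
        using tendstoD_seminorm(1)[OF p L] by (rule order_tendstoD(2)) (use e in simp)
      then obtain k2 where k2: "\<And>k. k \<ge> k2 \<Longrightarrow> p (?u k - L) < e / 4"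
        unfolding eventually_sequentially by blast
      \<comment> \<open>\<open>k1\<close> controls the tail and \<open>k2\<close> the distance of
        the sequence from its limit; the larger index serves both.\<close>
      let ?m = "max k1 k2"
      have "dist (p (sc_integral P {0..t} f - L)) 0 < e" if t: "vec (real k1) \<le> t" for t
      proof -
        have "p (sc_integral P {0..t} f - L)
            \<le> p (sc_integral P {0..t} f - ?u k1) + (p (?u k1 - ?u ?m) + p (?u ?m - L))"
          using triangle_via[OF p, of "sc_integral P {0..t} f" L "?u k1"]
            triangle_via[OF p, of "?u k1" L "?u ?m"] by linarith
        also have "\<dots> < e"
        proof -
          have "p (?u ?m - ?u k1) \<le> e / 4" by (rule *[OF vec_mono]) simp
          moreover have "p (?u ?m - L) < e / 4" by (rule k2) simp
          ultimately show ?thesis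
            using *[OF t] e minus_commute[OF p, of "?u k1" "?u ?m"] by linarith
        qed
        finally show ?thesis using p by simp
      qed
      then show "\<forall>\<^sub>F t in at_top. dist (p (sc_integral P {0..t} f - L)) 0 < e"
        unfolding eventually_at_top_vec by blast
    qed
  qed
  then show ?thesis ..
qed

end

section \<open>Convolution with step functions and its error\<close>

locale convolution_pair = seminorm_system P for P :: "('a::sclcs \<Rightarrow> real) set" +
  fixes A :: "real^'n \<Rightarrow> complex" and F :: "real^'n \<Rightarrow> 'a"
  assumes A: "A \<in> L1_loc {cmod}" and F: "F \<in> L1_loc P"
    and finA: "(\<integral>\<^sup>+t. ennreal (cmod (A t)) \<partial>lebesgue_on {0..}) < \<infinity>"
    and finF: "\<And>p. p \<in> P \<Longrightarrow> (\<integral>\<^sup>+t. ennreal (p (F t)) \<partial>lebesgue_on {0..}) < \<infinity>"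
begin

text \<open>With this extension the integral over \<open>{0..x}\<close> becomes one over the whole
  space whenever the other factor lives in the orthant: for \<open>s\<close> in the orthant,
  \<open>A0 (x - s)\<close> vanishes unless \<open>s \<le> x\<close>.\<close>

definition A0 where "A0 t = (if t \<in> {0..} then A t else 0)"

lemma A_has_bochner: "has_bochner_integral (lebesgue_on {0..t}) A (sc_integral {cmod} {0..t} A)"
proof -
  interpret C: seminorm_system_measure "{cmod}" "lebesgue_on {0..t}"
    by (rule seminorm_system.seminorm_system_lebesgue_on[OF seminorm_system_complex]) simp
  show ?thesis
    using seminorm_system.L1_loc_box[OF seminorm_system_complex A, of t]
    by (simp add: has_sint_complex_iff[OF C.complete_measure_axioms C.finite_measure_axioms])
qed

lemma A0_integrable: "integrable lebesgue A0"
proof (rule integrableI_bounded)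
  have "A \<in> borel_measurable (lebesgue_on {0..vec (real k)})" for k
    using A_has_bochner[of "vec (real k)"] by (auto simp: has_bochner_integral_iff)
  then show "A0 \<in> borel_measurable lebesgue"
    unfolding A0_def[abs_def] by (rule borel_measurable_orthantI)
  have "(\<integral>\<^sup>+t. ennreal (cmod (A0 t)) \<partial>lebesgue) = (\<integral>\<^sup>+t. ennreal (cmod (A t)) \<partial>lebesgue_on {0..})"
    unfolding nn_integral_lebesgue_on[OF orthant_sets]
    by (intro nn_integral_cong) (auto simp: A0_def indicator_def)
  then show "(\<integral>\<^sup>+t. ennreal (cmod (A0 t)) \<partial>lebesgue) < \<infinity>" using finA by simp
qed

text \<open>The \<open>L^1\<close> norm of \<open>A\<close> on the orthant; it bounds convolution
  with \<open>A\<close> in every seminorm as well as all box integrals of \<open>A\<close>.\<close>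

definition N where "N = (\<integral>t. cmod (A0 t) \<partial>lebesgue)"

lemma N_nonneg: "0 \<le> N"
  unfolding N_def by simp

lemma nn_integral_A0: "(\<integral>\<^sup>+t. ennreal (cmod (A0 t)) \<partial>lebesgue) = ennreal N"
  unfolding N_def using A0_integrable by (intro nn_integral_eq_integral) auto

lemma integral_A_box: "sc_integral {cmod} {0..t} A = (\<integral>s. A0 s \<partial>lebesgue_on {0..t})"
proof -
  have "(\<integral>s. A s \<partial>lebesgue_on {0..t}) = (\<integral>s. A0 s \<partial>lebesgue_on {0..t})"
    by (intro Bochner_Integration.integral_cong) (auto simp: A0_def)
  then show ?thesis using A_has_bochner[of t] by (simp add: has_bochner_integral_iff)
qed

lemma integral_A_box_le: "cmod (sc_integral {cmod} {0..t} A) \<le> N"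
proof -
  have "cmod (\<integral>s. A0 s \<partial>lebesgue_on {0..t}) = cmod (\<integral>s. indicator {0..t} s *\<^sub>R A0 s \<partial>lebesgue)"
    by (simp add: integral_restrict_space)
  also have "\<dots> \<le> (\<integral>s. cmod (indicator {0..t} s *\<^sub>R A0 s) \<partial>lebesgue)"
    by (rule integral_norm_bound)
  also have "\<dots> \<le> N"
    unfolding N_def using A0_integrable
    by (intro integral_mono integrable_norm integrable_mult_indicator) (auto simp: indicator_def)
  finally show ?thesis by (simp add: integral_A_box)
qed

lemma A0_reflect_measurable: "(\<lambda>s. A0 (x - s)) \<in> borel_measurable lebesgue"
  by (rule measurable_compose[OF lebesgue_reflect(2) borel_measurable_integrable[OF A0_integrable]])

lemma A0_reflect_integrable: "integrable lebesgue (\<lambda>s. A0 (x - s))"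
  using integrable_distr[OF lebesgue_reflect(2), of x A0] lebesgue_reflect(1)[of x] A0_integrable by simp

lemma A_reflect: "s \<in> {0..x} \<Longrightarrow> A (x - s) = A0 (x - s)"
  by (auto simp: A0_def)

lemma A0_reflect_0: "s \<in> {0..} \<Longrightarrow> s \<notin> {0..x} \<Longrightarrow> A0 (x - s) = 0"
  by (auto simp: A0_def)

text \<open>In the application \<open>Y\<close> is a set of values and \<open>E y\<close> the level
  set of \<open>y\<close>. The indicators are complex-valued so that \<open>has_sint_scalar\<close>
  applies to each summand.\<close>

definition step :: "'a set \<Rightarrow> ('a \<Rightarrow> (real^'n) set) \<Rightarrow> real^'n \<Rightarrow> 'a" where
  "step Y E t = (\<Sum>y\<in>Y. complex_of_real (indicat_real (E y) t) *\<^sub>C y)"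

definition conv_ind :: "(real^'n) set \<Rightarrow> real^'n \<Rightarrow> complex" where
  "conv_ind S x = (\<integral>s. A0 (x - s) * complex_of_real (indicat_real S s) \<partial>lebesgue)"

text \<open>Available at every point, since only scalar convolutions occur;
  \<open>has_sint_conv_step\<close> identifies it as the convolution of \<open>A\<close> with the
  step function.\<close>

definition conv_step :: "'a set \<Rightarrow> ('a \<Rightarrow> (real^'n) set) \<Rightarrow> real^'n \<Rightarrow> 'a" where
  "conv_step Y E x = (\<Sum>y\<in>Y. conv_ind (E y) x *\<^sub>C y)"

definition admissible :: "'a set \<Rightarrow> ('a \<Rightarrow> (real^'n) set) \<Rightarrow> bool" where
  "admissible Y E \<longleftrightarrow> finite Y \<and> (\<forall>y\<in>Y. E y \<in> lmeasurable \<and> E y \<subseteq> {0..})"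

text \<open>The cutoff to the orthant lets integrals range over the whole space although nothing is
  known about \<open>F\<close> outside the orthant.\<close>

definition err :: "('a \<Rightarrow> real) \<Rightarrow> 'a set \<Rightarrow> ('a \<Rightarrow> (real^'n) set) \<Rightarrow> real^'n \<Rightarrow> ennreal" where
  "err p Y E t = ennreal (p (F t - step Y E t)) * indicator {0..} t"

text \<open>A scalar convolution that dominates, pointwise in \<open>x\<close>, the
  \<open>p\<close>-distance between the convolutions of \<open>A\<close> with \<open>F\<close> and
  with the step function.\<close>

definition conv_err :: "('a \<Rightarrow> real) \<Rightarrow> 'a set \<Rightarrow> ('a \<Rightarrow> (real^'n) set) \<Rightarrow> real^'n \<Rightarrow> ennreal" where
  "conv_err p Y E x = (\<integral>\<^sup>+s. ennreal (cmod (A0 (x - s))) * err p Y E s \<partial>lebesgue)"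

lemma integrable_indicator_complex:
  "S \<in> lmeasurable \<Longrightarrow> integrable lebesgue (\<lambda>s. complex_of_real (indicat_real S s))"
  by (intro integrable_of_real integrable_real_indicator) (auto simp: fmeasurable_def)

lemma conv_ind_integrable: "S \<in> lmeasurable \<Longrightarrow> integrable lebesgue (conv_ind S)"
  unfolding conv_ind_def[abs_def]
  by (rule convolution_lebesgue(1)[OF A0_integrable integrable_indicator_complex])

lemma integral_conv_ind:
  "S \<in> lmeasurable \<Longrightarrow> (\<integral>x. conv_ind S x \<partial>lebesgue)
    = (\<integral>x. A0 x \<partial>lebesgue) * (\<integral>s. complex_of_real (indicat_real S s) \<partial>lebesgue)"
  unfolding conv_ind_def[abs_def]
  by (rule convolution_lebesgue(2)[OF A0_integrable integrable_indicator_complex])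

text \<open>A point of \<open>S\<close> lies in the orthant and hence cannot lie below
  \<open>x\<close>, so the reflected factor is evaluated off its support.
  \<open>integral_orthant_tendsto\<close> asks for this support condition.\<close>

lemma conv_ind_zero:
  assumes S: "S \<subseteq> {0..}" and x: "x \<notin> {0..}"
  shows "conv_ind S x = 0"
proof -
  have "A0 (x - s) * complex_of_real (indicat_real S s) = 0" for s
  proof (cases "s \<in> S")
    case True
    then have "s \<in> {0..}" "s \<notin> {0..x}" using S x by (auto intro: order_trans)
    then show ?thesis using A0_reflect_0 by simp
  qed simp
  then show ?thesis unfolding conv_ind_def by (simp only: integral_zero)
qed

lemma has_sint_conv_step:
  assumes adm: "admissible Y E"
  shows "has_sint P (lebesgue_on {0..x}) (\<lambda>s. A (x - s) *\<^sub>C step Y E s) (conv_step Y E x)"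
proof -
  interpret seminorm_system_measure P "lebesgue_on {0..x}"
    by (rule seminorm_system_lebesgue_on) simp
  have "has_sint P (lebesgue_on {0..x})
      (\<lambda>s. \<Sum>y\<in>Y. (A (x - s) * complex_of_real (indicat_real (E y) s)) *\<^sub>C y) (conv_step Y E x)"
    unfolding conv_step_def
  proof (rule has_sint_sum)
    fix y assume y: "y \<in> Y"
    have E: "E y \<in> sets lebesgue" "E y \<subseteq> {0..}" using adm y by (auto simp: admissible_def fmeasurableD)
    have "integrable lebesgue (\<lambda>s. indicator (E y) s *\<^sub>R A0 (x - s))"
      by (rule integrable_mult_indicator[OF E(1) A0_reflect_integrable])
    then have int: "integrable lebesgue (\<lambda>s. A0 (x - s) * complex_of_real (indicat_real (E y) s))"
      by (simp add: scaleR_conv_of_real mult.commute)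
    \<comment> \<open>Outside the box but inside the orthant, \<open>x - s\<close> has a negative
      coordinate, where \<open>A0\<close> vanishes; so restriction to the box changes
      nothing.\<close>
    have eq: "indicator {0..x} s *\<^sub>R (A (x - s) * complex_of_real (indicat_real (E y) s))
        = A0 (x - s) * complex_of_real (indicat_real (E y) s)" for s
      using A_reflect[of s x] A0_reflect_0[of s x] E(2) by (cases "s \<in> {0..x}") (auto simp: indicator_def)
    have i: "integrable (lebesgue_on {0..x}) (\<lambda>s. A (x - s) * complex_of_real (indicat_real (E y) s))"
      using int by (subst integrable_restrict_space) (simp_all add: eq)
    have v: "(\<integral>s. A (x - s) * complex_of_real (indicat_real (E y) s) \<partial>lebesgue_on {0..x}) = conv_ind (E y) x"
      unfolding conv_ind_def by (subst integral_restrict_space) (simp_all add: eq)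
    show "has_sint P (lebesgue_on {0..x})
        (\<lambda>s. (A (x - s) * complex_of_real (indicat_real (E y) s)) *\<^sub>C y) (conv_ind (E y) x *\<^sub>C y)"
      using has_sint_scalar[OF i, of y] unfolding v .
  qed
  moreover have "(\<Sum>y\<in>Y. (c * d y) *\<^sub>C y) = c *\<^sub>C (\<Sum>y\<in>Y. d y *\<^sub>C y)" for c and d :: "'a \<Rightarrow> complex"
    by (induction Y rule: infinite_finite_induct) (simp_all add: scaleC_zero_right scaleC_add_right scaleC_scaleC)
  ultimately show ?thesis unfolding step_def by simp
qed

lemma has_sint_sum_scalar:
  assumes "K \<in> lmeasurable" "\<And>y. y \<in> Y \<Longrightarrow> integrable lebesgue (\<phi> y)"
  shows "has_sint P (lebesgue_on K) (\<lambda>x. \<Sum>y\<in>Y. \<phi> y x *\<^sub>C y) (\<Sum>y\<in>Y. (\<integral>x. \<phi> y x \<partial>lebesgue_on K) *\<^sub>C y)"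
proof -
  interpret seminorm_system_measure P "lebesgue_on K"
    by (rule seminorm_system_lebesgue_on) fact
  have K: "K \<in> sets lebesgue" using assms(1) by (rule fmeasurableD)
  show ?thesis
  proof (intro has_sint_sum has_sint_scalar)
    fix y assume "y \<in> Y"
    then show "integrable (lebesgue_on K) (\<phi> y)"
      using integrable_mult_indicator[OF K assms(2)] K by (simp add: integrable_restrict_space)
  qed
qed

lemma has_sint_conv_step_outer:
  assumes "admissible Y E" "K \<in> lmeasurable"
  shows "has_sint P (lebesgue_on K) (conv_step Y E) (\<Sum>y\<in>Y. (\<integral>x. conv_ind (E y) x \<partial>lebesgue_on K) *\<^sub>C y)"
  unfolding conv_step_def[abs_def]
  using assms by (intro has_sint_sum_scalar conv_ind_integrable) (auto simp: admissible_def)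

lemma has_sint_step:
  assumes "admissible Y E" "K \<in> lmeasurable"
  shows "has_sint P (lebesgue_on K) (step Y E)
    (\<Sum>y\<in>Y. (\<integral>x. complex_of_real (indicat_real (E y) x) \<partial>lebesgue_on K) *\<^sub>C y)"
  unfolding step_def[abs_def]
  using assms by (intro has_sint_sum_scalar integrable_indicator_complex) (auto simp: admissible_def)

lemma err_measurable:
  assumes adm: "admissible Y E" and p: "p \<in> P"
  shows "err p Y E \<in> borel_measurable lebesgue"
proof -
  have "(\<lambda>t. F t - step Y E t) \<in> L1_loc P"
  proof (rule L1_locI)
    fix K :: "(real^'n) set" assume K: "compact K" "K \<subseteq> {0..}"
    interpret seminorm_system_measure P "lebesgue_on K"
      by (rule seminorm_system_lebesgue_on) (use K lmeasurable_compact in blast)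
    show "\<exists>I. has_sint P (lebesgue_on K) (\<lambda>t. F t - step Y E t) I"
      using has_sint_diff[OF L1_loc_has_sint[OF F K] has_sint_step[OF adm lmeasurable_compact[OF K(1)]]] by blast
  qed
  from L1_loc_seminorm_measurable[OF this p] show ?thesis unfolding err_def[abs_def] .
qed

text \<open>The \<open>L^1\<close> case of Young's inequality, an equality here by Tonelli because
  both factors are nonnegative: an error of \<open>F\<close> in mean is multiplied by
  \<open>N\<close>, for every seminorm.\<close>

lemma conv_err_measurable:
  assumes "admissible Y E" "p \<in> P"
  shows "conv_err p Y E \<in> borel_measurable lebesgue"
    and "(\<integral>\<^sup>+x. conv_err p Y E x \<partial>lebesgue) = ennreal N * (\<integral>\<^sup>+t. err p Y E t \<partial>lebesgue)"
proof -
  have m: "(\<lambda>x. ennreal (cmod (A0 x))) \<in> borel_measurable lebesgue"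
    using borel_measurable_integrable[OF A0_integrable] by measurable
  show "conv_err p Y E \<in> borel_measurable lebesgue"
    unfolding conv_err_def[abs_def] by (rule nn_convolution_lebesgue(1)[OF m err_measurable[OF assms]])
  show "(\<integral>\<^sup>+x. conv_err p Y E x \<partial>lebesgue) = ennreal N * (\<integral>\<^sup>+t. err p Y E t \<partial>lebesgue)"
    unfolding conv_err_def[abs_def] nn_convolution_lebesgue(2)[OF m err_measurable[OF assms]] nn_integral_A0 ..
qed

lemma nn_integral_conv_err:
  assumes "p \<in> P"
  shows "(\<integral>\<^sup>+s. ennreal (p (A (x - s) *\<^sub>C F s - A (x - s) *\<^sub>C step Y E s)) \<partial>lebesgue_on {0..x}) \<le> conv_err p Y E x"
  unfolding conv_err_def nn_integral_lebesgue_on[OF box_sets] err_def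
  using assms by (intro nn_integral_mono)
    (auto simp: indicator_def A0_def scale ennreal_mult simp flip: scaleC_diff_right)

text \<open>Holds at each single point where the convolution integral exists, before anything is
  known about the convolution as a function of \<open>x\<close>.\<close>

lemma conv_err_bound:
  assumes adm: "admissible Y E" and p: "p \<in> P"
    and C: "has_sint P (lebesgue_on {0..x}) (\<lambda>s. A (x - s) *\<^sub>C F s) C"
  shows "ennreal (p (C - conv_step Y E x)) \<le> conv_err p Y E x"
proof -
  interpret seminorm_system_measure P "lebesgue_on {0..x}"
    by (rule seminorm_system_lebesgue_on) simp
  show ?thesis
    using has_sint_bound[OF has_sint_diff[OF C has_sint_conv_step[OF adm]] p] nn_integral_conv_err[OF p]
    by (rule order_trans)
qed

text \<open>Half of \<open>e\<close> pays for cutting off outside a large cube, half for a simple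
  function on the cube. The step function depends on \<open>p\<close>.\<close>

lemma step_approximation:
  assumes p: "p \<in> P" and e: "e > 0"
  shows "\<exists>Y E. admissible Y E \<and> (\<integral>\<^sup>+t. err p Y E t \<partial>lebesgue) < ennreal e"
proof -
  let ?h = "\<lambda>t. ennreal (p (F t)) * indicator {0..} t"
  have hm: "?h \<in> borel_measurable lebesgue" by (rule L1_loc_seminorm_measurable[OF F p])
  have "(\<lambda>k. \<integral>\<^sup>+t. ?h t * indicator ({0..} - {0..vec (real k)}) t \<partial>lebesgue) \<longlonglongrightarrow> 0"
    using finF[OF p] by (intro orthant_tail_tendsto_0 hm) (simp add: nn_integral_lebesgue_on)
  from order_tendstoD(2)[OF this, of "ennreal (e / 2)"]
  obtain k where k: "(\<integral>\<^sup>+t. ?h t * indicator ({0..} - {0..vec (real k)}) t \<partial>lebesgue) < ennreal (e / 2)"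
    using e by (auto simp: eventually_sequentially)
  let ?B = "{0..vec (real k)} :: (real^'n) set"
  interpret seminorm_system_measure P "lebesgue_on ?B"
    by (rule seminorm_system_lebesgue_on) simp
  obtain s where s: "simple_approx P (lebesgue_on ?B) F s"
    using L1_loc_box[OF F, of "vec (real k)"] unfolding has_sint_def by blast
  from order_tendstoD(2)[OF simple_approxD(3)[OF s p], of "ennreal (e / 2)"]
  obtain j where j: "(\<integral>\<^sup>+t. ennreal (p (F t - s j t)) \<partial>lebesgue_on ?B) < ennreal (e / 2)"
    using e by (auto simp: eventually_sequentially)
  note sj = simple_approxD(1)[OF s, of j]
  \<comment> \<open>The step function takes the values of \<open>s j\<close> on the cube and 0 off
    it.\<close>
  define Y where "Y = s j ` ?B"
  define E where "E y = s j -` {y} \<inter> ?B" for y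
  have fin: "finite Y" using simple_functionD(1)[OF sj] by (simp add: Y_def)
  have Em: "E y \<in> sets lebesgue" for y
    using simple_functionD(2)[OF sj, of "{y}"] by (simp add: E_def sets_restrict_space_iff)
  have adm: "admissible Y E"
    unfolding admissible_def
  proof (intro conjI ballI fin)
    fix y
    show "E y \<in> lmeasurable"
      using Em[of y] by (rule fmeasurableI2[OF box_lmeasurable, rotated]) (auto simp: E_def)
    show "E y \<subseteq> {0..}" by (auto simp: E_def)
  qed
  have step_in: "step Y E t = s j t" if t: "t \<in> ?B" for t
  proof -
    have "step Y E t = (\<Sum>y\<in>Y. if y = s j t then y else 0)"
      unfolding step_def using t
      by (intro sum.cong) (auto simp: E_def indicator_def scaleC_one scaleC_zero_left)
    also have "\<dots> = s j t" using fin t by (simp add: Y_def)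
    finally show ?thesis .
  qed
  have step_out: "step Y E t = 0" if "t \<notin> ?B" for t
    unfolding step_def using that by (intro sum.neutral) (auto simp: E_def scaleC_zero_left)
  \<comment> \<open>Off the cube the step function is 0, so within the orthant the error there is
    \<open>p (F t)\<close> itself, the tail already estimated.\<close>
  have "(\<integral>\<^sup>+t. err p Y E t \<partial>lebesgue) \<le> (\<integral>\<^sup>+t. err p Y E t * indicator ?B t
      + ?h t * indicator ({0..} - ?B) t \<partial>lebesgue)"
    using step_out by (intro nn_integral_mono) (auto simp: err_def indicator_def)
  also have "\<dots> = (\<integral>\<^sup>+t. err p Y E t * indicator ?B t \<partial>lebesgue)
      + (\<integral>\<^sup>+t. ?h t * indicator ({0..} - ?B) t \<partial>lebesgue)"
    by (intro nn_integral_add borel_measurable_times_ennreal[OF err_measurable[OF adm p]]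
        borel_measurable_times_ennreal[OF hm] borel_measurable_indicator sets.Diff) auto
  also have "(\<integral>\<^sup>+t. err p Y E t * indicator ?B t \<partial>lebesgue) = (\<integral>\<^sup>+t. ennreal (p (F t - s j t)) \<partial>lebesgue_on ?B)"
    unfolding nn_integral_lebesgue_on[OF box_sets]
    using step_in by (intro nn_integral_cong) (auto simp: err_def indicator_def)
  also have "\<dots> + (\<integral>\<^sup>+t. ?h t * indicator ({0..} - ?B) t \<partial>lebesgue) < ennreal (e / 2) + ennreal (e / 2)"
    using j k by (rule add_strict_mono)
  also have "\<dots> = ennreal e" using e by (simp flip: ennreal_plus)
  finally show ?thesis using adm by blast
qed

end

lemma AE_lebesgue_on_subset:
  assumes "AE x in lebesgue_on T. Q x" "S \<subseteq> T" "S \<in> sets lebesgue" "T \<in> sets lebesgue"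
  shows "AE x in lebesgue_on S. Q x"
  using assms by (auto simp: AE_restrict_space_iff)

section \<open>The product formula by density\<close>

context convolution_pair
begin

lemma nn_integral_err_box:
  assumes "p \<in> P"
  shows "(\<integral>\<^sup>+s. ennreal (p (F s - step Y E s)) \<partial>lebesgue_on {0..t}) \<le> (\<integral>\<^sup>+s. err p Y E s \<partial>lebesgue)"
  unfolding nn_integral_lebesgue_on[OF box_sets] err_def by (intro nn_integral_mono) (auto simp: indicator_def)

text \<open>The difference is compared with its analogue for a step function, uniformly in
  \<open>t\<close>, so the argument works before the limits of the single integrals are known to
  exist. \<open>C\<close> may be any version of the convolution up to null sets.\<close>

lemma convolution_limit:
  assumes C: "AE x in lebesgue_on {0..}. has_sint P (lebesgue_on {0..x}) (\<lambda>s. A (x - s) *\<^sub>C F s) (C x)"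
    and CL: "C \<in> L1_loc P"
  shows "((\<lambda>t. sc_integral P {0..t} C - sc_integral {cmod} {0..t} A *\<^sub>C sc_integral P {0..t} F) \<longlongrightarrow> 0) at_top"
proof (rule tendsto_0I)
  fix p assume p: "p \<in> P"
  show "((\<lambda>t. p (sc_integral P {0..t} C - sc_integral {cmod} {0..t} A *\<^sub>C sc_integral P {0..t} F)) \<longlongrightarrow> 0) at_top"
  proof (rule tendstoI)
    fix e :: real assume e: "e > 0"
    \<comment> \<open>The denominator has \<open>N + 1\<close> because \<open>N\<close> may be 0;
      the choice gives \<open>N * d < e / 3\<close>.\<close>
    define d where "d = e / (3 * (N + 1))"
    have d: "d > 0" using e N_nonneg by (simp add: d_def)
    have "e - 3 * (N * d) = 3 * d" using N_nonneg by (simp add: d_def field_simps)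
    then have Nd: "N * d < e / 3" using d by linarith
    obtain Y E where adm: "admissible Y E" and err: "(\<integral>\<^sup>+t. err p Y E t \<partial>lebesgue) < ennreal d"
      using step_approximation[OF p d] by blast
    let ?a = "\<lambda>t. sc_integral {cmod} {0..t} A"
    let ?cG = "\<lambda>t. \<Sum>y\<in>Y. (\<integral>x. conv_ind (E y) x \<partial>lebesgue_on {0..t}) *\<^sub>C y"
    let ?G = "\<lambda>t. \<Sum>y\<in>Y. (\<integral>x. complex_of_real (indicat_real (E y) x) \<partial>lebesgue_on {0..t}) *\<^sub>C y"
    \<comment> \<open>Uniform in \<open>t\<close>: the mean error of the convolution over any box is
      at most the total one, which is below \<open>e / 3\<close> by the choice of
      \<open>d\<close>.\<close>
    have 1: "p (sc_integral P {0..t} C - ?cG t) < e / 3" for t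
    proof -
      interpret seminorm_system_measure P "lebesgue_on {0..t}"
        by (rule seminorm_system_lebesgue_on) simp
      have "ennreal (p (sc_integral P {0..t} C - ?cG t))
          \<le> (\<integral>\<^sup>+x. ennreal (p (C x - conv_step Y E x)) \<partial>lebesgue_on {0..t})"
        by (rule has_sint_bound[OF has_sint_diff[OF L1_loc_box[OF CL] has_sint_conv_step_outer[OF adm box_lmeasurable]] p])
      also have "\<dots> \<le> (\<integral>\<^sup>+x. conv_err p Y E x \<partial>lebesgue_on {0..t})"
      proof (rule nn_integral_mono_AE)
        have "AE x in lebesgue_on {0..t}. has_sint P (lebesgue_on {0..x}) (\<lambda>s. A (x - s) *\<^sub>C F s) (C x)"
          by (rule AE_lebesgue_on_subset[OF C]) auto
        then show "AE x in lebesgue_on {0..t}. ennreal (p (C x - conv_step Y E x)) \<le> conv_err p Y E x"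
          by eventually_elim (rule conv_err_bound[OF adm p])
      qed
      also have "\<dots> \<le> (\<integral>\<^sup>+x. conv_err p Y E x \<partial>lebesgue)"
        unfolding nn_integral_lebesgue_on[OF box_sets] by (intro nn_integral_mono) (auto simp: indicator_def)
      also have "\<dots> \<le> ennreal N * ennreal d"
        unfolding conv_err_measurable(2)[OF adm p] using err by (intro mult_left_mono) auto
      also have "\<dots> = ennreal (N * d)" using N_nonneg d by (simp add: ennreal_mult)
      also have "\<dots> < ennreal (e / 3)" using Nd e by (intro ennreal_lessI) auto
      finally show ?thesis using p by (simp only: ennreal_less_iff nonneg)
    qed
    have 3: "p (?a t *\<^sub>C ?G t - ?a t *\<^sub>C sc_integral P {0..t} F) < e / 3" for t
    proof -
      interpret seminorm_system_measure P "lebesgue_on {0..t}"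
        by (rule seminorm_system_lebesgue_on) simp
      have "ennreal (p (sc_integral P {0..t} F - ?G t)) \<le> ennreal d"
        using has_sint_bound[OF has_sint_diff[OF L1_loc_box[OF F] has_sint_step[OF adm box_lmeasurable]] p]
          nn_integral_err_box[OF p, where Y = Y and E = E and t = t] err by (meson less_imp_le order_trans)
      then have "p (?G t - sc_integral P {0..t} F) \<le> d"
        using d minus_commute[OF p] by simp
      then have "cmod (?a t) * p (?G t - sc_integral P {0..t} F) \<le> N * d"
        using integral_A_box_le N_nonneg p by (intro mult_mono) auto
      then show ?thesis using Nd by (simp add: scale[OF p] flip: scaleC_diff_right)
    qed
    \<comment> \<open>The coefficient of each \<open>y\<close> tends to 0 by the scalar product
      formula \<open>integral_conv_ind\<close>, and there are finitely many coefficients.\<close>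
    have 2: "((\<lambda>t. ?cG t - ?a t *\<^sub>C ?G t) \<longlongrightarrow> 0) at_top"
    proof -
      have a: "(?a \<longlongrightarrow> (\<integral>s. A0 s \<partial>lebesgue)) at_top"
        unfolding integral_A_box by (rule integral_orthant_tendsto[OF A0_integrable]) (auto simp: A0_def)
      have y: "((\<lambda>t. ((\<integral>x. conv_ind (E y) x \<partial>lebesgue_on {0..t})
          - ?a t * (\<integral>x. complex_of_real (indicat_real (E y) x) \<partial>lebesgue_on {0..t})) *\<^sub>C y) \<longlongrightarrow> 0) at_top"
        if "y \<in> Y" for y
      proof -
        have E: "E y \<in> lmeasurable" "E y \<subseteq> {0..}" using adm that by (auto simp: admissible_def)
        have c: "((\<lambda>t. \<integral>x. conv_ind (E y) x \<partial>lebesgue_on {0..t}) \<longlongrightarrow> (\<integral>x. conv_ind (E y) x \<partial>lebesgue)) at_top"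
          by (rule integral_orthant_tendsto[OF conv_ind_integrable[OF E(1)] conv_ind_zero[OF E(2)]])
        have i: "((\<lambda>t. \<integral>x. complex_of_real (indicat_real (E y) x) \<partial>lebesgue_on {0..t})
            \<longlongrightarrow> (\<integral>x. complex_of_real (indicat_real (E y) x) \<partial>lebesgue)) at_top"
          using E(2) by (intro integral_orthant_tendsto[OF integrable_indicator_complex[OF E(1)]]) (auto simp: indicator_def)
        have "((\<lambda>t. (\<integral>x. conv_ind (E y) x \<partial>lebesgue_on {0..t})
          - ?a t * (\<integral>x. complex_of_real (indicat_real (E y) x) \<partial>lebesgue_on {0..t})) \<longlongrightarrow> 0) at_top"
          using tendsto_diff[OF c tendsto_mult[OF a i]] integral_conv_ind[OF E(1)] by simp
        then have "((\<lambda>t. cmod ((\<integral>x. conv_ind (E y) x \<partial>lebesgue_on {0..t})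
          - ?a t * (\<integral>x. complex_of_real (indicat_real (E y) x) \<partial>lebesgue_on {0..t})) * r) \<longlongrightarrow> 0) at_top" for r
          by (intro tendsto_mult_left_zero tendsto_norm_zero)
        then show ?thesis by (intro tendsto_0I) (simp add: scale)
      qed
      have "((\<lambda>t. \<Sum>y\<in>Y. ((\<integral>x. conv_ind (E y) x \<partial>lebesgue_on {0..t})
          - ?a t * (\<integral>x. complex_of_real (indicat_real (E y) x) \<partial>lebesgue_on {0..t})) *\<^sub>C y) \<longlongrightarrow> (\<Sum>y\<in>Y. 0)) at_top"
        by (intro tendsto_sum y)
      moreover have "(\<Sum>y\<in>Y. (c y - b * d y) *\<^sub>C y) = (\<Sum>y\<in>Y. c y *\<^sub>C y) - b *\<^sub>C (\<Sum>y\<in>Y. d y *\<^sub>C y)"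
        for b and c d :: "'a \<Rightarrow> complex"
        by (induction Y rule: infinite_finite_induct)
          (simp_all add: scaleC_zero_right scaleC_add_right scaleC_scaleC scaleC_diff_left algebra_simps)
      ultimately show ?thesis by simp
    qed
    have "\<forall>\<^sub>F t in at_top. p (?cG t - ?a t *\<^sub>C ?G t) < e / 3"
      using tendsto_seminorm[OF p 2] e p by (intro order_tendstoD(2)) auto
    then show "\<forall>\<^sub>F t in at_top. dist (p (sc_integral P {0..t} C - ?a t *\<^sub>C sc_integral P {0..t} F)) 0 < e"
    proof eventually_elim
      case (elim t)
      have "p (sc_integral P {0..t} C - ?a t *\<^sub>C sc_integral P {0..t} F)
        \<le> p (sc_integral P {0..t} C - ?cG t) + (p (?cG t - ?a t *\<^sub>C ?G t)
          + p (?a t *\<^sub>C ?G t - ?a t *\<^sub>C sc_integral P {0..t} F))"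
        using triangle_via[OF p, of "sc_integral P {0..t} C" "?a t *\<^sub>C sc_integral P {0..t} F" "?cG t"]
          triangle_via[OF p, of "?cG t" "?a t *\<^sub>C sc_integral P {0..t} F" "?a t *\<^sub>C ?G t"] by linarith
      also have "\<dots> < e" using 1[of t] 3[of t] elim by linarith
      finally show ?case using p by simp
    qed
  qed
qed

end

section \<open>Frechet spaces\<close>

text \<open>A Borel-Cantelli argument: the series of the \<open>h k\<close> has finite integral, so
  it converges a.e. and its terms tend to 0.\<close>

lemma AE_tendsto_0_geometric:
  fixes h :: "nat \<Rightarrow> 'b \<Rightarrow> ennreal"
  assumes [measurable]: "\<And>k. h k \<in> borel_measurable M"
    and le: "\<And>k. (\<integral>\<^sup>+t. h k t \<partial>M) \<le> ennreal (c * (1/2) ^ k)" and c: "c \<ge> 0"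
  shows "AE t in M. (\<lambda>k. h k t) \<longlonglongrightarrow> 0"
proof -
  have "(\<integral>\<^sup>+t. (\<Sum>k. h k t) \<partial>M) = (\<Sum>k. \<integral>\<^sup>+t. h k t \<partial>M)"
    by (rule nn_integral_suminf) measurable
  also have "\<dots> \<le> (\<Sum>k. ennreal (c * (1/2) ^ k))"
    using le by (intro suminf_le) auto
  also have "\<dots> = ennreal (\<Sum>k. c * (1/2) ^ k)"
    using c by (intro suminf_ennreal2 summable_mult summable_geometric) auto
  also have "\<dots> < \<infinity>" by simp
  finally have "AE t in M. (\<Sum>k. h k t) \<noteq> \<infinity>"
    by (intro nn_integral_noteq_infinite) auto
  then show ?thesis
  proof eventually_elim
    case (elim t)
    have fin: "h k t < top" for k
      using elim ennreal_suminf_lessD[of "\<lambda>k. h k t" top k] by (simp add: less_top)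
    have "summable (\<lambda>k. enn2real (h k t))"
      using elim fin by (intro summable_suminf_not_top) auto
    then have "(\<lambda>k. enn2real (h k t)) \<longlonglongrightarrow> 0" by (rule summable_LIMSEQ_zero)
    then have "(\<lambda>k. ennreal (enn2real (h k t))) \<longlonglongrightarrow> ennreal 0" by (rule tendsto_ennrealI)
    then show ?case using fin by simp
  qed
qed

text \<open>An increasing sequence inside \<open>P\<close> that dominates each seminorm up to a
  constant. To have its members in \<open>P\<close>, the locale will be instantiated with the finite
  sums of the original seminorms.\<close>

locale countable_seminorm_system = seminorm_system P for P :: "('a::sclcs \<Rightarrow> real) set" +
  fixes q :: "nat \<Rightarrow> 'a \<Rightarrow> real"
  assumes qP: "q k \<in> P" and q_mono: "k \<le> m \<Longrightarrow> q k x \<le> q m x"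
    and q_dominates: "p \<in> P \<Longrightarrow> \<exists>c\<ge>0. \<exists>k. \<forall>x. p x \<le> c * q k x"
begin

text \<open>The k-th error is measured by \<open>q k\<close> itself. Since \<open>q\<close>
  increases, every seminorm is dominated by a fixed multiple of \<open>q k\<close> for all large
  \<open>k\<close>, so the geometric rate yields convergence a.e. and in mean for all seminorms
  simultaneously. The \<open>h k\<close> are measurable majorants for errors not yet known to be
  measurable.\<close>

lemma simple_approx_fast:
  assumes M: "seminorm_system_measure P M"
    and s: "\<And>k. simple_function M (s k)" and h: "\<And>k. h k \<in> borel_measurable M"
    and le: "\<And>k. AE t in M. ennreal (q k (g t - s k t)) \<le> h k t"
    and int: "\<And>k. (\<integral>\<^sup>+t. h k t \<partial>M) \<le> ennreal ((1/2) ^ k)"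
  shows "simple_approx P M g s"
proof -
  interpret seminorm_system_measure P M by fact
  have dom: "\<exists>c\<ge>0. \<exists>m. \<forall>k\<ge>m. \<forall>x. ennreal (p x) \<le> ennreal c * ennreal (q k x)" if p: "p \<in> P" for p
  proof -
    obtain c m where c: "c \<ge> 0" "\<And>x. p x \<le> c * q m x" using q_dominates[OF p] by blast
    have "ennreal (p x) \<le> ennreal c * ennreal (q k x)" if "k \<ge> m" for k x
      using order_trans[OF c(2)[of x] mult_left_mono[OF q_mono[OF that, of x] c(1)]] c(1) nonneg[OF qP]
      by (simp flip: ennreal_mult)
    then show ?thesis using c(1) by blast
  qed
  have all: "AE t in M. \<forall>k. ennreal (q k (g t - s k t)) \<le> h k t" using le by (simp add: AE_all_countable)
  have h0: "AE t in M. (\<lambda>k. h k t) \<longlonglongrightarrow> 0"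
    using int by (intro AE_tendsto_0_geometric[OF h, where c = 1]) auto
  show ?thesis
    unfolding simple_approx_def
  proof (intro conjI allI ballI s)
    show "AE t in M. (\<lambda>k. s k t) \<longlonglongrightarrow> g t"
      using all h0
    proof eventually_elim
      case (elim t)
      show ?case
      proof (rule tendstoI_seminorm)
        fix p assume p: "p \<in> P"
        obtain c m where c: "c \<ge> 0" "\<And>k x. k \<ge> m \<Longrightarrow> ennreal (p x) \<le> ennreal c * ennreal (q k x)"
          using dom[OF p] by blast
        have "(\<lambda>k. ennreal (p (s k t - g t))) \<longlonglongrightarrow> 0"
        proof (rule tendsto_0_ennreal_sandwich)
          show "\<forall>\<^sub>F k in sequentially. ennreal (p (s k t - g t)) \<le> ennreal c * h k t"
            unfolding eventually_sequentially minus_commute[OF p, of "s _ t"]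
            using c(2) elim(1) by (meson mult_left_mono order_trans zero_le)
          show "(\<lambda>k. ennreal c * h k t) \<longlonglongrightarrow> 0"
            using ennreal_tendsto_cmult[OF _ elim(2), of "ennreal c"] by simp
        qed
        then show "(\<lambda>k. p (s k t - g t)) \<longlonglongrightarrow> 0" using p by (simp add: tendsto_ennreal_0_iff)
      qed
    qed
    fix p assume p: "p \<in> P"
    obtain c m where c: "c \<ge> 0" "\<And>k x. k \<ge> m \<Longrightarrow> ennreal (p x) \<le> ennreal c * ennreal (q k x)"
      using dom[OF p] by blast
    have bound: "(\<integral>\<^sup>+t. ennreal (p (g t - s k t)) \<partial>M) \<le> ennreal c * ennreal ((1/2) ^ k)" if k: "k \<ge> m" for k
    proof -
      have "(\<integral>\<^sup>+t. ennreal (p (g t - s k t)) \<partial>M) \<le> (\<integral>\<^sup>+t. ennreal c * h k t \<partial>M)"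
      proof (rule nn_integral_mono_AE)
        show "AE t in M. ennreal (p (g t - s k t)) \<le> ennreal c * h k t"
          using le[of k] by eventually_elim (meson c(2)[OF k] mult_left_mono order_trans zero_le)
      qed
      also have "\<dots> = ennreal c * (\<integral>\<^sup>+t. h k t \<partial>M)" using h by (rule nn_integral_cmult)
      also have "\<dots> \<le> ennreal c * ennreal ((1/2) ^ k)" using int by (intro mult_left_mono) auto
      finally show ?thesis .
    qed
    show "(\<lambda>k. \<integral>\<^sup>+t. ennreal (p (g t - s k t)) \<partial>M) \<longlonglongrightarrow> 0"
    proof (rule tendsto_0_ennreal_sandwich)
      show "\<forall>\<^sub>F k in sequentially. (\<integral>\<^sup>+t. ennreal (p (g t - s k t)) \<partial>M) \<le> ennreal c * ennreal ((1/2) ^ k)"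
        unfolding eventually_sequentially using bound by blast
      have "(\<lambda>k. ennreal ((1/2) ^ k)) \<longlonglongrightarrow> 0"
        by (subst tendsto_ennreal_0_iff) (auto intro: LIMSEQ_power_zero)
      then show "(\<lambda>k. ennreal c * ennreal ((1/2) ^ k)) \<longlonglongrightarrow> 0"
        using ennreal_tendsto_cmult[of "ennreal c" "\<lambda>k. ennreal ((1/2) ^ k)" 0] by simp
    qed
  qed
qed

text \<open>Countability merges the separate approximations for each \<open>q k\<close> and
  \<open>e\<close> into one sequence, the k-th member being chosen for \<open>q k\<close> and
  accuracy \<open>(1/2) ^ k\<close>. The approximants \<open>\<sigma>\<close> themselves need only
  be integrable.\<close>

lemma has_sint_approxI:
  assumes M: "seminorm_system_measure P M"
    and approx: "\<And>k e. e > 0 \<Longrightarrow> \<exists>\<sigma> I h. has_sint P M \<sigma> I \<and> h \<in> borel_measurable M \<and>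
      (AE t in M. ennreal (q k (g t - \<sigma> t)) \<le> h t) \<and> (\<integral>\<^sup>+t. h t \<partial>M) \<le> ennreal e"
  shows "\<exists>I. has_sint P M g I"
proof -
  interpret seminorm_system_measure P M by fact
  have "\<exists>s h. simple_function M s \<and> h \<in> borel_measurable M \<and>
      (AE t in M. ennreal (q k (g t - s t)) \<le> h t) \<and> (\<integral>\<^sup>+t. h t \<partial>M) \<le> ennreal ((1/2) ^ k)" for k
  proof -
    \<comment> \<open>Half for the distance to \<open>\<sigma>\<close>, half for replacing
      \<open>\<sigma>\<close> by a simple function.\<close>
    let ?e = "(1/2) ^ k / 2 :: real"
    obtain \<sigma> I h where \<sigma>: "has_sint P M \<sigma> I" and h[measurable]: "h \<in> borel_measurable M"
      and le: "AE t in M. ennreal (q k (g t - \<sigma> t)) \<le> h t" and int: "(\<integral>\<^sup>+t. h t \<partial>M) \<le> ennreal ?e"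
      using approx[of ?e k] by auto
    obtain s where s: "simple_approx P M \<sigma> s" using \<sigma> unfolding has_sint_def by blast
    from order_tendstoD(2)[OF simple_approxD(3)[OF s qP], of "ennreal ?e" k]
    obtain j where j: "(\<integral>\<^sup>+t. ennreal (q k (\<sigma> t - s j t)) \<partial>M) < ennreal ?e"
      by (auto simp: eventually_sequentially)
    note sj = simple_approxD(1)[OF s, of j]
    have m[measurable]: "(\<lambda>t. q k (\<sigma> t - s j t)) \<in> borel_measurable M"
      by (rule simple_approx_measurable_diff_simple[OF s sj qP])
    let ?h = "\<lambda>t. h t + ennreal (q k (\<sigma> t - s j t))"
    have "AE t in M. ennreal (q k (g t - s j t)) \<le> ?h t"
      using le
    proof eventually_elim
      case (elim t)
      have "ennreal (q k (g t - s j t)) \<le> ennreal (q k (g t - \<sigma> t)) + ennreal (q k (\<sigma> t - s j t))"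
        using triangle_via[OF qP, of k "g t" "s j t" "\<sigma> t"] nonneg[OF qP] by (simp flip: ennreal_plus)
      also have "\<dots> \<le> ?h t" using elim by (rule add_right_mono)
      finally show ?case .
    qed
    moreover have "(\<integral>\<^sup>+t. ?h t \<partial>M) \<le> ennreal ((1/2) ^ k)"
    proof -
      have "(\<integral>\<^sup>+t. ?h t \<partial>M) = (\<integral>\<^sup>+t. h t \<partial>M) + (\<integral>\<^sup>+t. ennreal (q k (\<sigma> t - s j t)) \<partial>M)"
        by (rule nn_integral_add) measurable
      also have "\<dots> \<le> ennreal ?e + ennreal ?e" using int j by (intro add_mono) auto
      also have "\<dots> = ennreal ((1/2) ^ k)" by (simp flip: ennreal_plus)
      finally show ?thesis .
    qed
    moreover have "?h \<in> borel_measurable M" by measurable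
    ultimately show ?thesis using sj by blast
  qed
  then have "\<forall>k. \<exists>z. simple_function M (fst z) \<and> snd z \<in> borel_measurable M \<and>
      (AE t in M. ennreal (q k (g t - fst z t)) \<le> snd z t) \<and> (\<integral>\<^sup>+t. snd z t \<partial>M) \<le> ennreal ((1/2) ^ k)"
    by simp
  from choice[OF this] obtain z where z: "\<forall>k. simple_function M (fst (z k)) \<and> snd (z k) \<in> borel_measurable M \<and>
      (AE t in M. ennreal (q k (g t - fst (z k) t)) \<le> snd (z k) t) \<and>
      (\<integral>\<^sup>+t. snd (z k) t \<partial>M) \<le> ennreal ((1/2) ^ k)" ..
  have "simple_approx P M g (\<lambda>k. fst (z k))"
    by (rule simple_approx_fast[OF M, where h = "\<lambda>k. snd (z k)"]) (use z in blast)+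
  then show ?thesis by (rule has_sint_ex)
qed

end

locale frechet_convolution_pair = convolution_pair P A F + countable_seminorm_system P q
  for P :: "('a::sclcs \<Rightarrow> real) set" and A :: "real^'n \<Rightarrow> complex" and F :: "real^'n \<Rightarrow> 'a"
    and q :: "nat \<Rightarrow> 'a \<Rightarrow> real"
begin

text \<open>Young's equality turns geometric errors of step functions into geometric errors of
  convolutions, so at almost every \<open>x\<close> the error integrals tend to 0. At such
  \<open>x\<close> the integrands built from step functions approximate the true integrand in
  mean.\<close>

lemma convolution_defined_AE:
  "AE x in lebesgue. \<exists>I. has_sint P (lebesgue_on {0..x}) (\<lambda>s. A (x - s) *\<^sub>C F s) I"
proof -
  have "\<forall>k. \<exists>Y E. admissible Y E \<and> (\<integral>\<^sup>+t. err (q k) Y E t \<partial>lebesgue) < ennreal ((1/2) ^ k)"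
    using step_approximation[OF qP] by simp
  then obtain Y E where adm: "\<And>k. admissible (Y k) (E k)"
    and err: "\<And>k. (\<integral>\<^sup>+t. err (q k) (Y k) (E k) t \<partial>lebesgue) < ennreal ((1/2) ^ k)" by metis
  let ?H = "\<lambda>k x. conv_err (q k) (Y k) (E k) x"
  have "AE x in lebesgue. (\<lambda>k. ?H k x) \<longlonglongrightarrow> 0"
  proof (rule AE_tendsto_0_geometric[OF conv_err_measurable(1)[OF adm qP] _ N_nonneg])
    fix k
    have "(\<integral>\<^sup>+x. ?H k x \<partial>lebesgue) \<le> ennreal N * ennreal ((1/2) ^ k)"
      unfolding conv_err_measurable(2)[OF adm qP] using err[of k] by (intro mult_left_mono) auto
    then show "(\<integral>\<^sup>+x. ?H k x \<partial>lebesgue) \<le> ennreal (N * (1/2) ^ k)"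
      using N_nonneg by (simp add: ennreal_mult)
  qed
  then show ?thesis
  proof eventually_elim
    case (elim x)
    interpret M: seminorm_system_measure P "lebesgue_on {0..x}"
      by (rule seminorm_system_lebesgue_on) simp
    show ?case
    proof (rule has_sint_approxI[OF M.seminorm_system_measure_axioms])
      fix k :: nat and e :: real assume e: "e > 0"
      from order_tendstoD(2)[OF elim, of "ennreal e"]
      obtain m0 where m0: "\<And>m. m \<ge> m0 \<Longrightarrow> ?H m x < ennreal e"
        using e by (auto simp: eventually_sequentially)
      \<comment> \<open>Past \<open>m0\<close> the error is below \<open>e\<close>; moreover
        \<open>k \<le> m\<close>, because the error is measured by \<open>q m\<close>, which must
        dominate \<open>q k\<close>.\<close>
      define m where "m = max m0 k"
      have m: "?H m x < ennreal e" "k \<le> m" using m0 by (auto simp: m_def)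
      let ?h = "\<lambda>s. ennreal (cmod (A0 (x - s))) * err (q m) (Y m) (E m) s"
      show "\<exists>\<sigma> I h. has_sint P (lebesgue_on {0..x}) \<sigma> I \<and> h \<in> borel_measurable (lebesgue_on {0..x}) \<and>
        (AE s in lebesgue_on {0..x}. ennreal (q k (A (x - s) *\<^sub>C F s - \<sigma> s)) \<le> h s) \<and>
        (\<integral>\<^sup>+s. h s \<partial>lebesgue_on {0..x}) \<le> ennreal e"
      proof (intro exI[of _ "\<lambda>s. A (x - s) *\<^sub>C step (Y m) (E m) s"] exI[of _ ?h] exI conjI)
        show "has_sint P (lebesgue_on {0..x}) (\<lambda>s. A (x - s) *\<^sub>C step (Y m) (E m) s) (conv_step (Y m) (E m) x)"
          by (rule has_sint_conv_step[OF adm])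
        have "?h \<in> borel_measurable lebesgue"
          using A0_reflect_measurable err_measurable[OF adm qP] by measurable
        then show "?h \<in> borel_measurable (lebesgue_on {0..x})" by (rule measurable_restrict_space1)
        show "AE s in lebesgue_on {0..x}. ennreal (q k (A (x - s) *\<^sub>C F s - A (x - s) *\<^sub>C step (Y m) (E m) s)) \<le> ?h s"
        proof (rule AE_I2)
          fix s assume "s \<in> space (lebesgue_on {0..x})"
          then have s: "s \<in> {0..x}" by (simp add: space_restrict_space)
          have "q k (A (x - s) *\<^sub>C F s - A (x - s) *\<^sub>C step (Y m) (E m) s)
            \<le> cmod (A0 (x - s)) * q m (F s - step (Y m) (E m) s)"
            using q_mono[OF m(2)] scale[OF qP] A_reflect[OF s] by (simp flip: scaleC_diff_right add: mult_left_mono)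
          then show "ennreal (q k (A (x - s) *\<^sub>C F s - A (x - s) *\<^sub>C step (Y m) (E m) s)) \<le> ?h s"
            using s nonneg[OF qP] by (simp add: err_def flip: ennreal_mult)
        qed
        have "(\<integral>\<^sup>+s. ?h s \<partial>lebesgue_on {0..x}) \<le> ?H m x"
          unfolding conv_err_def nn_integral_lebesgue_on[OF box_sets]
          by (intro nn_integral_mono) (auto simp: indicator_def)
        then show "(\<integral>\<^sup>+s. ?h s \<partial>lebesgue_on {0..x}) \<le> ennreal e" using m(1) by simp
      qed
    qed
  qed
qed

text \<open>At almost every point \<open>conv_err\<close> dominates the distance of \<open>C\<close>
  from the convolution of a step function, and its integral is as small as desired.\<close>

lemma convolution_L1_loc:
  assumes C: "AE x in lebesgue_on {0..}. has_sint P (lebesgue_on {0..x}) (\<lambda>s. A (x - s) *\<^sub>C F s) (C x)"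
  shows "C \<in> L1_loc P"
proof (rule L1_locI)
  fix K :: "(real^'n) set" assume K: "compact K" "K \<subseteq> {0..}"
  have Kl: "K \<in> lmeasurable" using K(1) by (rule lmeasurable_compact)
  have Ks: "K \<in> sets lebesgue" using Kl by (rule fmeasurableD)
  interpret M: seminorm_system_measure P "lebesgue_on K"
    by (rule seminorm_system_lebesgue_on[OF Kl])
  show "\<exists>I. has_sint P (lebesgue_on K) C I"
  proof (rule has_sint_approxI[OF M.seminorm_system_measure_axioms])
    fix k :: nat and e :: real assume e: "e > 0"
    define d where "d = e / (N + 1)"
    have d: "d > 0" using e N_nonneg by (simp add: d_def)
    have "N * d \<le> e" using N_nonneg e by (simp add: d_def field_simps)
    obtain Y E where adm: "admissible Y E" and err: "(\<integral>\<^sup>+t. err (q k) Y E t \<partial>lebesgue) < ennreal d"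
      using step_approximation[OF qP d] by blast
    show "\<exists>\<sigma> I h. has_sint P (lebesgue_on K) \<sigma> I \<and> h \<in> borel_measurable (lebesgue_on K) \<and>
        (AE x in lebesgue_on K. ennreal (q k (C x - \<sigma> x)) \<le> h x) \<and>
        (\<integral>\<^sup>+x. h x \<partial>lebesgue_on K) \<le> ennreal e"
    proof (intro exI[of _ "conv_step Y E"] exI[of _ "conv_err (q k) Y E"] exI conjI)
      show "has_sint P (lebesgue_on K) (conv_step Y E) (\<Sum>y\<in>Y. (\<integral>x. conv_ind (E y) x \<partial>lebesgue_on K) *\<^sub>C y)"
        by (rule has_sint_conv_step_outer[OF adm Kl])
      show "conv_err (q k) Y E \<in> borel_measurable (lebesgue_on K)"
        by (rule measurable_restrict_space1[OF conv_err_measurable(1)[OF adm qP]])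
      have "AE x in lebesgue_on K. has_sint P (lebesgue_on {0..x}) (\<lambda>s. A (x - s) *\<^sub>C F s) (C x)"
        by (rule AE_lebesgue_on_subset[OF C K(2) Ks]) simp
      then show "AE x in lebesgue_on K. ennreal (q k (C x - conv_step Y E x)) \<le> conv_err (q k) Y E x"
        by eventually_elim (rule conv_err_bound[OF adm qP])
      have "(\<integral>\<^sup>+x. conv_err (q k) Y E x \<partial>lebesgue_on K) \<le> (\<integral>\<^sup>+x. conv_err (q k) Y E x \<partial>lebesgue)"
        unfolding nn_integral_lebesgue_on[OF Ks] by (intro nn_integral_mono) (auto simp: indicator_def)
      also have "\<dots> \<le> ennreal N * ennreal d"
        unfolding conv_err_measurable(2)[OF adm qP] using err by (intro mult_left_mono) auto
      also have "\<dots> \<le> ennreal e" using \<open>N * d \<le> e\<close> N_nonneg d by (simp add: ennreal_leI flip: ennreal_mult)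
      finally show "(\<integral>\<^sup>+x. conv_err (q k) Y E x \<partial>lebesgue_on K) \<le> ennreal e" .
    qed
  qed
qed

end

section \<open>Continuous factors\<close>

text \<open>Coordinates are rounded down to multiples of \<open>1 / (k + 1)\<close>. Rounding down
  keeps the box below the grid point inside the box below \<open>x\<close>, and keeps points of the
  orthant in the orthant.\<close>

definition grid :: "nat \<Rightarrow> real^'n \<Rightarrow> real^'n" where
  "grid k x = (\<chi> i. of_int \<lfloor>real (Suc k) * x $ i\<rfloor> / real (Suc k))"

lemma grid_le: "grid k x \<le> x"
proof -
  have "of_int \<lfloor>real (Suc k) * x $ i\<rfloor> \<le> real (Suc k) * x $ i" for i by (rule of_int_floor_le)
  then have "of_int \<lfloor>real (Suc k) * x $ i\<rfloor> / real (Suc k) \<le> x $ i" for i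
    by (subst pos_divide_le_eq) (simp_all only: mult.commute of_nat_0_less_iff zero_less_Suc)
  then show ?thesis by (simp add: grid_def less_eq_vec_def)
qed

lemma grid_nonneg: "0 \<le> x \<Longrightarrow> 0 \<le> grid k x"
  by (simp add: grid_def less_eq_vec_def)

lemma grid_tendsto: "(\<lambda>k. grid k x) \<longlonglongrightarrow> x"
proof (rule vec_tendstoI)
  fix i
  have "dist (grid k x $ i) (x $ i) \<le> inverse (real (Suc k))" for k
  proof -
    let ?r = "real (Suc k)"
    have r: "?r > 0" by simp
    have "\<bar>of_int \<lfloor>?r * x $ i\<rfloor> - ?r * x $ i\<bar> \<le> 1" by linarith
    moreover have "of_int \<lfloor>?r * x $ i\<rfloor> - ?r * x $ i = ?r * (grid k x $ i - x $ i)"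
      using r by (simp add: grid_def right_diff_distrib del: of_nat_Suc)
    ultimately have "?r * \<bar>grid k x $ i - x $ i\<bar> \<le> 1" using r by (simp add: abs_mult del: of_nat_Suc)
    then have "\<bar>grid k x $ i - x $ i\<bar> \<le> 1 / ?r" using r by (subst pos_le_divide_eq) (simp_all only: mult.commute)
    then show ?thesis by (simp add: dist_real_def inverse_eq_divide del: of_nat_Suc)
  qed
  then show "(\<lambda>k. grid k x $ i) \<longlonglongrightarrow> x $ i"
    unfolding tendsto_dist_iff[of _ "x $ i"]
    by (intro tendsto_sandwich[OF _ _ tendsto_const LIMSEQ_inverse_real_of_nat] always_eventually) auto
qed

lemma eventually_grid_greater:
  assumes "\<forall>i. s $ i < x $ i"
  shows "\<forall>\<^sub>F k in sequentially. \<forall>i. s $ i < grid k x $ i"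
proof -
  have "\<forall>\<^sub>F k in sequentially. \<forall>i\<in>UNIV. s $ i < grid k x $ i"
  proof (intro eventually_ball_finite ballI)
    fix i
    show "\<forall>\<^sub>F k in sequentially. s $ i < grid k x $ i"
      using assms by (intro order_tendstoD(1)[OF tendsto_vec_nth[OF grid_tendsto]]) simp
  qed simp
  then show ?thesis by simp
qed

text \<open>On a bounded set the floors take finitely many integer values, and each coordinate is a
  function of one such integer.\<close>

lemma simple_function_grid:
  fixes K :: "(real^'n) set"
  assumes "K \<in> sets lebesgue" "bounded K"
  shows "simple_function (lebesgue_on K) (grid k)"
proof -
  obtain B where B: "\<And>x. x \<in> K \<Longrightarrow> norm x \<le> B" using assms(2) by (auto simp: bounded_iff)
  let ?f = "\<lambda>i x. \<lfloor>real (Suc k) * x $ i\<rfloor>"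
  have f: "simple_function (lebesgue_on K) (?f i)" for i
    unfolding simple_function_eq_measurable
  proof
    have "?f i x \<in> {- \<lceil>real (Suc k) * B\<rceil> .. \<lceil>real (Suc k) * B\<rceil>}" if "x \<in> K" for x
    proof -
      have "\<bar>x $ i\<bar> \<le> B" using component_le_norm_cart[of x i] B[OF that] by linarith
      then have "\<bar>real (Suc k) * x $ i\<bar> \<le> real (Suc k) * B"
        by (simp add: abs_mult mult_left_mono del: of_nat_Suc)
      then show ?thesis by simp linarith
    qed
    then have "?f i ` space (lebesgue_on K) \<subseteq> {- \<lceil>real (Suc k) * B\<rceil> .. \<lceil>real (Suc k) * B\<rceil>}"
      by (auto simp: space_restrict_space)
    then show "finite (?f i ` space (lebesgue_on K))" by (rule finite_subset) simp
    have "(\<lambda>x::real^'n. real (Suc k) * x $ i) \<in> borel_measurable borel"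
      by (intro borel_measurable_continuous_onI continuous_intros)
    then have "(\<lambda>x::real^'n. real (Suc k) * x $ i) \<in> borel_measurable lborel" by simp
    from measurable_restrict_space1[OF measurable_completion[OF this]]
    have "(\<lambda>x. real (Suc k) * x $ i) \<in> borel_measurable (lebesgue_on K)" .
    then show "?f i \<in> measurable (lebesgue_on K) (count_space UNIV)"
      by measurable
  qed
  have "simple_function (lebesgue_on K) (\<lambda>x. \<Sum>i\<in>UNIV. axis i (of_int (?f i x) / real (Suc k)))"
  proof (rule simple_function_sum)
    fix i
    show "simple_function (lebesgue_on K) (\<lambda>x. axis i (of_int (?f i x) / real (Suc k)))"
      using f by (rule simple_function_compose1)
  qed
  moreover have "grid k x = (\<Sum>i\<in>UNIV. axis i (of_int (?f i x) / real (Suc k)))" for x :: "real^'n"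
    by (simp add: vec_eq_iff grid_def axis_def sum.If_cases)
  ultimately show ?thesis by (simp add: fun_eq_iff cong: simple_function_cong)
qed

text \<open>The upper faces lie in finitely many hyperplanes. A point of the box off these faces is
  eventually below \<open>grid k x\<close>, as the convergence of the boxes requires.\<close>

lemma AE_not_on_faces:
  fixes x :: "real^'n"
  shows "AE s in lebesgue_on {0..x}. \<forall>i. s $ i < x $ i"
proof -
  have "AE s in lebesgue. \<forall>i. s $ i \<noteq> x $ i"
    unfolding AE_all_countable
  proof
    fix i
    have "{s. s $ i = x $ i} \<in> null_sets lebesgue"
      using negligible_standard_hyperplane[of "axis i 1 :: real^'n" "x $ i"]
      by (simp add: negligible_iff_null_sets inner_axis axis_in_Basis_iff)
    then show "AE s in lebesgue. s $ i \<noteq> x $ i" by (auto dest: AE_not_in)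
  qed
  then have "AE s in lebesgue. s \<in> {0..x} \<longrightarrow> (\<forall>i. s $ i < x $ i)"
    by eventually_elim (auto simp: less_eq_vec_def less_le)
  then show ?thesis by (simp add: AE_restrict_space_iff)
qed

section \<open>Integrability by sampling on grids\<close>

context seminorm_system
begin

text \<open>Sampling \<open>g\<close> on the grid already yields simple functions; convergence along
  the grid and boundedness on boxes then give dominated convergence on a set of finite
  measure.\<close>

lemma L1_locI_grid:
  fixes g :: "real^'n \<Rightarrow> 'a"
  assumes lim: "\<And>p x. p \<in> P \<Longrightarrow> 0 \<le> x \<Longrightarrow> (\<lambda>k. p (g (grid k x) - g x)) \<longlonglongrightarrow> 0"
    and bound: "\<And>p T. p \<in> P \<Longrightarrow> \<exists>B. \<forall>x\<in>{0..T}. p (g x) \<le> B"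
  shows "g \<in> L1_loc P"
proof (rule L1_locI)
  fix K :: "(real^'n) set" assume K: "compact K" "K \<subseteq> {0..}"
  have Kl: "K \<in> lmeasurable" using K(1) by (rule lmeasurable_compact)
  interpret seminorm_system_measure P "lebesgue_on K"
    by (rule seminorm_system_lebesgue_on[OF Kl])
  have sp: "space (lebesgue_on K) = K" by (simp add: space_restrict_space)
  obtain r where r: "\<And>x. x \<in> K \<Longrightarrow> norm x \<le> r"
    using compact_imp_bounded[OF K(1)] by (auto simp: bounded_iff)
  \<comment> \<open>Each coordinate is bounded by the norm, so one corner lies above all of
    \<open>K\<close>.\<close>
  define T :: "real^'n" where "T = vec r"
  have KT: "x \<le> T" if "x \<in> K" for x
    unfolding less_eq_vec_def T_def using component_le_norm_cart[of x] r[OF that]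
    by (auto intro: order_trans abs_le_D1)
  obtain B where B: "\<And>p x. p \<in> P \<Longrightarrow> 0 \<le> x \<Longrightarrow> x \<le> T \<Longrightarrow> p (g x) \<le> B p"
    using bound[of _ T] by (metis atLeastAtMost_iff)
  have "simple_approx P (lebesgue_on K) g (\<lambda>k x. g (grid k x))"
  proof (rule simple_approx_dominated[where w = "\<lambda>p _. ennreal (2 * B p)"])
    show "simple_function (lebesgue_on K) (\<lambda>x. g (grid k x))" for k
      by (rule simple_function_compose1[OF simple_function_grid])
        (use Kl compact_imp_bounded[OF K(1)] in auto)
    show "AE x in lebesgue_on K. (\<lambda>k. g (grid k x)) \<longlonglongrightarrow> g x"
      using K(2) by (intro AE_I2 tendstoI_seminorm lim) (auto simp: sp)
    fix p assume p: "p \<in> P"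
    have "emeasure (lebesgue_on K) K < top" by (simp add: less_top[symmetric])
    then show "(\<integral>\<^sup>+x. ennreal (2 * B p) \<partial>lebesgue_on K) < \<infinity>"
      by (simp add: ennreal_mult_less_top sp)
    fix k
    show "AE x in lebesgue_on K. ennreal (p (g x - g (grid k x))) \<le> ennreal (2 * B p)"
    proof (rule AE_I2)
      fix x assume "x \<in> space (lebesgue_on K)"
      then have x: "0 \<le> x" "x \<le> T" using K(2) KT by (auto simp: sp)
      have "p (g x - g (grid k x)) \<le> p (g x) + p (g (grid k x))" by (rule triangle_diff[OF p])
      also have "\<dots> \<le> B p + B p"
        using x grid_le[of k x] grid_nonneg[of x k] by (intro add_mono B p) auto
      finally show "ennreal (p (g x - g (grid k x))) \<le> ennreal (2 * B p)" by (intro ennreal_leI) simp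
    qed
  qed simp
  then show "\<exists>I. has_sint P (lebesgue_on K) g I" by (rule has_sint_ex)
qed

text \<open>Both the domain and the integrand depend on the point. The integral over the smaller box
  is extended by zero, and the difference tends to 0 by dominated convergence. The general integrand
  \<open>\<Phi>\<close> covers a convolution in either order of its factors.\<close>

lemma L1_loc_parametric_integral:
  fixes \<Phi> :: "real^'n \<Rightarrow> real^'n \<Rightarrow> 'a"
  assumes \<Phi>: "\<And>y. 0 \<le> y \<Longrightarrow> has_sint P (lebesgue_on {0..y}) (\<Phi> y) (C y)"
    and cont: "\<And>x s. s \<in> {0..x} \<Longrightarrow> \<forall>i. s $ i < x $ i \<Longrightarrow> (\<lambda>k. \<Phi> (grid k x) s) \<longlonglongrightarrow> \<Phi> x s"
    and dom: "\<And>p T. p \<in> P \<Longrightarrow> \<exists>w. w \<in> borel_measurable (lebesgue_on {0..T}) \<and>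
      (\<integral>\<^sup>+s. w s \<partial>lebesgue_on {0..T}) < \<infinity> \<and>
      (\<forall>y\<in>{0..T}. \<forall>s\<in>{0..y}. ennreal (p (\<Phi> y s)) \<le> w s)"
  shows "C \<in> L1_loc P"
proof (rule L1_locI_grid)
  fix p assume p: "p \<in> P"
  show "\<exists>B. \<forall>x\<in>{0..T}. p (C x) \<le> B" for T
  proof -
    obtain w where w: "(\<integral>\<^sup>+s. w s \<partial>lebesgue_on {0..T}) < \<infinity>"
      "\<And>y s. y \<in> {0..T} \<Longrightarrow> s \<in> {0..y} \<Longrightarrow> ennreal (p (\<Phi> y s)) \<le> w s" using dom[OF p, of T] by blast
    have "p (C x) \<le> enn2real (\<integral>\<^sup>+s. w s \<partial>lebesgue_on {0..T})" if x: "x \<in> {0..T}" for x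
    proof -
      interpret seminorm_system_measure P "lebesgue_on {0..x}"
        by (rule seminorm_system_lebesgue_on) simp
      have "ennreal (p (C x)) \<le> (\<integral>\<^sup>+s. ennreal (p (\<Phi> x s)) \<partial>lebesgue_on {0..x})"
        using x by (intro has_sint_bound[OF \<Phi> p]) simp
      also have "\<dots> \<le> (\<integral>\<^sup>+s. w s \<partial>lebesgue_on {0..T})"
        unfolding nn_integral_lebesgue_on[OF box_sets] using w(2)[OF x] x
        by (intro nn_integral_mono) (auto simp: indicator_def)
      finally have "enn2real (ennreal (p (C x))) \<le> enn2real (\<integral>\<^sup>+s. w s \<partial>lebesgue_on {0..T})"
        using w(1) by (intro enn2real_mono) auto
      then show ?thesis using p by simp
    qed
    then show ?thesis by blast
  qed
  fix x :: "real^'n" assume x: "0 \<le> x"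
  interpret seminorm_system_measure P "lebesgue_on {0..x}"
    by (rule seminorm_system_lebesgue_on) simp
  obtain w where w: "w \<in> borel_measurable (lebesgue_on {0..x})" "(\<integral>\<^sup>+s. w s \<partial>lebesgue_on {0..x}) < \<infinity>"
    "\<And>y s. y \<in> {0..x} \<Longrightarrow> s \<in> {0..y} \<Longrightarrow> ennreal (p (\<Phi> y s)) \<le> w s" using dom[OF p, of x] by blast
  let ?y = "\<lambda>k. grid k x"
  define D where "D k s = (if s \<in> {0..?y k} then \<Phi> (?y k) s else 0) - \<Phi> x s" for k s
  have D: "has_sint P (lebesgue_on {0..x}) (D k) (C (?y k) - C x)" for k
  proof -
    have y: "0 \<le> ?y k" "?y k \<le> x" using x grid_nonneg grid_le by auto
    have "restrict_space (lebesgue_on {0..x}) {0..?y k} = lebesgue_on {0..?y k}"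
      using y by (subst restrict_restrict_space) (auto simp: Int_absorb1)
    then have "has_sint P (restrict_space (lebesgue_on {0..x}) {0..?y k}) (\<Phi> (?y k)) (C (?y k))"
      using \<Phi>[OF y(1)] by simp
    moreover have "{0..?y k} \<in> sets (lebesgue_on {0..x})"
      using y by (auto simp: sets_restrict_space_iff)
    ultimately have "has_sint P (lebesgue_on {0..x}) (\<lambda>s. if s \<in> {0..?y k} then \<Phi> (?y k) s else 0) (C (?y k))"
      by (rule has_sint_extend)
    from has_sint_diff[OF this \<Phi>[OF x]] show ?thesis unfolding D_def[abs_def] .
  qed
  have "(\<lambda>k. \<integral>\<^sup>+s. ennreal (p (D k s)) \<partial>lebesgue_on {0..x}) \<longlonglongrightarrow> (\<integral>\<^sup>+s. 0 \<partial>lebesgue_on {0..x})"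
  \<comment> \<open>One \<open>w\<close> for each of the two integrands that make up
    \<open>D\<close>.\<close>
  proof (rule nn_integral_dominated_convergence[where w = "\<lambda>s. 2 * w s"])
    show "(\<lambda>s. ennreal (p (D k s))) \<in> borel_measurable (lebesgue_on {0..x})" for k
      using has_sint_measurable[OF D p] by measurable
    show "(\<lambda>s. 2 * w s) \<in> borel_measurable (lebesgue_on {0..x})" using w(1) by measurable
    show "(\<integral>\<^sup>+s. 2 * w s \<partial>lebesgue_on {0..x}) < \<infinity>"
      using w by (simp add: nn_integral_cmult ennreal_mult_less_top)
    show "AE s in lebesgue_on {0..x}. ennreal (p (D k s)) \<le> 2 * w s" for k
    proof (rule AE_I2)
      fix s assume "s \<in> space (lebesgue_on {0..x})"
      then have s: "s \<in> {0..x}" by (simp add: space_restrict_space)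
      let ?z = "if s \<in> {0..?y k} then \<Phi> (?y k) s else 0"
      have "ennreal (p (D k s)) \<le> ennreal (p ?z) + ennreal (p (\<Phi> x s))"
        unfolding D_def using triangle_diff[OF p, of ?z "\<Phi> x s"] p by (simp flip: ennreal_plus)
      also have "\<dots> \<le> w s + w s"
        using w(3)[of "?y k" s] w(3)[of x s] s x grid_nonneg[OF x] grid_le[of k x] p
        by (intro add_mono) auto
      finally show "ennreal (p (D k s)) \<le> 2 * w s" by (simp add: mult_2)
    qed
    show "AE s in lebesgue_on {0..x}. (\<lambda>k. ennreal (p (D k s))) \<longlonglongrightarrow> 0"
      using AE_not_on_faces AE_space
    proof eventually_elim
      case (elim s)
      then have s: "s \<in> {0..x}" "\<forall>i. s $ i < x $ i" by (auto simp: space_restrict_space)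
      \<comment> \<open>Off the upper faces \<open>s\<close> eventually lies in the smaller box, so
        the extension by zero no longer intervenes.\<close>
      from eventually_grid_greater[OF s(2)] have ev: "\<forall>\<^sub>F k in sequentially. D k s = \<Phi> (?y k) s - \<Phi> x s"
        by eventually_elim (use s(1) in \<open>auto simp: D_def less_eq_vec_def less_imp_le\<close>)
      have "(\<lambda>k. p (\<Phi> (?y k) s - \<Phi> x s)) \<longlonglongrightarrow> 0"
        by (rule tendstoD_seminorm(1)[OF p cont[OF s]])
      then have "(\<lambda>k. p (D k s)) \<longlonglongrightarrow> 0"
        by (rule Lim_transform_eventually) (use ev in \<open>eventually_elim, simp\<close>)
      then show ?case using p by (simp add: tendsto_ennreal_0_iff)
    qed
  qed simp
  then have "(\<lambda>k. \<integral>\<^sup>+s. ennreal (p (D k s)) \<partial>lebesgue_on {0..x}) \<longlonglongrightarrow> 0" by simp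
  then have "(\<lambda>k. ennreal (p (C (?y k) - C x))) \<longlonglongrightarrow> 0"
    by (rule tendsto_0_ennreal_sandwich[OF always_eventually[OF allI[OF has_sint_bound[OF D p]]]])
  then show "(\<lambda>k. p (C (?y k) - C x)) \<longlonglongrightarrow> 0" using p by (simp add: tendsto_ennreal_0_iff)
qed

lemma bounded_on_box:
  fixes g :: "real^'n \<Rightarrow> 'b::topological_space" and r :: "'b \<Rightarrow> real"
  assumes "continuous_on {0..} g" "continuous_on UNIV r"
  shows "\<exists>B. \<forall>z\<in>{0..T}. \<bar>r (g z)\<bar> \<le> B"
proof -
  have "continuous_on {0..T} g" by (rule continuous_on_subset[OF assms(1)]) auto
  then have "continuous_on {0..T} (\<lambda>z. r (g z))"
    using continuous_on_compose2[OF assms(2)] by blast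
  then have "bounded ((\<lambda>z. r (g z)) ` {0..T})"
    using compact_imp_bounded compact_continuous_image box_compact by blast
  then show ?thesis by (auto simp: bounded_iff)
qed

end

lemma lebesgue_on_reflect:
  fixes x :: "real^'n"
  shows "(-) x \<in> lebesgue_on {0..x} \<rightarrow>\<^sub>M lebesgue_on {0..x}"
    and "distr (lebesgue_on {0..x}) (lebesgue_on {0..x}) ((-) x) = lebesgue_on {0..x}"
proof -
  have "(-) x \<in> lebesgue_on {0..x} \<rightarrow>\<^sub>M lebesgue"
    by (rule measurable_restrict_space1[OF lebesgue_reflect(2)])
  then show T: "(-) x \<in> lebesgue_on {0..x} \<rightarrow>\<^sub>M lebesgue_on {0..x}"
    by (intro measurable_restrict_space2) (auto simp: space_restrict_space)
  show "distr (lebesgue_on {0..x}) (lebesgue_on {0..x}) ((-) x) = lebesgue_on {0..x}"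
  proof (rule measure_eqI)
    fix S assume "S \<in> sets (distr (lebesgue_on {0..x}) (lebesgue_on {0..x}) ((-) x))"
    then have S': "S \<in> sets (lebesgue_on {0..x})" by simp
    then have S: "S \<in> sets lebesgue" "S \<subseteq> {0..x}" by (auto simp: sets_restrict_space_iff)
    have "emeasure (distr (lebesgue_on {0..x}) (lebesgue_on {0..x}) ((-) x)) S
        = emeasure (lebesgue_on {0..x}) ((-) x -` S \<inter> {0..x})"
      by (subst emeasure_distr[OF T S']) (simp add: space_restrict_space)
    also have "\<dots> = emeasure lebesgue ((-) x -` S \<inter> {0..x})"
      by (rule emeasure_restrict_space) auto
    \<comment> \<open>If \<open>x - s\<close> lies in the box, so does \<open>s\<close>.\<close>
    also have "(-) x -` S \<inter> {0..x} = (-) x -` S \<inter> space lebesgue"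
      using S(2) by force
    also have "emeasure lebesgue \<dots> = emeasure (distr lebesgue lebesgue ((-) x)) S"
      by (rule emeasure_distr[OF lebesgue_reflect(2) S(1), symmetric])
    also have "\<dots> = emeasure (lebesgue_on {0..x}) S"
      unfolding lebesgue_reflect(1) using S(2) by (intro emeasure_restrict_space[symmetric]) auto
    finally show "emeasure (distr (lebesgue_on {0..x}) (lebesgue_on {0..x}) ((-) x)) S
        = emeasure (lebesgue_on {0..x}) S" .
  qed simp
qed

section \<open>Convolutions with one continuous factor\<close>

context convolution_pair
begin

text \<open>\<open>A\<close> is bounded on boxes, which gives both existence and the majorant
  \<open>B * p (F s)\<close>. Continuity enters along the grid, where \<open>grid k x - s\<close> is
  eventually in the orthant.\<close>

lemma convolution_continuous_left:
  assumes cA: "continuous_on {0..} A"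
  shows "\<exists>I. has_sint P (lebesgue_on {0..x}) (\<lambda>s. A (x - s) *\<^sub>C F s) I"
    and "(\<And>x. 0 \<le> x \<Longrightarrow> has_sint P (lebesgue_on {0..x}) (\<lambda>s. A (x - s) *\<^sub>C F s) (C x)) \<Longrightarrow> C \<in> L1_loc P"
proof -
  have bA: "\<exists>B\<ge>0. \<forall>z\<in>{0..T}. cmod (A z) \<le> B" for T
  proof -
    obtain B where "\<forall>z\<in>{0..T}. \<bar>cmod (A z)\<bar> \<le> B"
      using bounded_on_box[OF cA, where r = cmod and T = T] continuous_on_norm_id by blast
    then show ?thesis by (intro exI[of _ "\<bar>B\<bar>"]) auto
  qed
  show "\<exists>I. has_sint P (lebesgue_on {0..x}) (\<lambda>s. A (x - s) *\<^sub>C F s) I"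
  proof -
    interpret seminorm_system_measure P "lebesgue_on {0..x}"
      by (rule seminorm_system_lebesgue_on) simp
    obtain B where B: "\<forall>z\<in>{0..x}. cmod (A z) \<le> B" using bA by blast
    have "(\<lambda>s. A0 (x - s)) \<in> borel_measurable (lebesgue_on {0..x})"
      by (rule measurable_restrict_space1[OF A0_reflect_measurable])
    then have "(\<lambda>s. A (x - s)) \<in> borel_measurable (lebesgue_on {0..x})"
      by (rule measurable_cong[THEN iffD1, rotated]) (simp add: A_reflect space_restrict_space)
    then show ?thesis
      using B by (intro has_sint_bounded_mult[OF L1_loc_box[OF F]]) (auto simp: space_restrict_space)
  qed
  assume C: "\<And>x. 0 \<le> x \<Longrightarrow> has_sint P (lebesgue_on {0..x}) (\<lambda>s. A (x - s) *\<^sub>C F s) (C x)"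
  show "C \<in> L1_loc P"
  proof (rule L1_loc_parametric_integral[OF C])
    fix x s :: "real^'n" assume s: "s \<in> {0..x}" "\<forall>i. s $ i < x $ i"
    from eventually_grid_greater[OF s(2)] have ev: "\<forall>\<^sub>F k in sequentially. grid k x - s \<in> {0..}"
      by eventually_elim (auto simp: less_eq_vec_def less_imp_le)
    have "(\<lambda>k. A (grid k x - s)) \<longlonglongrightarrow> A (x - s)"
      using s(1) by (intro continuous_on_tendsto_compose[OF cA _ _ ev] tendsto_diff grid_tendsto tendsto_const) auto
    then show "(\<lambda>k. A (grid k x - s) *\<^sub>C F s) \<longlonglongrightarrow> A (x - s) *\<^sub>C F s"
      by (rule tendsto_scaleC[OF _ tendsto_const])
  next
    fix p T assume p: "p \<in> P"
    obtain B where B: "B \<ge> 0" "\<And>z. z \<in> {0..T} \<Longrightarrow> cmod (A z) \<le> B" using bA[of T] by blast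
    interpret seminorm_system_measure P "lebesgue_on {0..T}"
      by (rule seminorm_system_lebesgue_on) simp
    note m[measurable] = has_sint_measurable[OF L1_loc_box[OF F] p]
    show "\<exists>w. w \<in> borel_measurable (lebesgue_on {0..T}) \<and> (\<integral>\<^sup>+s. w s \<partial>lebesgue_on {0..T}) < \<infinity> \<and>
      (\<forall>y\<in>{0..T}. \<forall>s\<in>{0..y}. ennreal (p (A (y - s) *\<^sub>C F s)) \<le> w s)"
    proof (intro exI[of _ "\<lambda>s. ennreal B * ennreal (p (F s))"] conjI ballI)
      show "(\<integral>\<^sup>+s. ennreal B * ennreal (p (F s)) \<partial>lebesgue_on {0..T}) < \<infinity>"
        using has_sint_finite[OF L1_loc_box[OF F] p] by (simp add: nn_integral_cmult ennreal_mult_less_top)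
      fix y s assume "y \<in> {0..T}" "s \<in> {0..y}"
      then have "y - s \<in> {0..T}" by (auto simp: less_eq_vec_def) (smt (verit))
      then have "cmod (A (y - s)) * p (F s) \<le> B * p (F s)" using B(2) p by (intro mult_right_mono) auto
      then show "ennreal (p (A (y - s) *\<^sub>C F s)) \<le> ennreal B * ennreal (p (F s))"
        using B(1) p by (simp add: scale flip: ennreal_mult)
    qed measurable
  qed
qed

text \<open>The moving variable has to sit on the continuous factor, so the box is reflected: the
  integrand \<open>A u *\<^sub>C F (y - u)\<close> has a fixed multiple of \<open>cmod (A u)\<close>
  as majorant. Existence comes from sampling \<open>F\<close> on the grid.\<close>

lemma convolution_continuous_right:
  assumes cF: "continuous_on {0..} F"
  shows "\<exists>I. has_sint P (lebesgue_on {0..x}) (\<lambda>s. A (x - s) *\<^sub>C F s) I"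
    and "(\<And>x. 0 \<le> x \<Longrightarrow> has_sint P (lebesgue_on {0..x}) (\<lambda>s. A (x - s) *\<^sub>C F s) (C x)) \<Longrightarrow> C \<in> L1_loc P"
proof -
  have "\<exists>B. \<forall>p\<in>P. 0 \<le> B p \<and> (\<forall>z\<in>{0..T}. p (F z) \<le> B p)" for T
  proof -
    have "\<forall>p\<in>P. \<exists>b. 0 \<le> b \<and> (\<forall>z\<in>{0..T}. p (F z) \<le> b)"
    proof
      fix p assume p: "p \<in> P"
      obtain b where "\<forall>z\<in>{0..T}. \<bar>p (F z)\<bar> \<le> b" using bounded_on_box[OF cF continuousP[OF p]] by blast
      then show "\<exists>b. 0 \<le> b \<and> (\<forall>z\<in>{0..T}. p (F z) \<le> b)" by (intro exI[of _ "\<bar>b\<bar>"]) auto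
    qed
    then show ?thesis by (rule bchoice)
  qed
  then obtain B where B: "\<And>T p. p \<in> P \<Longrightarrow> 0 \<le> B T p"
    "\<And>T p z. p \<in> P \<Longrightarrow> z \<in> {0..T} \<Longrightarrow> p (F z) \<le> B T p" by metis
  show "\<exists>I. has_sint P (lebesgue_on {0..x}) (\<lambda>s. A (x - s) *\<^sub>C F s) I"
  proof -
    interpret seminorm_system_measure P "lebesgue_on {0..x}"
      by (rule seminorm_system_lebesgue_on) simp
    have sp: "space (lebesgue_on {0..x}) = {0..x}" by (simp add: space_restrict_space)
    have g: "grid k s \<in> {0..x}" if "s \<in> {0..x}" for k s
      using that grid_le[of k s] grid_nonneg[of s k] by (auto intro: order_trans)
    show ?thesis
    proof (rule has_sint_integrable_mult[where s = "\<lambda>k s. F (grid k s)" and B = "B x"])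
      have "integrable (lebesgue_on {0..x}) (\<lambda>s. A0 (x - s))"
        using integrable_mult_indicator[OF box_sets A0_reflect_integrable] by (simp add: integrable_restrict_space)
      then show "integrable (lebesgue_on {0..x}) (\<lambda>s. A (x - s))"
        by (rule Bochner_Integration.integrable_cong[THEN iffD1, rotated 2]) (simp_all add: A_reflect sp)
      show "simple_function (lebesgue_on {0..x}) (\<lambda>s. F (grid k s))" for k
        by (rule simple_function_compose1[OF simple_function_grid]) (simp_all add: compact_imp_bounded)
      fix s assume s: "s \<in> space (lebesgue_on {0..x})"
      show "(\<lambda>k. F (grid k s)) \<longlonglongrightarrow> F s"
        using s g[of s] by (intro continuous_on_tendsto_compose[OF cF grid_tendsto] always_eventually) (auto simp: sp)
      show "p (F s) \<le> B x p" if "p \<in> P" for p using s B(2)[OF that] by (simp add: sp)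
      show "p (F (grid k s)) \<le> B x p" if "p \<in> P" for p k using s g[of s k] B(2)[OF that] by (simp add: sp)
    qed
  qed
  assume C: "\<And>x. 0 \<le> x \<Longrightarrow> has_sint P (lebesgue_on {0..x}) (\<lambda>s. A (x - s) *\<^sub>C F s) (C x)"
  show "C \<in> L1_loc P"
  proof (rule L1_loc_parametric_integral)
    fix y :: "real^'n" assume y: "0 \<le> y"
    interpret seminorm_system_measure P "lebesgue_on {0..y}"
      by (rule seminorm_system_lebesgue_on) simp
    show "has_sint P (lebesgue_on {0..y}) (\<lambda>u. A u *\<^sub>C F (y - u)) (C y)"
      using has_sint_measure_preserving[OF C[OF y] lebesgue_on_reflect] by simp
  next
    fix x u :: "real^'n" assume u: "u \<in> {0..x}" "\<forall>i. u $ i < x $ i"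
    from eventually_grid_greater[OF u(2)] have ev: "\<forall>\<^sub>F k in sequentially. grid k x - u \<in> {0..}"
      by eventually_elim (auto simp: less_eq_vec_def less_imp_le)
    have lim: "(\<lambda>k. F (grid k x - u)) \<longlonglongrightarrow> F (x - u)"
      using u(1) by (intro continuous_on_tendsto_compose[OF cF _ _ ev] tendsto_diff grid_tendsto tendsto_const) auto
    show "(\<lambda>k. A u *\<^sub>C F (grid k x - u)) \<longlonglongrightarrow> A u *\<^sub>C F (x - u)"
      by (rule tendsto_scaleC[OF tendsto_const lim])
  next
    fix p T assume p: "p \<in> P"
    have iA: "integrable (lebesgue_on {0..T}) A"
      using A_has_bochner[of T] by (auto simp: has_bochner_integral_iff)
    then have [measurable]: "A \<in> borel_measurable (lebesgue_on {0..T})" by simp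
    show "\<exists>w. w \<in> borel_measurable (lebesgue_on {0..T}) \<and> (\<integral>\<^sup>+s. w s \<partial>lebesgue_on {0..T}) < \<infinity> \<and>
      (\<forall>y\<in>{0..T}. \<forall>u\<in>{0..y}. ennreal (p (A u *\<^sub>C F (y - u))) \<le> w u)"
    proof (intro exI[of _ "\<lambda>u. ennreal (B T p) * ennreal (cmod (A u))"] conjI ballI)
      show "(\<integral>\<^sup>+s. ennreal (B T p) * ennreal (cmod (A s)) \<partial>lebesgue_on {0..T}) < \<infinity>"
        using iA by (simp add: nn_integral_cmult ennreal_mult_less_top integrable_iff_bounded)
      fix y u assume "y \<in> {0..T}" "u \<in> {0..y}"
      then have "y - u \<in> {0..T}" by (auto simp: less_eq_vec_def) (smt (verit))
      then have "p (F (y - u)) \<le> B T p" by (rule B(2)[OF p])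
      then have "cmod (A u) * p (F (y - u)) \<le> B T p * cmod (A u)"
        by (metis mult.commute mult_left_mono norm_ge_zero)
      then show "ennreal (p (A u *\<^sub>C F (y - u))) \<le> ennreal (B T p) * ennreal (cmod (A u))"
        using B(1)[OF p] p by (simp add: scale flip: ennreal_mult)
    qed measurable
  qed
qed

end

section \<open>Directed and countable systems of seminorms\<close>

text \<open>Finite sums with repetition: a directed system for the same topology, so that every
  neighbourhood of 0 contains a ball of a single member.\<close>

inductive_set seminorm_sums :: "('a::complex_vector \<Rightarrow> real) set \<Rightarrow> ('a \<Rightarrow> real) set"
  for P :: "('a \<Rightarrow> real) set" where
  zero: "(\<lambda>x. 0) \<in> seminorm_sums P"
| add: "p \<in> P \<Longrightarrow> r \<in> seminorm_sums P \<Longrightarrow> (\<lambda>x. p x + r x) \<in> seminorm_sums P"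

lemma seminorm_sums_base: "p \<in> P \<Longrightarrow> p \<in> seminorm_sums P"
  using seminorm_sums.add[OF _ seminorm_sums.zero] by fastforce

lemma seminorm_sums_add:
  "r \<in> seminorm_sums P \<Longrightarrow> r' \<in> seminorm_sums P \<Longrightarrow> (\<lambda>x. r x + r' x) \<in> seminorm_sums P"
proof (induction r rule: seminorm_sums.induct)
  case (add p r)
  then show ?case using seminorm_sums.add[of p P "\<lambda>x. r x + r' x"] by (simp add: add.assoc)
qed simp

lemma seminorm_sums_sum:
  "(\<And>i. i \<in> I \<Longrightarrow> r i \<in> seminorm_sums P) \<Longrightarrow> (\<lambda>x. \<Sum>i\<in>I. r i x) \<in> seminorm_sums P"
  by (induction I rule: infinite_finite_induct) (auto intro: seminorm_sums.zero seminorm_sums_add)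

context seminorm_system
begin

lemma fundamental_seminorm_sums: "fundamental_seminorms (seminorm_sums P)"
  unfolding fundamental_seminorms_def
proof (intro conjI ballI allI impI)
  fix r assume "r \<in> seminorm_sums P"
  then have "seminorm r \<and> continuous_on UNIV r"
  proof (induction r rule: seminorm_sums.induct)
    case (add p r)
    then have r: "0 \<le> r x" "r (x + y) \<le> r x + r y" "r (c *\<^sub>C x) = cmod c * r x" for x y c
      by (simp_all add: seminorm_def)
    have "p (x + y) + r (x + y) \<le> p x + r x + (p y + r y)" for x y
      using triangle[OF add(1), of x y] r(2)[of x y] by linarith
    moreover have "continuous_on UNIV (\<lambda>x. p x + r x)"
      using continuousP[OF add(1)] add.IH by (intro continuous_on_add) auto
    ultimately show ?case
      using nonneg[OF add(1)] r(1) by (simp add: seminorm_def scale[OF add(1)] r(3) distrib_left)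
  qed (simp add: seminorm_def)
  then show "seminorm r" "continuous_on UNIV r" by auto
next
  fix U :: "'a set" assume "open U \<and> 0 \<in> U"
  then obtain Q e where "finite Q" "Q \<subseteq> P" "e > 0" "\<And>x. (\<And>p. p \<in> Q \<Longrightarrow> p x < e) \<Longrightarrow> x \<in> U"
    using nhds_0[of U] by metis
  then show "\<exists>F e. finite F \<and> F \<subseteq> seminorm_sums P \<and> e > 0 \<and> {x. \<forall>p\<in>F. p x < e} \<subseteq> U"
    by (intro exI[of _ Q] exI[of _ e]) (auto intro: seminorm_sums_base)
qed

lemma seminorm_sums_ball:
  assumes "open U" "0 \<in> U"
  shows "\<exists>r\<in>seminorm_sums P. \<exists>e>0. \<forall>x. r x < e \<longrightarrow> x \<in> U"
proof -
  obtain Q e where Q: "finite Q" "Q \<subseteq> P" "e > 0" "\<And>x. (\<And>p. p \<in> Q \<Longrightarrow> p x < e) \<Longrightarrow> x \<in> U"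
    using nhds_0[OF assms] by metis
  have "p x \<le> (\<Sum>p\<in>Q. p x)" if "p \<in> Q" for p x
    using Q(1,2) that by (intro member_le_sum) auto
  then have "\<forall>x. (\<Sum>p\<in>Q. p x) < e \<longrightarrow> x \<in> U" using Q(4) by (meson le_less_trans)
  with Q(3) have "\<exists>e>0. \<forall>x. (\<Sum>p\<in>Q. p x) < e \<longrightarrow> x \<in> U" by (intro exI[of _ e]) simp
  moreover have "(\<lambda>x. \<Sum>p\<in>Q. p x) \<in> seminorm_sums P"
    using Q(2) by (intro seminorm_sums_sum) (auto intro: seminorm_sums_base)
  ultimately show ?thesis by (rule bexI[where P = "\<lambda>r. \<exists>e>0. \<forall>x. r x < e \<longrightarrow> x \<in> U"])
qed

text \<open>Passing from \<open>P\<close> to the sums, the mean errors add up along the induction.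
  Splitting the integral uses measurability of \<open>r (g t - s k t)\<close>, which is taken from
  a.e. convergence because mean convergence for \<open>r\<close> is part of the claim.\<close>

lemma approx_simple_seminorm_sums:
  fixes K :: "(real^'n) set"
  assumes K: "K \<in> lmeasurable"
  shows "approx_simple (seminorm_sums P) K g s \<longleftrightarrow> approx_simple P K g s"
proof -
  interpret S: seminorm_system "seminorm_sums P"
    by unfold_locales (rule fundamental_seminorm_sums)
  interpret M: seminorm_system_measure P "lebesgue_on K" by (rule seminorm_system_lebesgue_on[OF K])
  interpret SM: seminorm_system_measure "seminorm_sums P" "lebesgue_on K"
    by (rule S.seminorm_system_lebesgue_on[OF K])
  show ?thesis
    unfolding approx_simple_iff[OF K] S.approx_simple_iff[OF K]
  proof
    assume "simple_approx (seminorm_sums P) (lebesgue_on K) g s"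
    then show "simple_approx P (lebesgue_on K) g s"
      unfolding simple_approx_def by (auto intro: seminorm_sums_base)
  next
    assume s: "simple_approx P (lebesgue_on K) g s"
    have "(\<lambda>k. \<integral>\<^sup>+t. ennreal (r (g t - s k t)) \<partial>lebesgue_on K) \<longlonglongrightarrow> 0" if "r \<in> seminorm_sums P" for r
      using that
    proof (induction r rule: seminorm_sums.induct)
      case (add p r)
      have "(\<integral>\<^sup>+t. ennreal (p (g t - s k t) + r (g t - s k t)) \<partial>lebesgue_on K)
          \<le> (\<integral>\<^sup>+t. ennreal (p (g t - s k t)) \<partial>lebesgue_on K) + (\<integral>\<^sup>+t. ennreal (r (g t - s k t)) \<partial>lebesgue_on K)" for k
      proof -
        have "AE t in lebesgue_on K. (\<lambda>m. s m t - s k t) \<longlonglongrightarrow> g t - s k t"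
          using M.simple_approxD(2)[OF s]
        proof eventually_elim
          case (elim t)
          show ?case using tendsto_add[OF elim tendsto_const[of "- s k t"]] by simp
        qed
        then have "(\<lambda>t. r (g t - s k t)) \<in> borel_measurable (lebesgue_on K)"
          using simple_function_compose2[OF M.simple_approxD(1)[OF s] M.simple_approxD(1)[OF s]] add(2)
          by (intro S.borel_measurable_seminorm[OF M.complete_measure_axioms]) auto
        then show ?thesis
          using M.simple_approx_measurable_diff_simple[OF s M.simple_approxD(1)[OF s] add(1)]
            nonneg[OF add(1)] S.nonneg[OF add(2)]
          by (subst nn_integral_add[symmetric]) (auto simp: ennreal_plus)
      qed
      then have ev: "\<forall>\<^sub>F k in sequentially. (\<integral>\<^sup>+t. ennreal (p (g t - s k t) + r (g t - s k t)) \<partial>lebesgue_on K)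
          \<le> (\<integral>\<^sup>+t. ennreal (p (g t - s k t)) \<partial>lebesgue_on K) + (\<integral>\<^sup>+t. ennreal (r (g t - s k t)) \<partial>lebesgue_on K)"
        by (intro always_eventually allI)
      have "(\<lambda>k. (\<integral>\<^sup>+t. ennreal (p (g t - s k t)) \<partial>lebesgue_on K)
          + (\<integral>\<^sup>+t. ennreal (r (g t - s k t)) \<partial>lebesgue_on K)) \<longlonglongrightarrow> 0"
        using tendsto_add[OF M.simple_approxD(3)[OF s add(1)] add.IH] by simp
      from tendsto_0_ennreal_sandwich[OF ev this] show ?case .
    qed simp
    then show "simple_approx (seminorm_sums P) (lebesgue_on K) g s"
      using s unfolding simple_approx_def by simp
  qed
qed

lemma sc_integrable_seminorm_sums:
  "K \<in> lmeasurable \<Longrightarrow> sc_integrable (seminorm_sums P) K g \<longleftrightarrow> sc_integrable P (K :: (real^'n) set) g"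
  unfolding sc_integrable_def using approx_simple_seminorm_sums by blast

lemma L1_loc_seminorm_sums: "(L1_loc (seminorm_sums P) :: (real^'n \<Rightarrow> 'a) set) = L1_loc P"
  unfolding L1_loc_def by (auto simp: sc_integrable_seminorm_sums lmeasurable_compact)

lemma nn_integral_seminorm_sums_finite:
  fixes f :: "real^'n \<Rightarrow> 'a"
  assumes f: "f \<in> L1_loc P"
    and fin: "\<And>p. p \<in> P \<Longrightarrow> (\<integral>\<^sup>+t. ennreal (p (f t)) \<partial>lebesgue_on {0..}) < \<infinity>"
    and r: "r \<in> seminorm_sums P"
  shows "(\<integral>\<^sup>+t. ennreal (r (f t)) \<partial>lebesgue_on {0..}) < \<infinity>"
  using r
proof (induction r rule: seminorm_sums.induct)
  case (add p r)
  interpret S: seminorm_system "seminorm_sums P"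
    by unfold_locales (rule fundamental_seminorm_sums)
  have fS: "f \<in> L1_loc (seminorm_sums P)" unfolding L1_loc_seminorm_sums by (rule f)
  have "(\<integral>\<^sup>+t. ennreal (p (f t) + r (f t)) \<partial>lebesgue_on {0..})
      = (\<integral>\<^sup>+t. ennreal (p (f t)) * indicator {0..} t + ennreal (r (f t)) * indicator {0..} t \<partial>lebesgue)"
    unfolding nn_integral_lebesgue_on[OF orthant_sets]
    using nonneg[OF add(1)] S.nonneg[OF add(2)]
    by (intro nn_integral_cong) (simp add: ennreal_plus distrib_right)
  also have "\<dots> = (\<integral>\<^sup>+t. ennreal (p (f t)) \<partial>lebesgue_on {0..}) + (\<integral>\<^sup>+t. ennreal (r (f t)) \<partial>lebesgue_on {0..})"
    unfolding nn_integral_lebesgue_on[OF orthant_sets]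
    by (rule nn_integral_add[OF L1_loc_seminorm_measurable[OF f add(1)] S.L1_loc_seminorm_measurable[OF fS add(2)]])
  also have "\<dots> < \<infinity>" using fin[OF add(1)] add.IH by simp
  finally show ?case .
qed simp

text \<open>For each \<open>m\<close> a finite sum is chosen some ball of which fits into the metric
  ball of radius \<open>1 / (m + 1)\<close>; \<open>q k\<close> adds up the first
  \<open>k + 1\<close> of them. Domination follows from continuity of \<open>p\<close> by
  homogeneity.\<close>

lemma frechet_countable_seminorms:
  assumes "frechet_space TYPE('a)"
  shows "\<exists>q. countable_seminorm_system (seminorm_sums P) q"
proof -
  interpret S: seminorm_system "seminorm_sums P"
    by unfold_locales (rule fundamental_seminorm_sums)
  obtain d :: "'a \<Rightarrow> 'a \<Rightarrow> real" where M: "Metric_space UNIV d"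
    and top: "Metric_space.mtopology UNIV d = euclidean"
    using assms unfolding frechet_space_def by (elim exE conjE) (rule that)
  interpret Metric_space UNIV d by (rule M)
  have opn: "open U \<longleftrightarrow> openin mtopology U" for U by (simp add: top)
  have "\<forall>m::nat. \<exists>z. fst z \<in> seminorm_sums P \<and> snd z > 0 \<and>
      (\<forall>x. fst z x < snd z \<longrightarrow> x \<in> mball 0 (inverse (real (Suc m))))"
  proof
    fix m :: nat
    have "open (mball 0 (inverse (real (Suc m))))" "0 \<in> mball 0 (inverse (real (Suc m)))"
      by (simp_all add: opn)
    from seminorm_sums_ball[OF this] show "\<exists>z. fst z \<in> seminorm_sums P \<and> snd z > 0 \<and>
      (\<forall>x. fst z x < snd z \<longrightarrow> x \<in> mball 0 (inverse (real (Suc m))))"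
      by auto
  qed
  from choice[OF this] obtain z where z: "\<And>m. fst (z m) \<in> seminorm_sums P" "\<And>m. snd (z m) > 0"
    "\<And>m x. fst (z m) x < snd (z m) \<Longrightarrow> x \<in> mball 0 (inverse (real (Suc m)))" by blast
  define q where "q k x = (\<Sum>m\<le>k. fst (z m) x)" for k :: nat and x
  have "countable_seminorm_system (seminorm_sums P) q"
  proof unfold_locales
    show qS: "q k \<in> seminorm_sums P" for k
      unfolding q_def[abs_def] using z(1) by (intro seminorm_sums_sum)
    show "q k x \<le> q m x" if "k \<le> m" for k m x
      unfolding q_def using that S.nonneg[OF z(1)] by (intro sum_mono2) auto
    fix p assume p: "p \<in> seminorm_sums P"
    have "open {x. p x < 1}" using S.continuousP[OF p] by (intro open_Collect_less continuous_on_const)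
    moreover have "0 \<in> {x. p x < 1}" using S.zero[OF p] by simp
    ultimately obtain r where r: "r > 0" "mball 0 r \<subseteq> {x. p x < 1}"
      unfolding opn openin_mtopology by blast
    obtain k where k: "inverse (real (Suc k)) < r" using reals_Archimedean[OF r(1)] by blast
    define e where "e = snd (z k)"
    have e: "e > 0" using z(2) by (simp add: e_def)
    have small: "p x < 1" if "q k x < e" for x
    proof -
      have "fst (z k) x \<le> q k x"
        unfolding q_def using S.nonneg[OF z(1)] by (intro member_le_sum) auto
      then have "x \<in> mball 0 (inverse (real (Suc k)))" using that z(3)[of k x] by (simp add: e_def)
      then show ?thesis using r(2) mball_subset_concentric[of "inverse (real (Suc k))" r 0] k by auto
    qed
    \<comment> \<open>Where \<open>q k x > 0\<close>, scaling \<open>x\<close> to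
      \<open>q k\<close>-size \<open>e / 2\<close> and applying \<open>small\<close> gives the
      constant \<open>2 / e\<close>; where \<open>q k x = 0\<close>, scaling \<open>x\<close> to
      \<open>p\<close>-size 1 would contradict \<open>small\<close>.\<close>
    have "p x \<le> (2 / e) * q k x" for x
    proof (cases "q k x = 0")
      case True
      have "p x = 0"
      proof (rule ccontr)
        assume "p x \<noteq> 0"
        then have px: "p x > 0" using S.nonneg[OF p, of x] by simp
        have "q k ((1 / p x) *\<^sub>R x) < e" using True e by (simp add: S.scaleR[OF qS])
        from small[OF this] px show False by (simp add: S.scaleR[OF p])
      qed
      then show ?thesis using True by simp
    next
      case False
      then have c: "q k x > 0" using S.nonneg[OF qS, of k x] by simp
      have "q k ((e / (2 * q k x)) *\<^sub>R x) < e" using c e by (simp add: S.scaleR[OF qS])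
      from small[OF this] have "e / (2 * q k x) * p x < 1" using c e by (simp add: S.scaleR[OF p])
      then show ?thesis using c e by (simp add: field_simps)
    qed
    then show "\<exists>c\<ge>0. \<exists>k. \<forall>x. p x \<le> c * q k x"
      using e by (intro exI[of _ "2 / e"] conjI exI[of _ k]) auto
  qed
  then show ?thesis by (rule exI[where P = "countable_seminorm_system (seminorm_sums P)"])
qed


lemma has_sint_seminorm_sums:
  fixes K :: "(real^'n) set"
  assumes K: "K \<in> lmeasurable"
  shows "has_sint (seminorm_sums P) (lebesgue_on K) g I \<longleftrightarrow> has_sint P (lebesgue_on K) g I"
proof -
  interpret S: seminorm_system "seminorm_sums P"
    by unfold_locales (rule fundamental_seminorm_sums)
  show ?thesis
    unfolding has_sint_def approx_simple_iff[OF K, symmetric] S.approx_simple_iff[OF K, symmetric]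
      approx_simple_seminorm_sums[OF K] ..
qed

text \<open>Used for the exponential weight and for its inverse: a continuous factor is bounded on
  compact sets.\<close>

lemma L1_loc_continuous_mult:
  fixes f :: "real^'n \<Rightarrow> 'a" and \<phi> :: "real^'n \<Rightarrow> complex"
  assumes f: "f \<in> L1_loc P" and \<phi>: "continuous_on UNIV \<phi>"
  shows "(\<lambda>t. \<phi> t *\<^sub>C f t) \<in> L1_loc P"
proof (rule L1_locI)
  fix K :: "(real^'n) set" assume K: "compact K" "K \<subseteq> {0..}"
  interpret seminorm_system_measure P "lebesgue_on K"
    by (rule seminorm_system_lebesgue_on[OF lmeasurable_compact[OF K(1)]])
  have "bounded (\<phi> ` K)"
    using K(1) \<phi> by (intro compact_imp_bounded compact_continuous_image) (auto intro: continuous_on_subset)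
  then obtain B where B: "\<And>t. t \<in> K \<Longrightarrow> cmod (\<phi> t) \<le> B" by (auto simp: bounded_iff)
  have "\<phi> \<in> borel_measurable lborel" using borel_measurable_continuous_onI[OF \<phi>] by simp
  then have "\<phi> \<in> borel_measurable (lebesgue_on K)"
    by (intro measurable_restrict_space1 measurable_completion)
  then show "\<exists>I. has_sint P (lebesgue_on K) (\<lambda>t. \<phi> t *\<^sub>C f t) I"
    by (rule has_sint_bounded_mult[OF L1_loc_has_sint[OF f K], where B = B]) (simp add: B space_restrict_space)
qed

end

section \<open>The Frechet case for arbitrary systems of seminorms, and the limit of the
  product\<close>

context convolution_pair
begin

text \<open>The finite sums of \<open>P\<close> have the same integrals as \<open>P\<close>, so the
  countable case is applied to them and carried back.\<close>

lemma convolution_frechet: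
  assumes "frechet_space TYPE('a)"
  shows "AE x in lebesgue_on {0..}. \<exists>I. has_sint P (lebesgue_on {0..x}) (\<lambda>s. A (x - s) *\<^sub>C F s) I"
    and "AE x in lebesgue_on {0..}. has_sint P (lebesgue_on {0..x}) (\<lambda>s. A (x - s) *\<^sub>C F s) (C x) \<Longrightarrow>
      C \<in> L1_loc P"
proof -
  obtain q where q: "countable_seminorm_system (seminorm_sums P) q"
    using frechet_countable_seminorms[OF assms] ..
  interpret S: countable_seminorm_system "seminorm_sums P" q by (rule q)
  interpret S: frechet_convolution_pair "seminorm_sums P" A F q
    using A F finA nn_integral_seminorm_sums_finite[OF F finF]
    by unfold_locales (simp_all add: L1_loc_seminorm_sums)
  have "AE x in lebesgue. \<exists>I. has_sint P (lebesgue_on {0..x}) (\<lambda>s. A (x - s) *\<^sub>C F s) I"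
    using S.convolution_defined_AE by (simp add: has_sint_seminorm_sums)
  then show "AE x in lebesgue_on {0..}. \<exists>I. has_sint P (lebesgue_on {0..x}) (\<lambda>s. A (x - s) *\<^sub>C F s) I"
    by (subst AE_restrict_space_iff) auto
  show "C \<in> L1_loc P"
    if "AE x in lebesgue_on {0..}. has_sint P (lebesgue_on {0..x}) (\<lambda>s. A (x - s) *\<^sub>C F s) (C x)"
    using S.convolution_L1_loc[of C] that by (simp add: has_sint_seminorm_sums L1_loc_seminorm_sums)
qed

text \<open>\<open>convolution_limit\<close> concerns a difference only; absolute integrability
  provides the limits of the two factors and thereby the third.\<close>

lemma convolution_limit_product:
  assumes "AE x in lebesgue_on {0..}. has_sint P (lebesgue_on {0..x}) (\<lambda>s. A (x - s) *\<^sub>C F s) (C x)"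
    and "C \<in> L1_loc P"
  shows "\<exists>LA LF. ((\<lambda>t. sc_integral {cmod} {0..t} A) \<longlongrightarrow> LA) at_top \<and>
    ((\<lambda>t. sc_integral P {0..t} F) \<longlongrightarrow> LF) at_top \<and> ((\<lambda>t. sc_integral P {0..t} C) \<longlongrightarrow> LA *\<^sub>C LF) at_top"
proof -
  obtain LA where LA: "((\<lambda>t. sc_integral {cmod} {0..t} A) \<longlongrightarrow> LA) at_top"
    using seminorm_system.L1_loc_limit_exists[OF seminorm_system_complex A] finA by blast
  obtain LF where LF: "((\<lambda>t. sc_integral P {0..t} F) \<longlongrightarrow> LF) at_top"
    using L1_loc_limit_exists[OF F finF] by blast
  have "((\<lambda>t. sc_integral P {0..t} C) \<longlongrightarrow> LA *\<^sub>C LF) at_top"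
    using tendsto_add[OF convolution_limit[OF assms] tendsto_scaleC[OF LA LF]] by simp
  with LA LF show ?thesis by blast
qed

end

section \<open>The Laplace transform\<close>

lemma laplace_kernel_continuous: "continuous_on UNIV (laplace_kernel l)"
  unfolding laplace_kernel_def[abs_def] by (intro continuous_intros)

lemma laplace_kernel_add: "laplace_kernel l (x + y) = laplace_kernel l x * laplace_kernel l y"
  by (simp add: laplace_kernel_def distrib_left sum.distrib exp_diff exp_minus divide_inverse mult.commute
      flip: exp_add)

lemma laplace_kernel_nonzero [simp]: "laplace_kernel l x \<noteq> 0"
  by (simp add: laplace_kernel_def)

locale laplace_pair = seminorm_system P for P :: "('a::sclcs \<Rightarrow> real) set" +
  fixes a :: "real^'n \<Rightarrow> complex" and f :: "real^'n \<Rightarrow> 'a" and l :: "complex^'n"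
  assumes a: "a \<in> L1_loc {cmod}" and f: "f \<in> L1_loc P"
    and abs_a: "l \<in> Omega_abs {cmod} a" and abs_f: "l \<in> Omega_abs P f"
begin

definition A where "A t = laplace_kernel l t *\<^sub>C a t"

definition F where "F t = laplace_kernel l t *\<^sub>C f t"

sublocale convolution_pair P A F
proof unfold_locales
  show "A \<in> L1_loc {cmod}"
    unfolding A_def[abs_def]
    by (rule seminorm_system.L1_loc_continuous_mult[OF seminorm_system_complex a laplace_kernel_continuous])
  show "F \<in> L1_loc P"
    unfolding F_def[abs_def] by (rule L1_loc_continuous_mult[OF f laplace_kernel_continuous])
  show "(\<integral>\<^sup>+t. ennreal (cmod (A t)) \<partial>lebesgue_on {0..}) < \<infinity>"
    using abs_a by (simp add: Omega_abs_def A_def)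
  show "(\<integral>\<^sup>+t. ennreal (p (F t)) \<partial>lebesgue_on {0..}) < \<infinity>" if "p \<in> P" for p
    using abs_f that by (simp add: Omega_abs_def F_def)
qed

text \<open>The two weights multiply to the weight at \<open>x\<close>, which does not depend on
  \<open>s\<close>; so weighting commutes with convolution.\<close>

lemma convolution_integrand:
  "A (x - s) *\<^sub>C F s = laplace_kernel l x *\<^sub>C (a (x - s) *\<^sub>C f s)"
  using laplace_kernel_add[of l "x - s" s]
  by (simp add: A_def F_def scaleC_complex_def scaleC_scaleC mult_ac)

lemma has_sint_convolution_iff:
  "has_sint P (lebesgue_on {0..x}) (\<lambda>s. A (x - s) *\<^sub>C F s) (laplace_kernel l x *\<^sub>C I)
    \<longleftrightarrow> has_sint P (lebesgue_on {0..x}) (\<lambda>s. a (x - s) *\<^sub>C f s) I"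
proof -
  interpret seminorm_system_measure P "lebesgue_on {0..x}"
    by (rule seminorm_system_lebesgue_on) simp
  show ?thesis
    unfolding convolution_integrand
  proof
    assume "has_sint P (lebesgue_on {0..x}) (\<lambda>s. laplace_kernel l x *\<^sub>C a (x - s) *\<^sub>C f s) (laplace_kernel l x *\<^sub>C I)"
    from has_sint_scaleC[OF this, of "inverse (laplace_kernel l x)"]
    show "has_sint P (lebesgue_on {0..x}) (\<lambda>s. a (x - s) *\<^sub>C f s) I"
      by (simp add: scaleC_scaleC scaleC_one flip: mult.assoc)
  qed (rule has_sint_scaleC)
qed

lemma conv_defined_at_iff:
  "conv_defined_at P a f x \<longleftrightarrow> (\<exists>I. has_sint P (lebesgue_on {0..x}) (\<lambda>s. A (x - s) *\<^sub>C F s) I)"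
proof -
  have "conv_defined_at P a f x
      \<longleftrightarrow> (\<exists>I. has_sint P (lebesgue_on {0..x}) (\<lambda>s. A (x - s) *\<^sub>C F s) (laplace_kernel l x *\<^sub>C I))"
    unfolding conv_defined_at_def sc_integrable_iff[OF box_lmeasurable] has_sint_convolution_iff ..
  also have "\<dots> \<longleftrightarrow> (\<exists>I. has_sint P (lebesgue_on {0..x}) (\<lambda>s. A (x - s) *\<^sub>C F s) I)"
  proof safe
    fix I assume I: "has_sint P (lebesgue_on {0..x}) (\<lambda>s. A (x - s) *\<^sub>C F s) I"
    have "laplace_kernel l x *\<^sub>C (inverse (laplace_kernel l x) *\<^sub>C I) = I"
      by (simp add: scaleC_scaleC scaleC_one)
    then show "\<exists>I. has_sint P (lebesgue_on {0..x}) (\<lambda>s. A (x - s) *\<^sub>C F s) (laplace_kernel l x *\<^sub>C I)"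
      using I by (intro exI[of _ "inverse (laplace_kernel l x) *\<^sub>C I"]) simp
  qed blast
  finally show ?thesis .
qed

text \<open>Where the convolution is defined, this is the convolution of the weighted functions
  \<open>A\<close> and \<open>F\<close>; its box integrals are the partial Laplace integrals of
  \<open>conv0 P a f\<close>.\<close>

definition C where "C x = laplace_kernel l x *\<^sub>C conv0 P a f x"

lemma conv_defined_at_has_sint:
  assumes "conv_defined_at P a f x"
  shows "has_sint P (lebesgue_on {0..x}) (\<lambda>s. A (x - s) *\<^sub>C F s) (C x)"
  unfolding C_def has_sint_convolution_iff conv0_def
  using assms by (intro has_sint_sc_integral) (simp_all add: conv_defined_at_def)

text \<open>The weight is removed by multiplying with its continuous inverse.\<close>

lemma conv0_L1_loc:
  assumes "C \<in> L1_loc P"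
  shows "conv0 P a f \<in> L1_loc P"
proof -
  have "continuous_on UNIV (\<lambda>x. inverse (laplace_kernel l x))"
    by (intro continuous_on_inverse laplace_kernel_continuous) simp
  from L1_loc_continuous_mult[OF assms this] show ?thesis
    by (simp add: C_def scaleC_scaleC scaleC_one)
qed

lemma laplace_convolution:
  assumes def: "AE x in lebesgue_on {0..}. conv_defined_at P a f x" and CL: "C \<in> L1_loc P"
  shows "laplace_exists {cmod} a l \<and> laplace_exists P f l \<and> laplace_exists P (conv0 P a f) l \<and>
    laplace P (conv0 P a f) l = laplace {cmod} a l *\<^sub>C laplace P f l"
proof -
  have "AE x in lebesgue_on {0..}. has_sint P (lebesgue_on {0..x}) (\<lambda>s. A (x - s) *\<^sub>C F s) (C x)"
    using def by eventually_elim (rule conv_defined_at_has_sint)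
  from convolution_limit_product[OF this CL] obtain LA LF
    where "(laplace_partial {cmod} a l \<longlongrightarrow> LA) at_top" "(laplace_partial P f l \<longlongrightarrow> LF) at_top"
      "(laplace_partial P (conv0 P a f) l \<longlongrightarrow> LA *\<^sub>C LF) at_top"
    unfolding laplace_partial_def[abs_def] A_def[abs_def] F_def[abs_def] C_def[abs_def] by blast
  then show ?thesis
    unfolding laplace_exists_def laplace_def
    using tendsto_Lim[OF at_top_vec_neq_bot] by metis
qed

end

theorem proposition2p17:
  fixes P :: "('a::sclcs \<Rightarrow> real) set"
    and a :: "real ^ 'n \<Rightarrow> complex"
    and f :: "real ^ 'n \<Rightarrow> 'a"
    and l :: "complex ^ 'n"
  assumes "fundamental_seminorms P"
    and "CARD('n) \<ge> 2"
    and "a \<in> L1_loc {cmod}"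
    and "f \<in> L1_loc P"
    and "l \<in> Omega_abs {cmod} a \<inter> Omega_abs P f"
  shows "(frechet_space TYPE('a) \<longrightarrow>
      (AE x in lebesgue_on {0..}. conv_defined_at P a f x) \<and>
      conv0 P a f \<in> L1_loc P \<and>
      laplace_exists {cmod} a l \<and> laplace_exists P f l \<and> laplace_exists P (conv0 P a f) l \<and>
      laplace P (conv0 P a f) l = laplace {cmod} a l *\<^sub>C laplace P f l)
    \<and> (continuous_on {0..} a \<or> continuous_on {0..} f \<longrightarrow>
      (\<forall>x\<in>{0..}. conv_defined_at P a f x) \<and>
      conv0 P a f \<in> L1_loc P \<and>
      laplace_exists {cmod} a l \<and> laplace_exists P f l \<and> laplace_exists P (conv0 P a f) l \<and>
      laplace P (conv0 P a f) l = laplace {cmod} a l *\<^sub>C laplace P f l)"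
proof -
  interpret laplace_pair P a f l
    by unfold_locales (use assms in auto)
  show ?thesis
  proof (intro conjI[of "_ \<longrightarrow> _"] impI)
    assume X: "frechet_space TYPE('a)"
    have def: "AE x in lebesgue_on {0..}. conv_defined_at P a f x"
      unfolding conv_defined_at_iff by (rule convolution_frechet(1)[OF X])
    then have "AE x in lebesgue_on {0..}. has_sint P (lebesgue_on {0..x}) (\<lambda>s. A (x - s) *\<^sub>C F s) (C x)"
      by eventually_elim (rule conv_defined_at_has_sint)
    then have CL: "C \<in> L1_loc P" by (rule convolution_frechet(2)[OF X])
    show "(AE x in lebesgue_on {0..}. conv_defined_at P a f x) \<and>
      conv0 P a f \<in> L1_loc P \<and>
      laplace_exists {cmod} a l \<and> laplace_exists P f l \<and> laplace_exists P (conv0 P a f) l \<and>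
      laplace P (conv0 P a f) l = laplace {cmod} a l *\<^sub>C laplace P f l"
      using def conv0_L1_loc[OF CL] laplace_convolution[OF def CL] by blast
  next
    assume "continuous_on {0..} a \<or> continuous_on {0..} f"
    moreover have k: "continuous_on {0..} (laplace_kernel l)"
      using laplace_kernel_continuous by (rule continuous_on_subset) simp
    \<comment> \<open>The weight is continuous, so whichever factor is continuous stays so after
      weighting.\<close>
    ultimately have "continuous_on {0..} A \<or> continuous_on {0..} F"
      by (auto simp: A_def[abs_def] F_def[abs_def] continuous_on_def intro: tendsto_scaleC)
    \<comment> \<open>Definedness holds at every point, also outside the orthant, where the box is
      empty.\<close>
    then have "(\<forall>x. conv_defined_at P a f x) \<and> C \<in> L1_loc P"
    proof
      assume 1: "continuous_on {0..} A"
      have "conv_defined_at P a f x" for x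
        unfolding conv_defined_at_iff by (rule convolution_continuous_left(1)[OF 1])
      then show ?thesis using convolution_continuous_left(2)[OF 1, of C] conv_defined_at_has_sint by blast
    next
      assume 2: "continuous_on {0..} F"
      have "conv_defined_at P a f x" for x
        unfolding conv_defined_at_iff by (rule convolution_continuous_right(1)[OF 2])
      then show ?thesis using convolution_continuous_right(2)[OF 2, of C] conv_defined_at_has_sint by blast
    qed
    then have def: "\<And>x. conv_defined_at P a f x" and CL: "C \<in> L1_loc P" by auto
    have "AE x in lebesgue_on {0..}. conv_defined_at P a f x" using def by simp
    from laplace_convolution[OF this CL] conv0_L1_loc[OF CL] def
    show "(\<forall>x\<in>{0..}. conv_defined_at P a f x) \<and>
      conv0 P a f \<in> L1_loc P \<and>
      laplace_exists {cmod} a l \<and> laplace_exists P f l \<and> laplace_exists P (conv0 P a f) l \<and>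
      laplace P (conv0 P a f) l = laplace {cmod} a l *\<^sub>C laplace P f l"
      by blast
  qed
qed

end
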